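(* Let $T>0$ and let $N,M\ge 1$ be integers. Let $H_j:\mathbb{R}^N\times\mathbb{R}^N\times\mathbb{R}^M\times\mathbb{R}^N\to\mathbb{R}$, $j=1,\dots,M$, be continuous functions satisfying the structural assumptions (S) and the monotonicity condition (Mon) stated in the context, and let $u_0=(u_{0,1},\dots,u_{0,M}):\mathbb{R}^N\to\mathbb{R}^M$ be bounded and uniformly continuous. For $\varepsilon>0$ let $u^\varepsilon=(u^\varepsilon_1,\dots,u^\varepsilon_M)\in BUC(\mathbb{R}^N\times[0,T])$ be the viscosity solution of $$\begin{cases}\dfrac{\partial u^\varepsilon_i}{\partial t}+H_i\left(x,\dfrac{x}{\varepsilon},u^\varepsilon,Du^\varepsilon_i\right)=0 & (x,t)\in\mathbb{R}^N\times(0,T],\\ u^\varepsilon_i(x,0)=u_{0,i}(x) & x\in\mathbb{R}^N,\end{cases}\qquad i=1,\dots,M.$$ Then, as $\varepsilon\to0$, $u^\varepsilon$ converges locally uniformly on $\mathbb{R}^N\times[0,T]$ to the viscosity solution $u=(u_1,\dots,u_M)\in BUC(\mathbb{R}^N\times[0,T])$ of $$\begin{cases}\dfrac{\partial u_i}{\partial t}+\overline H_i(x,u,Du_i)=0 & (x,t)\in\mathbb{R}^N\times(0,T],\\ u_i(x,0)=u_{0,i}(x) & x\in\mathbb{R}^N,\end{cases}\qquad i=1,\dots,M,$$ where $\overline H_1,\dots,\overline H_M$ are the effective Hamiltonians defined in the context.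
   Context: A modulus of continuity is a nondecreasing continuous function $\omega:[0,\infty)\to[0,\infty)$ with $\omega(0)=0$. $BUC$ means bounded and uniformly continuous (componentwise for vector-valued functions). $B_N(0,R)$ is the ball of $\mathbb{R}^N$ of center $0$ and radius $R$. $\mathbb{T}^N=[0,1]^N$; periodic means $\mathbb{Z}^N$-periodic. Assumptions (S), for every $j=1,\dots,M$: (i) $H_j(x,y,r,p)$ is $\mathbb{Z}^N$-periodic in $y$ for any $(x,r,p)$; (ii) $\lim_{|p|\to+\infty}H_j(x,y,r,p)=+\infty$ uniformly in $(x,y,r)$; (iii) for all $R>0$, $H_j\in BUC(\mathbb{R}^N\times\mathbb{R}^N\times[-R,R]^M\times B_N(0,R))$; (iv) there exists a modulus of continuity $\omega$ such that $|H_j(x_1,y_1,r,p)-H_j(x_2,y_2,r,p)|\le\omega\big((1+|p|)(|x_1-x_2|+|y_1-y_2|)\big)$ for every $x_1,x_2,y_1,y_2,p\in\mathbb{R}^N$ and $r\in\mathbb{R}^M$. Condition (Mon): for every $j\in\{1,\dots,M\}$, if $r,s\in\mathbb{R}^M$ and $r_j-s_j=\max_{k=1,\dots,M}\{r_k-s_k\}\ge0$, then $H_j(x,y,r,p)-H_j(x,y,s,p)\ge0$ for all $x,y,p\in\mathbb{R}^N$. Effective Hamiltonians: for $i\in\{1,\dots,M\}$ and $(x,r,p)\in\mathbb{R}^N\times\mathbb{R}^M\times\mathbb{R}^N$, $\overline H_i(x,r,p)$ is the unique real number $\lambda$ such that the equation $H_i(x,y,r,p+Dv(y))=\lambda$,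 $y\in\mathbb{T}^N$, admits a Lipschitz continuous $\mathbb{Z}^N$-periodic viscosity solution $v$ (such a unique $\lambda$ exists under (S)). Viscosity solutions of systems: let $G_i:\mathbb{R}^N\times[0,T]\times\mathbb{R}^M\times\mathbb{R}^N\to\mathbb{R}$ be continuous and consider $\partial_t u_i+G_i(x,t,u,Du_i)=0$ in $\mathbb{R}^N\times(0,T]$, $u_i(\cdot,0)=u_{0,i}$, $i=1,\dots,M$. An upper semicontinuous (componentwise) $u:\mathbb{R}^N\times[0,T]\to\mathbb{R}^M$ is a viscosity subsolution if $u_i(\cdot,0)\le u_{0,i}$ for all $i$ and, whenever $\phi\in C^1$, $i\in\{1,\dots,M\}$ and $u_i-\phi$ attains a local maximum (relative to $\mathbb{R}^N\times[0,T]$) at $(x,t)$ with $t>0$, then $\partial_t\phi(x,t)+G_i(x,t,u(x,t),D\phi(x,t))\le0$. A lower semicontinuous $v$ is a viscosity supersolution if $v_i(\cdot,0)\ge u_{0,i}$ for all $i$ and, whenever $\phi\in C^1$ and $v_i-\phi$ attains a local minimum at $(x,t)$ with $t>0$, then $\partial_t\phi(x,t)+G_i(x,t,v(x,t),D\phi(x,t))\ge0$. A continuous function is a viscosity solution if it is both. For the oscillating system $G_i(x,t,r,p)=H_i(x,x/\varepsilon,r,p)$; for the limit system $G_i(x,t,r,p)=\overline H_i(x,r,p)$. *)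

theory Defs
  imports "HOL-Analysis.Analysis"
begin

text \<open>
  Space dimension \<open>N = CARD('n)\<close>, number of equations \<open>M = CARD('m)\<close>; both are at least 1 since
  types are nonempty. A Hamiltonian is curried as \<open>H j x y r p\<close>, and functions of space and time
  take a pair \<open>(x, t)\<close>. Only their values on the strip \<open>\<real>\<^sup>N \<times> [0,T]\<close> are relevant.
\<close>

definition strip :: "real \<Rightarrow> ((real^'n) \<times> real) set" where
  "strip T = UNIV \<times> {0..T}"

definition BUC_on :: "'a::metric_space set \<Rightarrow> ('a \<Rightarrow> 'b::metric_space) \<Rightarrow> bool" where
  "BUC_on S f \<longleftrightarrow> bounded (f ` S) \<and> uniformly_continuous_on S f"

definition modulus_of_continuity :: "(real \<Rightarrow> real) \<Rightarrow> bool" where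
  "modulus_of_continuity \<omega> \<longleftrightarrow>
     mono_on {0..} \<omega> \<and> continuous_on {0..} \<omega> \<and> (\<forall>s\<ge>0. \<omega> s \<ge> 0) \<and> \<omega> 0 = 0"

definition Z_periodic :: "(real^'n \<Rightarrow> 'b) \<Rightarrow> bool" where
  "Z_periodic f \<longleftrightarrow> (\<forall>y k. (\<forall>i. k $ i \<in> \<int>) \<longrightarrow> f (y + k) = f y)"

definition usc_on :: "'a::topological_space set \<Rightarrow> ('a \<Rightarrow> real) \<Rightarrow> bool" where
  "usc_on S f \<longleftrightarrow> (\<forall>z\<in>S. \<forall>a. f z < a \<longrightarrow> (\<forall>\<^sub>F w in at z within S. f w < a))"

definition lsc_on :: "'a::topological_space set \<Rightarrow> ('a \<Rightarrow> real) \<Rightarrow> bool" where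
  "lsc_on S f \<longleftrightarrow> (\<forall>z\<in>S. \<forall>a. a < f z \<longrightarrow> (\<forall>\<^sub>F w in at z within S. a < f w))"

definition local_max_on :: "'a::topological_space set \<Rightarrow> ('a \<Rightarrow> real) \<Rightarrow> 'a \<Rightarrow> bool" where
  "local_max_on S f z \<longleftrightarrow> z \<in> S \<and> (\<forall>\<^sub>F w in at z within S. f w \<le> f z)"

definition local_min_on :: "'a::topological_space set \<Rightarrow> ('a \<Rightarrow> real) \<Rightarrow> 'a \<Rightarrow> bool" where
  "local_min_on S f z \<longleftrightarrow> z \<in> S \<and> (\<forall>\<^sub>F w in at z within S. f z \<le> f w)"

definition C1_with_gradient :: "('a::real_inner \<Rightarrow> real) \<Rightarrow> ('a \<Rightarrow> 'a) \<Rightarrow> bool" where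
  "C1_with_gradient \<phi> g \<longleftrightarrow> (\<forall>z. GDERIV \<phi> z :> g z) \<and> continuous_on UNIV g"


section \<open>Viscosity solutions\<close>

text \<open>
  Cauchy problem \<open>\<partial>\<^sub>t u\<^sub>i + G i x t u (D u\<^sub>i) = 0\<close>, \<open>u\<^sub>i(\<cdot>,0) = u0\<^sub>i\<close>. For a test function \<open>\<phi>\<close> on
  space-time with gradient \<open>g\<close>, \<open>fst (g (x,t))\<close> is \<open>D\<phi>(x,t)\<close> and \<open>snd (g (x,t))\<close> is
  \<open>\<partial>\<^sub>t\<phi>(x,t)\<close>. The terminal time \<open>t = T\<close> is allowed in the tests.
\<close>

definition visc_subsolution ::
  "('m::finite \<Rightarrow> real^'n \<Rightarrow> real \<Rightarrow> real^'m \<Rightarrow> real^'n \<Rightarrow> real) \<Rightarrow> real \<Rightarrow> (real^'n \<Rightarrow> real^'m) \<Rightarrow>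
   ((real^'n) \<times> real \<Rightarrow> real^'m) \<Rightarrow> bool" where
  "visc_subsolution G T u0 u \<longleftrightarrow>
     (\<forall>i. usc_on (strip T) (\<lambda>z. u z $ i)) \<and>
     (\<forall>i x. u (x, 0) $ i \<le> u0 x $ i) \<and>
     (\<forall>\<phi> g i x t. C1_with_gradient \<phi> g \<and> t > 0 \<and>
        local_max_on (strip T) (\<lambda>z. u z $ i - \<phi> z) (x, t) \<longrightarrow>
        snd (g (x, t)) + G i x t (u (x, t)) (fst (g (x, t))) \<le> 0)"

definition visc_supersolution ::
  "('m::finite \<Rightarrow> real^'n \<Rightarrow> real \<Rightarrow> real^'m \<Rightarrow> real^'n \<Rightarrow> real) \<Rightarrow> real \<Rightarrow> (real^'n \<Rightarrow> real^'m) \<Rightarrow>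
   ((real^'n) \<times> real \<Rightarrow> real^'m) \<Rightarrow> bool" where
  "visc_supersolution G T u0 v \<longleftrightarrow>
     (\<forall>i. lsc_on (strip T) (\<lambda>z. v z $ i)) \<and>
     (\<forall>i x. v (x, 0) $ i \<ge> u0 x $ i) \<and>
     (\<forall>\<phi> g i x t. C1_with_gradient \<phi> g \<and> t > 0 \<and>
        local_min_on (strip T) (\<lambda>z. v z $ i - \<phi> z) (x, t) \<longrightarrow>
        snd (g (x, t)) + G i x t (v (x, t)) (fst (g (x, t))) \<ge> 0)"

definition visc_solution ::
  "('m::finite \<Rightarrow> real^'n \<Rightarrow> real \<Rightarrow> real^'m \<Rightarrow> real^'n \<Rightarrow> real) \<Rightarrow> real \<Rightarrow> (real^'n \<Rightarrow> real^'m) \<Rightarrow>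
   ((real^'n) \<times> real \<Rightarrow> real^'m) \<Rightarrow> bool" where
  "visc_solution G T u0 u \<longleftrightarrow>
     continuous_on (strip T) u \<and> visc_subsolution G T u0 u \<and> visc_supersolution G T u0 u"

text \<open>
  Viscosity solutions of the stationary equation \<open>F y (D v y) = c\<close>. Functions on the torus are
  periodic functions on \<open>\<real>\<^sup>N\<close>, so the equation is tested on all of \<open>\<real>\<^sup>N\<close>.
\<close>

definition stationary_visc_solution ::
  "(real^'n \<Rightarrow> real^'n \<Rightarrow> real) \<Rightarrow> real \<Rightarrow> (real^'n \<Rightarrow> real) \<Rightarrow> bool" where
  "stationary_visc_solution F c v \<longleftrightarrow>
     continuous_on UNIV v \<and>
     (\<forall>\<phi> g y. C1_with_gradient \<phi> g \<and> local_max_on UNIV (\<lambda>z. v z - \<phi> z) y \<longrightarrow> F y (g y) \<le> c) \<and>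
     (\<forall>\<phi> g y. C1_with_gradient \<phi> g \<and> local_min_on UNIV (\<lambda>z. v z - \<phi> z) y \<longrightarrow> F y (g y) \<ge> c)"


section \<open>Assumptions on the Hamiltonians\<close>

definition structural_S ::
  "('m::finite \<Rightarrow> real^'n \<Rightarrow> real^'n \<Rightarrow> real^'m \<Rightarrow> real^'n \<Rightarrow> real) \<Rightarrow> bool" where
  "structural_S H \<longleftrightarrow> (\<forall>j.
     (\<forall>x r p. Z_periodic (\<lambda>y. H j x y r p)) \<and>
     (\<forall>K. \<exists>R. \<forall>x y r p. norm p \<ge> R \<longrightarrow> H j x y r p \<ge> K) \<and>
     (\<forall>R>0. BUC_on (UNIV \<times> UNIV \<times> {r. \<forall>k. r $ k \<in> {-R..R}} \<times> ball 0 R)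
                   (\<lambda>(x, y, r, p). H j x y r p)) \<and>
     (\<exists>\<omega>. modulus_of_continuity \<omega> \<and>
        (\<forall>x1 x2 y1 y2 r p. \<bar>H j x1 y1 r p - H j x2 y2 r p\<bar>
            \<le> \<omega> ((1 + norm p) * (norm (x1 - x2) + norm (y1 - y2))))))"

definition Mon ::
  "('m::finite \<Rightarrow> real^'n \<Rightarrow> real^'n \<Rightarrow> real^'m \<Rightarrow> real^'n \<Rightarrow> real) \<Rightarrow> bool" where
  "Mon H \<longleftrightarrow> (\<forall>j r s.
     r $ j - s $ j = Max (range (\<lambda>k. r $ k - s $ k)) \<and> r $ j - s $ j \<ge> 0 \<longrightarrow>
     (\<forall>x y p. H j x y r p - H j x y s p \<ge> 0))"

definition effective_hamiltonian ::
  "('m::finite \<Rightarrow> real^'n \<Rightarrow> real^'n \<Rightarrow> real^'m \<Rightarrow> real^'n \<Rightarrow> real) \<Rightarrow>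
   'm \<Rightarrow> real^'n \<Rightarrow> real^'m \<Rightarrow> real^'n \<Rightarrow> real" where
  "effective_hamiltonian H i x r p =
     (THE c. \<exists>v. (\<exists>L. L-lipschitz_on UNIV v) \<and> Z_periodic v \<and>
                 stationary_visc_solution (\<lambda>y q. H i x y r (p + q)) c v)"

text \<open>The nonlinearities \<open>G i x t r p\<close> of the oscillating and of the limit Cauchy problem.\<close>

definition oscillating_G ::
  "('m::finite \<Rightarrow> real^'n \<Rightarrow> real^'n \<Rightarrow> real^'m \<Rightarrow> real^'n \<Rightarrow> real) \<Rightarrow> real \<Rightarrow>
   'm \<Rightarrow> real^'n \<Rightarrow> real \<Rightarrow> real^'m \<Rightarrow> real^'n \<Rightarrow> real" where
  "oscillating_G H \<epsilon> i x t r p = H i x (x /\<^sub>R \<epsilon>) r p"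

definition limit_G ::
  "('m::finite \<Rightarrow> real^'n \<Rightarrow> real^'n \<Rightarrow> real^'m \<Rightarrow> real^'n \<Rightarrow> real) \<Rightarrow>
   'm \<Rightarrow> real^'n \<Rightarrow> real \<Rightarrow> real^'m \<Rightarrow> real^'n \<Rightarrow> real" where
  "limit_G H i x t r p = effective_hamiltonian H i x r p"

end

theory Submission
  imports Defs "HOL-Complex_Analysis.Great_Picard"
begin

text \<open>
  Correctors are obtained by solving \<open>\<delta> v + F(y, Dv) = 0\<close> with Perron's method and letting
  \<open>\<delta>\<close> tend to 0. Comparing correctors shows that the effective Hamiltonians inherit coercivity,
  monotonicity and local uniform continuity. In the comparison principle for the systems the variables
  are doubled with a fixed penalization in time: coercivity then bounds the gradients in the space
  penalization, and (Mon) applies because the maximum is also taken over the index. The same argument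
  applied to one solution, together with barriers at the initial time, gives a modulus of continuity of
  \<open>u\<^sup>\<epsilon>\<close> independent of \<open>\<epsilon>\<close>. By compactness and the perturbed test function method every
  sequence has a subsequence converging to a solution of the limit system, which is unique.
\<close>

section \<open>Superdifferentials\<close>

text \<open>One comparison argument has to serve two systems: the oscillating one, for estimates
  independent of \<epsilon>, and the limit one, for uniqueness. It therefore rests on properties
  that pass from \<open>H\<close> to the effective Hamiltonians through the cell problem. Since
  \<open>u0\<close> is only uniformly continuous, Lipschitz bounds for the solutions cannot be
  expected. Moduli appear instead as one estimate for each tolerance \<open>e\<close>, of the form
  \<open>e + (t - s)^2 / \<eta>\<close> in time and \<open>e + L * norm (x - y)\<close> in space, up
  to factors of \<open>e\<close>. All tests are recorded as sets of gradients, which can be followed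
  through limits; supersolutions are tested through \<open>superdiff\<close> of the negated
  function. Lemmas on subsolutions thus cover supersolutions by reflection. Reflection destroys
  coercivity, so the space modulus comes from the subsolution property alone, used with the two
  points exchanged. Equicontinuity makes convergence uniform on compact sets, so limits are
  continuous and comparison of bounded uniformly continuous functions suffices.\<close>

definition superdiff :: "'a::real_inner set \<Rightarrow> ('a \<Rightarrow> real) \<Rightarrow> 'a \<Rightarrow> 'a set" where
  "superdiff S f z =
     {q. \<exists>\<phi> g. C1_with_gradient \<phi> g \<and> local_max_on S (\<lambda>w. f w - \<phi> w) z \<and> g z = q}"

section \<open>Calculus of continuously differentiable test functions\<close>

lemma C1_const: "C1_with_gradient (\<lambda>z. c) (\<lambda>z. 0)"
  by (simp add: C1_with_gradient_def GDERIV_const)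

lemma C1_minus: "C1_with_gradient \<phi> g \<Longrightarrow> C1_with_gradient (\<lambda>z. - \<phi> z) (\<lambda>z. - g z)"
  by (simp add: C1_with_gradient_def GDERIV_minus continuous_on_minus)

lemma C1_add:
  "C1_with_gradient \<phi> g \<Longrightarrow> C1_with_gradient \<psi> h \<Longrightarrow>
   C1_with_gradient (\<lambda>z. \<phi> z + \<psi> z) (\<lambda>z. g z + h z)"
  by (simp add: C1_with_gradient_def GDERIV_add continuous_on_add)

lemma C1_diff:
  "C1_with_gradient \<phi> g \<Longrightarrow> C1_with_gradient \<psi> h \<Longrightarrow>
   C1_with_gradient (\<lambda>z. \<phi> z - \<psi> z) (\<lambda>z. g z - h z)"
  by (simp add: C1_with_gradient_def GDERIV_diff continuous_on_diff)

lemma C1_scale: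
  "C1_with_gradient \<phi> g \<Longrightarrow> C1_with_gradient (\<lambda>z. c * \<phi> z) (\<lambda>z. c *\<^sub>R g z)"
  using GDERIV_mult[OF GDERIV_const, of \<phi> _ _ c]
  by (simp add: C1_with_gradient_def continuous_on_scaleR)

lemma C1_norm_squared:
  "C1_with_gradient (\<lambda>z. (norm (z - a))\<^sup>2) (\<lambda>z. 2 *\<^sub>R (z - a))"
proof -
  have "GDERIV (\<lambda>z. (norm (z - a))\<^sup>2) z :> 2 *\<^sub>R (z - a)" for z
    unfolding gderiv_def power2_norm_eq_inner
    by (rule derivative_eq_intros refl)+ (auto simp: fun_eq_iff inner_commute algebra_simps)
  then show ?thesis
    by (auto simp: C1_with_gradient_def intro!: continuous_intros)
qed

text \<open>A smooth stand-in for the cone \<open>norm (z - a)\<close>: its gradient has norm below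
  1, and the error is at most \<kappa>. With \<open>\<kappa> = 1\<close> it also serves as
  penalization at infinity and as spatial part of barriers.\<close>

lemma C1_sqrt_norm:
  assumes "\<kappa> > 0"
  shows "C1_with_gradient (\<lambda>z. sqrt (\<kappa>\<^sup>2 + (norm (z - a))\<^sup>2))
           (\<lambda>z. (1 / sqrt (\<kappa>\<^sup>2 + (norm (z - a))\<^sup>2)) *\<^sub>R (z - a))"
proof -
  have pos: "\<kappa>\<^sup>2 + (norm (z - a))\<^sup>2 > 0" for z
    using assms by (simp add: add_pos_nonneg)
  have "GDERIV (\<lambda>z. sqrt (\<kappa>\<^sup>2 + (norm (z - a))\<^sup>2)) z
          :> (1 / sqrt (\<kappa>\<^sup>2 + (norm (z - a))\<^sup>2)) *\<^sub>R (z - a)" for z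
  proof -
    have "GDERIV (\<lambda>z. \<kappa>\<^sup>2 + (norm (z - a))\<^sup>2) z :> 2 *\<^sub>R (z - a)"
      using C1_add[OF C1_const[of "\<kappa>\<^sup>2"] C1_norm_squared[of a]] by (simp add: C1_with_gradient_def)
    from GDERIV_DERIV_compose[OF this DERIV_real_sqrt[OF pos]] show ?thesis
      by (simp add: field_simps)
  qed
  moreover have "sqrt (\<kappa>\<^sup>2 + (norm (z - a))\<^sup>2) \<noteq> 0" for z
    using pos[of z] by (metis less_irrefl real_sqrt_eq_zero_cancel_iff)
  ultimately show ?thesis
    unfolding C1_with_gradient_def by (intro conjI allI continuous_intros) auto
qed

text \<open>Space-time test functions below are sums of a function of \<open>x\<close> and a
  function of \<open>t\<close>; this rule and its counterpart for \<open>snd\<close> put their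
  gradients into the two slots.\<close>

lemma C1_fst:
  fixes \<phi> :: "'c::real_inner \<Rightarrow> real"
  assumes "C1_with_gradient \<phi> g"
  shows "C1_with_gradient (\<lambda>z :: 'c \<times> 'd::real_inner. \<phi> (fst z)) (\<lambda>z :: 'c \<times> 'd. (g (fst z), 0))"
proof -
  have "GDERIV (\<lambda>z :: 'c \<times> 'd. \<phi> (fst z)) z :> (g (fst z), 0)" for z
  proof -
    have "(\<phi> has_derivative (\<lambda>h. inner h (g (fst z)))) (at (fst z))"
      using assms by (simp add: C1_with_gradient_def gderiv_def)
    from has_derivative_compose[OF has_derivative_fst[OF has_derivative_ident] this]
    show ?thesis by (simp add: gderiv_def inner_prod_def)
  qed
  moreover have "continuous_on UNIV (\<lambda>z :: 'c \<times> 'd. (g (fst z), 0))"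
  proof (intro continuous_on_Pair continuous_on_const)
    show "continuous_on UNIV (\<lambda>z :: 'c \<times> 'd. g (fst z))"
      by (rule continuous_on_compose2[of UNIV g])
        (use assms in \<open>auto simp: C1_with_gradient_def intro: continuous_on_fst continuous_on_id\<close>)
  qed
  ultimately show ?thesis by (simp add: C1_with_gradient_def)
qed

lemma C1_snd:
  fixes \<phi> :: "'c::real_inner \<Rightarrow> real"
  assumes "C1_with_gradient \<phi> g"
  shows "C1_with_gradient (\<lambda>z :: 'd::real_inner \<times> 'c. \<phi> (snd z)) (\<lambda>z :: 'd \<times> 'c. (0, g (snd z)))"
proof -
  have "GDERIV (\<lambda>z :: 'd::real_inner \<times> 'c. \<phi> (snd z)) z :> (0, g (snd z))" for z
  proof -
    have "(\<phi> has_derivative (\<lambda>h. inner h (g (snd z)))) (at (snd z))"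
      using assms by (simp add: C1_with_gradient_def gderiv_def)
    from has_derivative_compose[OF has_derivative_snd[OF has_derivative_ident] this]
    show ?thesis by (simp add: gderiv_def inner_prod_def)
  qed
  moreover have "continuous_on UNIV (\<lambda>z :: 'd \<times> 'c. (0, g (snd z)))"
  proof (intro continuous_on_Pair continuous_on_const)
    show "continuous_on UNIV (\<lambda>z :: 'd \<times> 'c. g (snd z))"
      by (rule continuous_on_compose2[of UNIV g])
        (use assms in \<open>auto simp: C1_with_gradient_def intro: continuous_on_snd continuous_on_id\<close>)
  qed
  ultimately show ?thesis by (simp add: C1_with_gradient_def)
qed

lemma C1_linear: "C1_with_gradient (\<lambda>t::real. c * t) (\<lambda>t. c)"
  unfolding C1_with_gradient_def by (auto intro!: derivative_eq_intros)

lemma C1_continuous: "C1_with_gradient \<phi> g \<Longrightarrow> continuous_on A \<phi>"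
  unfolding C1_with_gradient_def gderiv_def
  by (meson continuous_at_imp_continuous_on has_derivative_continuous)

section \<open>Rules for superdifferentials\<close>

lemma superdiffI:
  assumes "C1_with_gradient \<phi> g" "z \<in> S" "\<And>w. w \<in> S \<Longrightarrow> f w - \<phi> w \<le> f z - \<phi> z" "g z = q"
  shows "q \<in> superdiff S f z"
  using assms unfolding superdiff_def local_max_on_def
  by (auto simp: eventually_at_filter intro!: exI[of _ \<phi>] exI[of _ g])

lemma superdiffE:
  assumes "q \<in> superdiff S f z"
  obtains \<phi> g where "C1_with_gradient \<phi> g" "local_max_on S (\<lambda>w. f w - \<phi> w) z" "g z = q"
  using assms by (auto simp: superdiff_def)

lemma superdiff_add_C1:
  assumes "q \<in> superdiff S (\<lambda>w. f w + \<psi> w) z" "C1_with_gradient \<psi> h"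
  shows "q - h z \<in> superdiff S f z"
proof -
  obtain \<phi> g where \<phi>: "C1_with_gradient \<phi> g"
    "local_max_on S (\<lambda>w. f w + \<psi> w - \<phi> w) z" "g z = q"
    using assms(1) by (auto simp: superdiff_def)
  have "local_max_on S (\<lambda>w. f w - (\<phi> w - \<psi> w)) z"
    using \<phi>(2) by (simp add: algebra_simps)
  with C1_diff[OF \<phi>(1) assms(2)] \<phi>(3) show ?thesis
    unfolding superdiff_def by blast
qed

text \<open>A function touching \<open>f\<close> from above at \<open>z\<close> also touches
  everything that lies below \<open>f\<close> and agrees with it at \<open>z\<close>. This serves
  when a maximum is known for an upper envelope (a Perron bump, a sup-convolution) and the equation
  only for a competitor below it.\<close>

lemma superdiff_touch:
  assumes "q \<in> superdiff S f z" "\<forall>\<^sub>F w in at z within S. f' w \<le> f w" "f' z = f z"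
  shows "q \<in> superdiff S f' z"
proof -
  obtain \<phi> g where \<phi>: "C1_with_gradient \<phi> g" "local_max_on S (\<lambda>w. f w - \<phi> w) z" "g z = q"
    using assms(1) by (auto simp: superdiff_def)
  have "\<forall>\<^sub>F w in at z within S. f w - \<phi> w \<le> f z - \<phi> z" and zS: "z \<in> S"
    using \<phi>(2) by (auto simp: local_max_on_def)
  with assms(2) have "\<forall>\<^sub>F w in at z within S. f' w - \<phi> w \<le> f' z - \<phi> z"
    using assms(3) by (auto elim: eventually_elim2)
  with zS have "local_max_on S (\<lambda>w. f' w - \<phi> w) z"
    by (simp add: local_max_on_def)
  with \<phi> show ?thesis unfolding superdiff_def by blast
qed

text \<open>The gradient of \<open>\<psi> - \<phi>\<close> vanishes at an interior maximum. On the
  strip this would fail at the final time, where the time derivative is constrained from one side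
  only.\<close>

lemma superdiff_C1:
  assumes "q \<in> superdiff UNIV \<psi> z" "C1_with_gradient \<psi> h"
  shows "q = h z"
proof -
  obtain \<phi> g where \<phi>: "C1_with_gradient \<phi> g" "local_max_on UNIV (\<lambda>w. \<psi> w - \<phi> w) z" "g z = q"
    using assms(1) by (auto simp: superdiff_def)
  obtain U where U: "open U" "z \<in> U" "\<forall>w\<in>U. \<psi> w - \<phi> w \<le> \<psi> z - \<phi> z"
    using \<phi>(2) unfolding local_max_on_def eventually_at_topological by (metis UNIV_I order_refl)
  have "((\<lambda>w. \<psi> w - \<phi> w) has_derivative (\<lambda>k. inner k (h z - g z))) (at z)"
    using C1_diff[OF assms(2) \<phi>(1)] by (simp add: C1_with_gradient_def gderiv_def)
  from differential_zero_maxmin[OF U(2,1) this] U(3)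
  have "inner k (h z - g z) = 0" for k by (meson)
  then have "h z - g z = 0" by (metis inner_eq_zero_iff)
  with \<phi>(3) show ?thesis by simp
qed

text \<open>Far points are only compared with the single value \<open>f z1\<close>; the compact set
  is enlarged to contain \<open>z1\<close>, so its maximum dominates them too.\<close>

lemma attains_max_coercive:
  fixes f :: "'a::euclidean_space \<Rightarrow> real"
  assumes "closed S" "continuous_on S f" "z1 \<in> S"
    and far: "\<And>z. z \<in> S \<Longrightarrow> norm z > R \<Longrightarrow> f z \<le> f z1"
  obtains z where "z \<in> S" "\<And>w. w \<in> S \<Longrightarrow> f w \<le> f z"
proof -
  let ?K = "S \<inter> cball 0 (max R (norm z1))"
  have "compact ?K" using assms(1) by (simp add: closed_Int_compact)
  moreover have "z1 \<in> ?K" using assms(3) by simp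
  ultimately obtain z where z: "z \<in> ?K" "\<forall>w\<in>?K. f w \<le> f z"
    using continuous_attains_sup[of ?K f] continuous_on_subset[OF assms(2), of ?K] by blast
  show thesis
  proof (rule that[of z])
    show "z \<in> S" using z by simp
    fix w assume "w \<in> S"
    show "f w \<le> f z"
    proof (cases "norm w > R")
      case True
      with far \<open>w \<in> S\<close> have "f w \<le> f z1" by blast
      also have "\<dots> \<le> f z" using z \<open>z1 \<in> ?K\<close> by blast
      finally show ?thesis .
    next
      case False
      with z \<open>w \<in> S\<close> show ?thesis by auto
    qed
  qed
qed

text \<open>Adding \<open>(norm (w - z0))^2\<close> to the test function makes the maximum strict
  without changing the gradient at \<open>z0\<close>, so maximizers for \<open>fn n\<close> converge
  to \<open>z0\<close>. Besides convergence at \<open>z0\<close> only the one-sided bound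
  \<open>up\<close> enters, which is what a maximizing sequence in Perron's method provides.\<close>

lemma superdiff_stable:
  fixes f :: "'a::euclidean_space \<Rightarrow> real"
  assumes S: "closed S" and f: "continuous_on S f" and fn: "\<And>n. continuous_on S (fn n)"
    and z0: "z0 \<in> S" and conv: "(\<lambda>n. fn n z0) \<longlonglongrightarrow> f z0"
    and up: "\<And>K e. compact K \<Longrightarrow> K \<subseteq> S \<Longrightarrow> e > 0 \<Longrightarrow> \<forall>\<^sub>F n in sequentially. \<forall>z\<in>K. fn n z \<le> f z + e"
    and q: "q \<in> superdiff S f z0"
  obtains zs qs where "\<forall>\<^sub>F n in sequentially. qs n \<in> superdiff S (fn n) (zs n)"
    "\<And>n. zs n \<in> S" "zs \<longlonglongrightarrow> z0" "qs \<longlonglongrightarrow> q" "(\<lambda>n. fn n (zs n)) \<longlonglongrightarrow> f z0"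
proof -
  obtain \<phi> g where \<phi>: "C1_with_gradient \<phi> g" "local_max_on S (\<lambda>w. f w - \<phi> w) z0" "g z0 = q"
    using q by (auto simp: superdiff_def)
  obtain d where d: "d > 0" "\<And>w. w \<in> S \<Longrightarrow> dist w z0 < d \<Longrightarrow> f w - \<phi> w \<le> f z0 - \<phi> z0"
    using \<phi>(2) unfolding local_max_on_def eventually_at by (metis order_refl)
  \<comment> \<open>Half the radius leaves room around \<open>z0\<close>: maximizers over
    \<open>K\<close> close to \<open>z0\<close> are local maximizers relative to
    \<open>S\<close>.\<close>
  define K where "K = S \<inter> cball z0 (d/2)"
  have K: "compact K" "z0 \<in> K" "K \<subseteq> S"
    using S z0 d(1) by (auto simp: K_def closed_Int_compact)
  define \<psi> where "\<psi> w = \<phi> w + (norm (w - z0))\<^sup>2" for w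
  define h where "h w = g w + 2 *\<^sub>R (w - z0)" for w
  have \<psi>: "C1_with_gradient \<psi> h"
    unfolding \<psi>_def h_def by (intro C1_add \<phi>(1) C1_norm_squared)
  have "\<exists>z\<in>K. \<forall>w\<in>K. fn n w - \<psi> w \<le> fn n z - \<psi> z" for n
  proof (rule continuous_attains_sup)
    show "compact K" "K \<noteq> {}" using K by auto
    show "continuous_on K (\<lambda>w. fn n w - \<psi> w)"
      by (intro continuous_on_diff continuous_on_subset[OF fn K(3)] C1_continuous[OF \<psi>])
  qed
  then obtain zs where zs: "\<And>n. zs n \<in> K" "\<And>n w. w \<in> K \<Longrightarrow> fn n w - \<psi> w \<le> fn n (zs n) - \<psi> (zs n)"
    by metis
  \<comment> \<open>Comparing the maximizer with \<open>z0\<close> leaves the quadratic term bounded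
    by the two approximation errors, one from \<open>up\<close> and one at
    \<open>z0\<close>.\<close>
  have est: "\<forall>\<^sub>F n in sequentially. (norm (zs n - z0))\<^sup>2 \<le> 2 * e" if "e > 0" for e
  proof -
    have "\<forall>\<^sub>F n in sequentially. \<bar>fn n z0 - f z0\<bar> < e"
      using tendstoD[OF conv that] by (simp add: dist_real_def)
    with up[OF K(1,3) that] show ?thesis
    proof eventually_elim
      case (elim n)
      have "f (zs n) - \<phi> (zs n) \<le> f z0 - \<phi> z0"
        using d zs(1)[of n] by (intro d(2)) (auto simp: K_def dist_commute)
      moreover have "fn n z0 - \<phi> z0 \<le> fn n (zs n) - \<phi> (zs n) - (norm (zs n - z0))\<^sup>2"
        using zs(2)[OF K(2), of n] by (simp add: \<psi>_def)
      moreover have "fn n (zs n) \<le> f (zs n) + e" using elim(1) zs(1) by blast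
      ultimately show ?case using elim(2) by linarith
    qed
  qed
  have lim: "zs \<longlonglongrightarrow> z0"
  proof (rule tendstoI)
    fix e :: real assume "e > 0"
    then have "e\<^sup>2/4 > 0" by simp
    from est[OF this] show "\<forall>\<^sub>F n in sequentially. dist (zs n) z0 < e"
    proof eventually_elim
      case (elim n)
      then have "(norm (zs n - z0))\<^sup>2 < e\<^sup>2" using zero_less_power[OF \<open>e > 0\<close>, of 2] by linarith
      then show ?case using \<open>e > 0\<close> by (simp add: dist_norm power2_less_imp_less)
    qed
  qed
  have zS: "zs n \<in> S" for n using zs(1) K(3) by blast
  have fz: "(\<lambda>n. f (zs n)) \<longlonglongrightarrow> f z0"
    by (rule continuous_on_tendsto_compose[OF f lim z0]) (simp add: zS)
  have \<psi>z: "(\<lambda>n. \<psi> (zs n)) \<longlonglongrightarrow> \<psi> z0"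
    by (rule continuous_on_tendsto_compose[OF C1_continuous[OF \<psi>, of UNIV] lim]) auto
  have val: "(\<lambda>n. fn n (zs n)) \<longlonglongrightarrow> f z0"
  proof (rule tendstoI)
    fix e :: real assume e: "e > 0"
    then have e2: "e/2 > 0" by simp
    show "\<forall>\<^sub>F n in sequentially. dist (fn n (zs n)) (f z0) < e"
      using up[OF K(1,3) e2] tendstoD[OF fz e2] tendstoD[OF \<psi>z e2] tendstoD[OF conv e2]
    proof eventually_elim
      case (elim n)
      have "fn n z0 - \<psi> z0 \<le> fn n (zs n) - \<psi> (zs n)" using zs(2) K(2) by blast
      moreover have "fn n (zs n) \<le> f (zs n) + e/2" using elim(1) zs(1) by blast
      ultimately show ?case using elim(2-4) by (simp add: dist_real_def abs_if split: if_splits)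
    qed
  qed
  have "\<forall>\<^sub>F n in sequentially. h (zs n) \<in> superdiff S (fn n) (zs n)"
    using tendstoD[OF lim half_gt_zero[OF d(1)]]
  proof eventually_elim
    case (elim n)
    then have din: "dist (zs n) z0 < d/2" by simp
    have "local_max_on S (\<lambda>w. fn n w - \<psi> w) (zs n)"
      unfolding local_max_on_def eventually_at
    proof (intro conjI zS exI[of _ "d/2 - dist (zs n) z0"] ballI impI)
      fix w assume w: "w \<in> S" "w \<noteq> zs n \<and> dist w (zs n) < d/2 - dist (zs n) z0"
      then have "dist w z0 < d/2" using dist_triangle[of w z0 "zs n"] by linarith
      then have "w \<in> K" using w by (simp add: K_def dist_commute)
      then show "fn n w - \<psi> w \<le> fn n (zs n) - \<psi> (zs n)" by (rule zs(2))
    qed (use din in auto)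
    with \<psi> show ?case unfolding superdiff_def by blast
  qed
  moreover have "(\<lambda>n. h (zs n)) \<longlonglongrightarrow> q"
  proof -
    have "(\<lambda>n. g (zs n)) \<longlonglongrightarrow> g z0"
      using \<phi>(1) unfolding C1_with_gradient_def
      by (auto intro: continuous_on_tendsto_compose[OF _ lim, of UNIV])
    then have "(\<lambda>n. g (zs n) + 2 *\<^sub>R (zs n - z0)) \<longlonglongrightarrow> g z0 + 2 *\<^sub>R (z0 - z0)"
      by (intro tendsto_intros lim)
    then show ?thesis using \<phi>(3) by (simp add: h_def)
  qed
  ultimately show thesis using that[of "\<lambda>n. h (zs n)" zs] zS lim val by blast
qed

section \<open>From bounded superdifferentials to Lipschitz bounds\<close>

lemma norm_le_sqrt_sum: "norm x \<le> sqrt (\<kappa>\<^sup>2 + (norm x)\<^sup>2)"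
  by (rule real_le_rsqrt) simp

text \<open>Smoothing the cone \<open>L' * norm (y - x)\<close> makes it a test function; its gradient exceeds \<open>L\<close>
  except near the vertex, so the maximum point must be close to \<open>x\<close>.\<close>

lemma norm_scaled_gradient_le:
  assumes "\<kappa> > 0" "0 \<le> L" "L < L'"
    and le: "norm ((L' / sqrt (\<kappa>\<^sup>2 + (norm v)\<^sup>2)) *\<^sub>R v) \<le> L"
  shows "norm v \<le> L / sqrt (L'\<^sup>2 - L\<^sup>2) * \<kappa>"
proof -
  have pos: "\<kappa>\<^sup>2 + (norm v)\<^sup>2 > 0" using assms(1) by (simp add: add_pos_nonneg)
  have "L' * norm v \<le> L * sqrt (\<kappa>\<^sup>2 + (norm v)\<^sup>2)"
    using le assms pos by (simp add: field_simps)
  then have "(L' * norm v)\<^sup>2 \<le> (L * sqrt (\<kappa>\<^sup>2 + (norm v)\<^sup>2))\<^sup>2"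
    using assms by (intro power_mono) auto
  then have "(L'\<^sup>2 - L\<^sup>2) * (norm v)\<^sup>2 \<le> (L * \<kappa>)\<^sup>2"
    using pos by (simp add: power_mult_distrib algebra_simps)
  then have "sqrt ((L'\<^sup>2 - L\<^sup>2) * (norm v)\<^sup>2) \<le> sqrt ((L * \<kappa>)\<^sup>2)"
    by (rule real_sqrt_le_mono)
  then have "sqrt (L'\<^sup>2 - L\<^sup>2) * norm v \<le> L * \<kappa>"
    using assms by (simp add: real_sqrt_mult real_sqrt_abs)
  moreover have "L'\<^sup>2 - L\<^sup>2 > 0" using assms by (simp add: power_strict_mono)
  ultimately show ?thesis by (simp add: field_simps)
qed

text \<open>For a slope \<open>L' > L\<close> the maximizer is confined to distance
  \<open>C * \<kappa>\<close> from the vertex \<open>x\<close>, and \<kappa> tends to 0 with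
  \<open>L'\<close> fixed. Only then does \<open>L'\<close> tend to \<open>L\<close>, because for
  \<open>L > 0\<close> the constant \<open>C\<close> blows up there.\<close>

lemma lipschitz_of_superdiff_bound:
  fixes f :: "'a::euclidean_space \<Rightarrow> real"
  assumes f: "continuous_on UNIV f" and B: "\<And>y. \<bar>f y\<bar> \<le> B" and L0: "0 \<le> L"
    and L: "\<And>y q. q \<in> superdiff UNIV f y \<Longrightarrow> norm q \<le> L"
  shows "f y \<le> f x + L * norm (y - x)"
proof -
  have main: "f y \<le> f x + L' * norm (y - x)" if "L' > L" for L'
  proof -
    have L': "L' > 0" using that L0 by linarith
    define C where "C = L / sqrt (L'\<^sup>2 - L\<^sup>2)"
    have "\<exists>z. norm (z - x) \<le> C * \<kappa> \<and> f y - L' * sqrt (\<kappa>\<^sup>2 + (norm (y - x))\<^sup>2) \<le> f z" if "\<kappa> > 0" for \<kappa>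
    proof -
      let ?s = "\<lambda>z. sqrt (\<kappa>\<^sup>2 + (norm (z - x))\<^sup>2)"
      let ?f = "\<lambda>z. f z - L' * ?s z"
      obtain z where z: "\<And>w. ?f w \<le> ?f z"
      proof (rule attains_max_coercive[of UNIV ?f x "norm x + 2 * B / L' + \<kappa>"])
        show "continuous_on UNIV ?f" by (intro continuous_intros f)
        fix z :: 'a assume "norm z > norm x + 2 * B / L' + \<kappa>"
        then have "norm (z - x) > 2 * B / L' + \<kappa>" using norm_triangle_sub[of z x] by linarith
        then have "?s z > 2 * B / L' + \<kappa>" using norm_le_sqrt_sum[of "z - x" \<kappa>] by linarith
        then have "L' * ?s z > 2 * B + L' * \<kappa>" using L' by (simp add: field_simps)
        then show "?f z \<le> ?f x" using B[of z] B[of x] \<open>\<kappa> > 0\<close> by simp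
      qed auto
      have "(L' / ?s z) *\<^sub>R (z - x) \<in> superdiff UNIV f z"
        by (rule superdiffI[OF C1_scale[OF C1_sqrt_norm[OF \<open>\<kappa> > 0\<close>, of x], of L']]) (use z in auto)
      from norm_scaled_gradient_le[OF \<open>\<kappa> > 0\<close> L0 \<open>L' > L\<close> L[OF this]]
      have "norm (z - x) \<le> C * \<kappa>" by (simp add: C_def)
      moreover have "f y - L' * ?s y \<le> f z"
        using z[of y] L' by (smt (verit) mult_nonneg_nonneg real_sqrt_ge_zero zero_le_power2)
      ultimately show ?thesis by blast
    qed
    note near = this
    have "\<exists>z. norm (z - x) \<le> C * (1 / real (Suc n)) \<and>
        f y - L' * sqrt ((1 / real (Suc n))\<^sup>2 + (norm (y - x))\<^sup>2) \<le> f z" for n :: nat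
      by (rule near) simp
    then obtain z where z: "\<And>n. norm (z n - x) \<le> C * (1 / real (Suc n))"
      "\<And>n. f y - L' * sqrt ((1 / real (Suc n))\<^sup>2 + (norm (y - x))\<^sup>2) \<le> f (z n)"
      by metis
    have inv: "(\<lambda>n. 1 / real (Suc n)) \<longlonglongrightarrow> 0"
      using LIMSEQ_inverse_real_of_nat by (simp add: inverse_eq_divide)
    have "z \<longlonglongrightarrow> x"
    proof (rule LIM_zero_cancel, rule tendsto_norm_zero_cancel)
      show "(\<lambda>n. norm (z n - x)) \<longlonglongrightarrow> 0"
        by (rule tendsto_sandwich[OF _ _ tendsto_const tendsto_mult_right_zero[OF inv, of C]])
          (use z(1) in auto)
    qed
    then have "(\<lambda>n. f (z n)) \<longlonglongrightarrow> f x"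
      by (rule continuous_on_tendsto_compose[OF f]) auto
    moreover have "(\<lambda>n. f y - L' * sqrt ((1 / real (Suc n))\<^sup>2 + (norm (y - x))\<^sup>2))
        \<longlonglongrightarrow> f y - L' * sqrt (0\<^sup>2 + (norm (y - x))\<^sup>2)"
      by (intro tendsto_intros inv)
    ultimately have "f y - L' * sqrt (0\<^sup>2 + (norm (y - x))\<^sup>2) \<le> f x"
      using z(2) by (intro LIMSEQ_le) auto
    then show ?thesis by simp
  qed
  have "f y - f x \<le> L * norm (y - x)"
  proof (rule field_le_epsilon)
    fix e :: real assume e: "e > 0"
    let ?d = "e / (1 + norm (y - x))"
    have "1 + norm (y - x) > 0" by (simp add: add_pos_nonneg)
    then have "?d > 0" "?d * norm (y - x) \<le> e" using e by (auto simp: field_simps)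
    with main[of "L + ?d"] show "f y - f x \<le> L * norm (y - x) + e"
      by (simp add: distrib_right)
  qed
  then show ?thesis by simp
qed

text \<open>Arzela-Ascoli on a set that need not be compact. The subsequence comes from a diagonal
  argument on a countable dense subset, before any compact set is chosen; finite nets from that
  subset then give uniform Cauchy estimates on every \<open>K\<close>.\<close>

lemma equicontinuous_subsequence:
  fixes f :: "nat \<Rightarrow> 'a::euclidean_space \<Rightarrow> 'b::{real_normed_vector,heine_borel}"
  assumes bdd: "\<And>n x. x \<in> S \<Longrightarrow> norm (f n x) \<le> B"
    and equi: "\<And>e. e > 0 \<Longrightarrow> \<exists>d>0. \<forall>n. \<forall>x\<in>S. \<forall>y\<in>S. dist x y < d \<longrightarrow> dist (f n x) (f n y) < e"
  obtains g r where "strict_mono (r :: nat \<Rightarrow> nat)"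
    "\<And>K. compact K \<Longrightarrow> K \<subseteq> S \<Longrightarrow> uniform_limit K (\<lambda>n. f (r n)) g sequentially"
proof -
  obtain D where D: "countable D" "D \<subseteq> S" "S \<subseteq> closure D"
    using separable by blast
  obtain r where r: "strict_mono (r :: nat \<Rightarrow> nat)" "\<And>x. x \<in> D \<Longrightarrow> \<exists>l. (\<lambda>n. f (r n) x) \<longlonglongrightarrow> l"
    using function_convergent_subsequence[OF D(1), of f B] bdd D(2) by (metis subsetD)
  have "uniformly_convergent_on K (\<lambda>n. f (r n))" if K: "compact K" "K \<subseteq> S" for K
    unfolding uniformly_convergent_eq_Cauchy uniformly_Cauchy_on_def
  proof (intro allI impI)
    fix e :: real assume "e > 0"
    then have "e/3 > 0" by simp
    from equi[OF this] obtain d where d: "d > 0"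
      "\<And>n x y. x \<in> S \<Longrightarrow> y \<in> S \<Longrightarrow> dist x y < d \<Longrightarrow> dist (f n x) (f n y) < e/3" by blast
    have "K \<subseteq> (\<Union>c\<in>D. ball c d)"
    proof
      fix x assume "x \<in> K"
      then have "x \<in> closure D" using K D by blast
      then obtain c where "c \<in> D" "dist c x < d"
        using d(1) by (meson closure_approachable)
      then show "x \<in> (\<Union>c\<in>D. ball c d)" by auto
    qed
    then obtain F where F: "F \<subseteq> D" "finite F" "K \<subseteq> (\<Union>c\<in>F. ball c d)"
      using compactE_image[OF K(1), of D "\<lambda>c. ball c d"] by (metis open_ball)
    have "\<exists>M. \<forall>m\<ge>M. \<forall>n\<ge>M. dist (f (r m) c) (f (r n) c) < e/3" if "c \<in> F" for c
    proof -
      have "Cauchy (\<lambda>n. f (r n) c)"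
        using r(2)[of c] that F(1) LIMSEQ_imp_Cauchy by blast
      then show ?thesis using \<open>e/3 > 0\<close> unfolding Cauchy_def by blast
    qed
    then obtain M where M: "\<And>c m n. c \<in> F \<Longrightarrow> m \<ge> M c \<Longrightarrow> n \<ge> M c \<Longrightarrow> dist (f (r m) c) (f (r n) c) < e/3"
      by metis
    show "\<exists>M. \<forall>x\<in>K. \<forall>m\<ge>M. \<forall>n\<ge>M. dist (f (r m) x) (f (r n) x) < e"
    proof (intro exI[of _ "\<Sum>c\<in>F. M c"] ballI allI impI)
      fix x m n assume x: "x \<in> K" and mn: "m \<ge> (\<Sum>c\<in>F. M c)" "n \<ge> (\<Sum>c\<in>F. M c)"
      obtain c where c: "c \<in> F" "dist c x < d" using F(3) x by auto
      have "M c \<le> (\<Sum>c\<in>F. M c)" using F(2) c(1) by (simp add: member_le_sum)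
      then have "dist (f (r m) c) (f (r n) c) < e/3" using M[OF c(1)] mn by simp
      moreover have "dist (f (r m) c) (f (r m) x) < e/3" "dist (f (r n) c) (f (r n) x) < e/3"
        using d(2)[of c x] c x F(1) D(2) K(2) by blast+
      ultimately show "dist (f (r m) x) (f (r n) x) < e"
        using dist_triangle_third[of "f (r m) x" "f (r m) c" e "f (r n) c" "f (r n) x"]
        by (simp add: dist_commute)
    qed
  qed
  note uc = this
  define g where "g x = lim (\<lambda>n. f (r n) x)" for x
  show thesis
  proof (rule that[OF r(1)])
    fix K assume "compact K" "K \<subseteq> S"
    from uc[OF this] show "uniform_limit K (\<lambda>n. f (r n)) g sequentially"
      unfolding g_def by (simp add: uniformly_convergent_uniform_limit_iff)
  qed
qed

section \<open>The cell problem\<close>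

lemma local_min_iff_max:
  "local_min_on S (\<lambda>z. v z - \<phi> z) y \<longleftrightarrow> local_max_on S (\<lambda>z. - v z - - \<phi> z) y"
  by (simp add: local_min_on_def local_max_on_def algebra_simps)

lemma superdiff_shift: "superdiff S (\<lambda>w. f w + c) z = superdiff S f z"
  by (simp add: superdiff_def local_max_on_def)

lemma superdiff_translate:
  assumes "q \<in> superdiff UNIV (\<lambda>y. w (y + k)) y"
  shows "q \<in> superdiff UNIV w (y + k)"
proof -
  obtain \<phi> g where \<phi>: "C1_with_gradient \<phi> g" "local_max_on UNIV (\<lambda>y. w (y + k) - \<phi> y) y" "g y = q"
    using assms by (auto simp: superdiff_def)
  have "C1_with_gradient (\<lambda>z. \<phi> (z - k)) (\<lambda>z. g (z - k))"
    unfolding C1_with_gradient_def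
  proof (intro conjI allI)
    fix z
    have "(\<phi> has_derivative (\<lambda>h. inner h (g (z - k)))) (at (z - k))"
      using \<phi>(1) by (simp add: C1_with_gradient_def gderiv_def)
    from has_derivative_compose[OF has_derivative_diff[OF has_derivative_ident has_derivative_const] this]
    show "GDERIV (\<lambda>z. \<phi> (z - k)) z :> g (z - k)" by (simp add: gderiv_def)
  next
    show "continuous_on UNIV (\<lambda>z. g (z - k))"
      by (rule continuous_on_compose2[of UNIV g])
        (use \<phi>(1) in \<open>auto simp: C1_with_gradient_def intro!: continuous_intros\<close>)
  qed
  moreover have "local_max_on UNIV (\<lambda>z. w z - \<phi> (z - k)) (y + k)"
  proof -
    obtain d where d: "d > 0" "\<And>x. x \<noteq> y \<Longrightarrow> dist x y < d \<Longrightarrow> w (x + k) - \<phi> x \<le> w (y + k) - \<phi> y"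
      using \<phi>(2) unfolding local_max_on_def eventually_at by blast
    show ?thesis unfolding local_max_on_def eventually_at
    proof (intro conjI UNIV_I exI[of _ d] d(1) ballI impI)
      fix x assume "x \<noteq> y + k \<and> dist x (y + k) < d"
      then show "w x - \<phi> (x - k) \<le> w (y + k) - \<phi> (y + k - k)"
        using d(2)[of "x - k"] by (auto simp: dist_norm algebra_simps)
    qed
  qed
  ultimately show ?thesis using \<phi>(3) unfolding superdiff_def by force
qed

text \<open>The two halves are kept apart because comparison and the perturbed test function method
  each use one half of a corrector. In \<open>cell_sup\<close> the superdifferential of
  \<open>- v\<close> is minus the subdifferential of \<open>v\<close>, hence the argument
  \<open>- q\<close>.\<close>

definition cell_sub :: "('a::real_inner \<Rightarrow> 'a \<Rightarrow> real) \<Rightarrow> real \<Rightarrow> ('a \<Rightarrow> real) \<Rightarrow> bool" where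
  "cell_sub F c v \<longleftrightarrow> (\<forall>y. \<forall>q\<in>superdiff UNIV v y. F y q \<le> c)"

definition cell_sup :: "('a::real_inner \<Rightarrow> 'a \<Rightarrow> real) \<Rightarrow> real \<Rightarrow> ('a \<Rightarrow> real) \<Rightarrow> bool" where
  "cell_sup F c v \<longleftrightarrow> (\<forall>y. \<forall>q\<in>superdiff UNIV (\<lambda>y. - v y) y. c \<le> F y (- q))"

lemma stationary_visc_solution_iff:
  "stationary_visc_solution F c v \<longleftrightarrow> continuous_on UNIV v \<and> cell_sub F c v \<and> cell_sup F c v"
proof -
  have "(\<forall>\<phi> g y. C1_with_gradient \<phi> g \<and> local_min_on UNIV (\<lambda>z. v z - \<phi> z) y \<longrightarrow> F y (g y) \<ge> c)
      \<longleftrightarrow> cell_sup F c v" (is "?L \<longleftrightarrow> ?R")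
  proof
    assume L: ?L
    show ?R unfolding cell_sup_def superdiff_def
    proof (intro allI ballI, elim CollectE exE conjE)
      fix y q \<phi> g
      assume "C1_with_gradient \<phi> g" "local_max_on UNIV (\<lambda>w. - v w - \<phi> w) y" "g y = q"
      then show "c \<le> F y (- q)"
        using L[rule_format, of "\<lambda>z. - \<phi> z" "\<lambda>z. - g z" y] C1_minus[of \<phi> g]
        unfolding local_min_iff_max by auto
    qed
  next
    assume R: ?R
    show ?L
    proof (intro allI impI)
      fix \<phi> g y assume "C1_with_gradient \<phi> g \<and> local_min_on UNIV (\<lambda>z. v z - \<phi> z) y"
      then have "- g y \<in> superdiff UNIV (\<lambda>y. - v y) y"
        unfolding local_min_iff_max superdiff_def using C1_minus[of \<phi> g] by blast
      with R show "F y (g y) \<ge> c" unfolding cell_sup_def by fastforce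
    qed
  qed
  then show ?thesis
    unfolding stationary_visc_solution_def cell_sub_def superdiff_def by blast
qed

section \<open>Periodic functions on the whole space\<close>

lemma Z_periodic_rep:
  fixes y :: "real^'n"
  obtains k where "\<forall>i. k $ i \<in> \<int>" "y + k \<in> cbox 0 (\<chi> i. 1)"
proof (rule that[of "\<chi> i. - of_int \<lfloor>y $ i\<rfloor>"])
  show "y + (\<chi> i. - real_of_int \<lfloor>y $ i\<rfloor>) \<in> cbox 0 (\<chi> i. 1)"
    unfolding mem_box_cart by (auto simp: algebra_simps) linarith+
qed auto

lemma Z_periodic_attains_max:
  fixes f :: "real^'n \<Rightarrow> real"
  assumes "Z_periodic f" "continuous_on UNIV f"
  obtains z where "\<And>w. f w \<le> f z"
proof -
  let ?K = "cbox (0::real^'n) (\<chi> i. 1)"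
  obtain z where z: "z \<in> ?K" "\<forall>w\<in>?K. f w \<le> f z"
  proof (rule continuous_attains_sup[of ?K f, THEN bexE])
    show "?K \<noteq> {}" using Z_periodic_rep by blast
    show "continuous_on ?K f" using assms(2) continuous_on_subset by blast
  qed auto
  have "f w \<le> f z" for w
  proof -
    obtain k where "\<forall>i. k $ i \<in> \<int>" "w + k \<in> ?K" using Z_periodic_rep by blast
    then show ?thesis using z assms(1) unfolding Z_periodic_def by metis
  qed
  then show thesis by (rule that)
qed

lemma Z_periodic_bounded:
  fixes f :: "real^'n \<Rightarrow> real"
  assumes "Z_periodic f" "continuous_on UNIV f"
  obtains B where "\<And>y. \<bar>f y\<bar> \<le> B"
proof -
  obtain z where z: "\<And>w. f w \<le> f z" using Z_periodic_attains_max[OF assms] by blast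
  have "Z_periodic (\<lambda>y. - f y)" "continuous_on UNIV (\<lambda>y. - f y)"
    using assms by (auto simp: Z_periodic_def intro: continuous_on_minus)
  then obtain z' where z': "\<And>w. - f w \<le> - f z'" using Z_periodic_attains_max by blast
  have "\<bar>f y\<bar> \<le> \<bar>f z\<bar> + \<bar>f z'\<bar>" for y using z[of y] z'[of y] by linarith
  then show thesis by (rule that)
qed

lemma tendsto_curried:
  assumes "continuous_on UNIV (\<lambda>(y, q). F y q)" "(ys \<longlongrightarrow> y) L" "(qs \<longlongrightarrow> q) L"
  shows "((\<lambda>n. F (ys n) (qs n)) \<longlongrightarrow> F y q) L"
  using continuous_on_tendsto_compose[OF assms(1) tendsto_Pair[OF assms(2,3)]] by simp

lemma continuous_on_curried:
  assumes "continuous_on UNIV (\<lambda>(y, q). F y q)" "continuous_on A f" "continuous_on A g"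
  shows "continuous_on A (\<lambda>x. F (f x) (g x))"
  using continuous_on_compose2[OF assms(1) continuous_on_Pair[OF assms(2,3)]] by simp

lemma lipschitz_realI:
  fixes f :: "'a::real_normed_vector \<Rightarrow> real"
  assumes "\<And>x y. f y \<le> f x + L * norm (y - x)" "0 \<le> L"
  shows "L-lipschitz_on UNIV f"
proof (rule lipschitz_onI)
  fix x y
  show "dist (f x) (f y) \<le> L * dist x y"
    using assms(1)[of y x] assms(1)[of x y]
    by (auto simp: dist_real_def dist_norm norm_minus_commute abs_le_iff)
qed (rule assms(2))

lemma lipschitz_realD:
  fixes f :: "'a::real_normed_vector \<Rightarrow> real"
  assumes "L-lipschitz_on UNIV f"
  shows "f y \<le> f x + L * norm (y - x)"
  using lipschitz_onD[OF assms, of y x] by (simp add: dist_real_def dist_norm)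

text \<open>What remains of a Hamiltonian once the index, \<open>x\<close>, \<open>r\<close> and the
  macroscopic gradient \<open>p\<close> are frozen: \<open>F y q\<close> stands for
  \<open>H i x y r (p + q)\<close>.\<close>

locale cell_problem =
  fixes F :: "real^'n \<Rightarrow> real^'n \<Rightarrow> real"
  assumes cont: "continuous_on UNIV (\<lambda>(y, q). F y q)"
    and per: "\<And>q. Z_periodic (\<lambda>y. F y q)"
    and coer: "\<And>K. \<exists>R. \<forall>y q. R \<le> norm q \<longrightarrow> K \<le> F y q"
begin

text \<open>\<open>A\<close> bounds \<open>F\<close> at zero gradient, so
  \<open>A / \<delta>\<close> and \<open>- A / \<delta>\<close> are barriers for the discounted
  equation. A subsolution above the lower barrier satisfies \<open>F y q \<le> A\<close>, the level
  at which coercivity provides \<open>L\<close>, independently of \<delta>.\<close>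

lemma constants:
  obtains A L where "0 \<le> A" "0 \<le> L" "\<And>y. \<bar>F y 0\<bar> \<le> A" "\<And>y q. F y q \<le> A \<Longrightarrow> norm q \<le> L"
proof -
  have "continuous_on UNIV (\<lambda>y. F y 0)"
    by (intro continuous_on_curried[OF cont] continuous_intros)
  then obtain A where A: "\<And>y. \<bar>F y 0\<bar> \<le> A"
    using Z_periodic_bounded[OF per] by blast
  obtain R where R: "\<And>y q. R \<le> norm q \<Longrightarrow> A + 1 \<le> F y q" using coer by blast
  show thesis
  proof (rule that[of A "max R 0"])
    show "0 \<le> A" using A[of 0] by linarith
    show "norm q \<le> max R 0" if "F y q \<le> A" for y q using R[of q y] that by linarith
  qed (use A in auto)
qed

text \<open>Perron's method. The competitors are not required to be periodic, so that the bump of the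
  supersolution step can be localized; the supremum is periodic because the class of competitors is
  invariant under integer translations.\<close>

lemma discounted_solution:
  assumes \<delta>: "\<delta> > 0" and L0: "0 \<le> L" and A: "\<And>y. \<bar>F y 0\<bar> \<le> A"
    and L: "\<And>y q. F y q \<le> A \<Longrightarrow> norm q \<le> L"
  obtains v where "L-lipschitz_on UNIV v" "Z_periodic v" "\<And>y. \<bar>v y\<bar> \<le> A / \<delta>"
    "\<And>y q. q \<in> superdiff UNIV v y \<Longrightarrow> \<delta> * v y + F y q \<le> 0"
    "\<And>y q. q \<in> superdiff UNIV (\<lambda>y. - v y) y \<Longrightarrow> 0 \<le> \<delta> * v y + F y (- q)"
proof -
  \<comment> \<open>One Lipschitz constant for all competitors makes their supremum continuous, so
    Perron's method can work without semicontinuous envelopes.\<close>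
  define C where "C = {w. L-lipschitz_on UNIV w \<and> (\<forall>y. \<bar>w y\<bar> \<le> A / \<delta>) \<and>
    (\<forall>y. \<forall>q\<in>superdiff UNIV w y. \<delta> * w y + F y q \<le> 0)}"
  have Clip: "L-lipschitz_on UNIV w" and Cb: "\<bar>w y\<bar> \<le> A / \<delta>"
    and Csub: "q \<in> superdiff UNIV w y \<Longrightarrow> \<delta> * w y + F y q \<le> 0" if "w \<in> C" for w y q
    using that by (auto simp: C_def)
  have CI: "w \<in> C" if w: "continuous_on UNIV w" "\<And>y. \<bar>w y\<bar> \<le> A / \<delta>"
    "\<And>y q. q \<in> superdiff UNIV w y \<Longrightarrow> \<delta> * w y + F y q \<le> 0" for w
  proof -
    have "norm q \<le> L" if "q \<in> superdiff UNIV w y" for y q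
    proof (rule L)
      have "\<delta> * w y \<ge> - A" using w(2)[of y] \<delta> by (auto simp: abs_le_iff field_simps)
      then show "F y q \<le> A" using w(3)[OF that] by linarith
    qed
    then have "L-lipschitz_on UNIV w"
      using lipschitz_of_superdiff_bound[OF w(1,2) L0] by (intro lipschitz_realI L0) blast
    then show ?thesis using w by (auto simp: C_def)
  qed
  define v where "v y = (SUP w\<in>C. w y)" for y
  have "(\<lambda>y. - A / \<delta>) \<in> C"
  proof (rule CI)
    fix y q :: "real^'n" assume "q \<in> superdiff UNIV (\<lambda>y. - A / \<delta>) y"
    then have "q = 0" by (rule superdiff_C1[OF _ C1_const[of "- A / \<delta>"]])
    then show "\<delta> * (- A / \<delta>) + F y q \<le> 0" using A[of y] \<delta> by simp
  qed (use \<delta> A[of 0] in auto)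
  then have C0: "C \<noteq> {}" by blast
  have bdd: "bdd_above ((\<lambda>w. w y) ` C)" for y
    using Cb by (intro bdd_aboveI[of _ "A / \<delta>"]) (auto simp: abs_le_iff)
  have vub: "w y \<le> v y" if "w \<in> C" for w y
    unfolding v_def by (rule cSUP_upper[OF that bdd])
  have vle: "v y \<le> a" if "\<And>w. w \<in> C \<Longrightarrow> w y \<le> a" for y a
    unfolding v_def by (rule cSUP_least[OF C0 that])
  have vlip: "L-lipschitz_on UNIV v"
  proof (rule lipschitz_realI[OF _ L0])
    fix x y
    show "v y \<le> v x + L * norm (y - x)"
    proof (rule vle)
      fix w assume "w \<in> C"
      then show "w y \<le> v x + L * norm (y - x)"
        using lipschitz_realD[OF Clip, of w y x] vub[of w x] by linarith
    qed
  qed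
  then have vcont: "continuous_on UNIV v" by (rule lipschitz_on_continuous_on)
  have vb: "\<bar>v y\<bar> \<le> A / \<delta>" for y
  proof -
    obtain w where "w \<in> C" using C0 by blast
    then have "- (A / \<delta>) \<le> v y" using Cb[of w y] vub[of w y] by linarith
    moreover have "v y \<le> A / \<delta>" using Cb by (intro vle) (auto simp: abs_le_iff)
    ultimately show ?thesis by linarith
  qed
  have Ctrans: "(\<lambda>y. w (y + k)) \<in> C" if w: "w \<in> C" and k: "\<forall>i. k $ i \<in> \<int>" for w k
  proof (rule CI)
    show "continuous_on UNIV (\<lambda>y. w (y + k))"
      using lipschitz_on_continuous_on[OF Clip[OF w]]
      by (rule continuous_on_compose2[of UNIV w]) (auto intro!: continuous_intros)
    show "\<bar>w (y + k)\<bar> \<le> A / \<delta>" for y using Cb[OF w] .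
    show "\<delta> * w (y + k) + F y q \<le> 0" if "q \<in> superdiff UNIV (\<lambda>y. w (y + k)) y" for y q
      using Csub[OF w superdiff_translate[OF that]] per[of q] k unfolding Z_periodic_def by metis
  qed
  have vper: "Z_periodic v"
    unfolding Z_periodic_def
  proof (intro allI impI antisym)
    fix y k :: "real^'n" assume k: "\<forall>i. k $ i \<in> \<int>"
    show "v (y + k) \<le> v y"
      by (rule vle) (use vub[OF Ctrans[OF _ k]] in blast)
    have k': "\<forall>i. (- k) $ i \<in> \<int>" using k by simp
    show "v y \<le> v (y + k)"
    proof (rule vle)
      fix w assume "w \<in> C"
      from vub[OF Ctrans[OF this k'], of "y + k"] show "w y \<le> v (y + k)" by simp
    qed
  qed
  \<comment> \<open>A maximizing sequence at the single point \<open>y\<close> is enough: its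
    members lie below \<open>v\<close>, which is the one-sided bound required by
    \<open>superdiff_stable\<close>.\<close>
  have vsub: "\<delta> * v y + F y q \<le> 0" if q: "q \<in> superdiff UNIV v y" for y q
  proof -
    have "\<exists>w\<in>C. v y - 1 / real (Suc n) < w y" for n
      using vle[of y "v y - 1 / real (Suc n)"] by (force simp: not_less)
    then obtain w where w: "\<And>n. w n \<in> C" "\<And>n. v y - 1 / real (Suc n) < w n y" by metis
    have inv: "(\<lambda>n. 1 / real (Suc n)) \<longlonglongrightarrow> 0"
      using LIMSEQ_inverse_real_of_nat by (simp add: inverse_eq_divide)
    have lim: "(\<lambda>n. w n y) \<longlonglongrightarrow> v y"
    proof (rule tendsto_sandwich[OF _ _ _ tendsto_const])
      show "(\<lambda>n. v y - 1 / real (Suc n)) \<longlonglongrightarrow> v y"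
        using tendsto_diff[OF tendsto_const inv, of "v y"] by simp
      show "\<forall>\<^sub>F n in sequentially. v y - 1 / real (Suc n) \<le> w n y"
        using w(2) by (intro always_eventually allI less_imp_le)
      show "\<forall>\<^sub>F n in sequentially. w n y \<le> v y"
        using vub[OF w(1)] by (intro always_eventually allI)
    qed
    obtain zs qs where z: "\<forall>\<^sub>F n in sequentially. qs n \<in> superdiff UNIV (w n) (zs n)"
      "zs \<longlonglongrightarrow> y" "qs \<longlonglongrightarrow> q" "(\<lambda>n. w n (zs n)) \<longlonglongrightarrow> v y"
    proof (rule superdiff_stable[of UNIV v w y q])
      show "continuous_on UNIV (w n)" for n by (rule lipschitz_on_continuous_on[OF Clip[OF w(1)]])
      show "\<forall>\<^sub>F n in sequentially. \<forall>z\<in>K. w n z \<le> v z + e" if "e > 0" for K and e :: real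
        using vub[OF w(1)] that by (intro always_eventually allI ballI) (smt (verit))
    qed (use vcont lim q in auto)
    have "(\<lambda>n. \<delta> * w n (zs n) + F (zs n) (qs n)) \<longlonglongrightarrow> \<delta> * v y + F y q"
      by (intro tendsto_intros tendsto_curried[OF cont] z)
    moreover have "\<forall>\<^sub>F n in sequentially. \<delta> * w n (zs n) + F (zs n) (qs n) \<le> 0"
      using z(1) by eventually_elim (rule Csub[OF w(1)])
    ultimately show ?thesis by (rule tendsto_upperbound) simp
  qed
  \<comment> \<open>If the inequality failed at \<open>y0\<close>, the touching function, made
    strict by a quadratic and lifted by \<kappa>, would be a subsolution near \<open>y0\<close>; its
    maximum with \<open>v\<close> would be a competitor exceeding \<open>v\<close> at
    \<open>y0\<close>.\<close>
  have vsup: "0 \<le> \<delta> * v y0 + F y0 (- q)" if q: "q \<in> superdiff UNIV (\<lambda>y. - v y) y0" for y0 q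
  proof (rule ccontr)
    assume neg: "\<not> ?thesis"
    obtain \<phi> g where \<phi>: "C1_with_gradient \<phi> g" "local_max_on UNIV (\<lambda>w. - v w - \<phi> w) y0" "g y0 = q"
      using q by (auto simp: superdiff_def)
    define \<psi> where "\<psi> y = (v y0 + \<phi> y0) - \<phi> y - (norm (y - y0))\<^sup>2" for y
    define h where "h y = 0 - g y - 2 *\<^sub>R (y - y0)" for y
    have \<psi>: "C1_with_gradient \<psi> h"
      unfolding \<psi>_def h_def by (intro C1_diff C1_const \<phi>(1) C1_norm_squared)
    define G where "G y = \<delta> * \<psi> y + F y (h y)" for y
    have Gc: "continuous_on UNIV G"
      unfolding G_def using \<psi>
      by (intro continuous_intros C1_continuous[OF \<psi>] continuous_on_curried[OF cont])
        (auto simp: C1_with_gradient_def)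
    have "G y0 < 0" using neg \<phi>(3) by (simp add: G_def \<psi>_def h_def)
    define m where "m = - G y0 / 2"
    have m: "m > 0" using \<open>G y0 < 0\<close> by (simp add: m_def)
    have "isCont G y0" using Gc by (simp add: continuous_on_eq_continuous_at)
    then obtain r1 where r1: "r1 > 0" "\<And>y. dist y y0 < r1 \<Longrightarrow> dist (G y) (G y0) < m"
      unfolding continuous_at_eps_delta using m by blast
    obtain r2 where r2: "r2 > 0" "\<And>y. y \<noteq> y0 \<Longrightarrow> dist y y0 < r2 \<Longrightarrow> - v y - \<phi> y \<le> - v y0 - \<phi> y0"
      using \<phi>(2) unfolding local_max_on_def eventually_at by blast
    define r where "r = min r1 r2"
    define \<rho> where "\<rho> = r / 2"
    have r: "r > 0" "0 < \<rho>" "\<rho> < r" using r1 r2 by (auto simp: r_def \<rho>_def)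
    have Gr: "G y < - m" if "dist y y0 < r" for y
    proof -
      have "dist (G y) (G y0) < m" using r1(2) that by (simp add: r_def)
      moreover have "G y0 = - 2 * m" by (simp add: m_def)
      ultimately show ?thesis by (simp add: dist_real_def)
    qed
    have below: "\<psi> y + (norm (y - y0))\<^sup>2 \<le> v y" if "dist y y0 < r" for y
      using r2(2)[of y] that by (cases "y = y0") (auto simp: \<psi>_def r_def)
    \<comment> \<open>The first bound keeps the lifted function a subsolution, as
      \<open>\<delta> * \<kappa>\<close> uses up at most the margin \<open>m\<close>. The second
      puts it below \<open>v\<close> at distances from \<rho> to \<open>r\<close>, so the gluing is
      continuous.\<close>
    define \<kappa> where "\<kappa> = min (m / \<delta>) (\<rho>\<^sup>2 / 2)"
    have \<kappa>: "\<kappa> > 0" "\<delta> * \<kappa> \<le> m" "\<kappa> < \<rho>\<^sup>2"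
      using m \<delta> r by (auto simp: \<kappa>_def min_def field_simps)
    define w where "w y = (if dist y y0 < \<rho> then max (v y) (\<psi> y + \<kappa>) else v y)" for y
    have wr: "w y = max (v y) (\<psi> y + \<kappa>)" if "dist y y0 < r" for y
    proof (cases "dist y y0 < \<rho>")
      case False
      then have "\<rho>\<^sup>2 \<le> (norm (y - y0))\<^sup>2" using r by (intro power_mono) (auto simp: dist_norm)
      with below[OF that] \<kappa> show ?thesis using False by (simp add: w_def)
    qed (simp add: w_def)
    have wge: "v y \<le> w y" for y by (simp add: w_def)
    have wcont: "continuous_on UNIV w"
    proof -
      have "continuous_on (ball y0 r) (\<lambda>y. max (v y) (\<psi> y + \<kappa>))"
        by (intro continuous_intros continuous_on_subset[OF vcont] C1_continuous[OF \<psi>]) auto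
      then have "continuous_on (ball y0 r) w"
        by (rule continuous_on_eq) (use wr in \<open>auto simp: dist_commute\<close>)
      moreover have "continuous_on (- cball y0 \<rho>) w"
        using continuous_on_subset[OF vcont]
        by (rule continuous_on_eq[where f = v]) (auto simp: w_def dist_commute)
      ultimately have "continuous_on (ball y0 r \<union> - cball y0 \<rho>) w"
        by (intro continuous_on_open_Un) auto
      moreover have "ball y0 r \<union> - cball y0 \<rho> = UNIV" using r by auto
      ultimately show ?thesis by simp
    qed
    have wsub: "\<delta> * w y + F y p \<le> 0" if p: "p \<in> superdiff UNIV w y" for y p
    proof (cases "w y = v y")
      case True
      have "p \<in> superdiff UNIV v y"
        by (rule superdiff_touch[OF p]) (use wge True in auto)
      then show ?thesis using vsub True by simp
    next
      case False
      then have y: "dist y y0 < \<rho>" "w y = \<psi> y + \<kappa>" by (auto simp: w_def split: if_splits)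
      have "\<forall>\<^sub>F z in at y. \<psi> z + \<kappa> \<le> w z"
        unfolding eventually_at
      proof (intro exI[of _ "\<rho> - dist y y0"] conjI ballI impI)
        fix z assume "z \<noteq> y \<and> dist z y < \<rho> - dist y y0"
        then have "dist z y0 < \<rho>" using dist_triangle[of z y0 y] by linarith
        then show "\<psi> z + \<kappa> \<le> w z" by (simp add: w_def)
      qed (use y in auto)
      then have "p \<in> superdiff UNIV (\<lambda>z. \<psi> z + \<kappa>) y"
        by (rule superdiff_touch[OF p]) (use y in auto)
      then have "p = h y" unfolding superdiff_shift by (rule superdiff_C1[OF _ \<psi>])
      moreover have "G y < - m" using y r by (intro Gr) simp
      ultimately show ?thesis using \<kappa> y by (simp add: G_def distrib_left)
    qed
    \<comment> \<open>Outside the ball \<open>w\<close> equals \<open>v\<close>, so a value above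
      \<open>A / \<delta>\<close> forces a global maximum of \<open>w\<close>; there 0 is a
      superdifferential and the equation gives the bound after all.\<close>
    have wle: "w y \<le> A / \<delta>" for y
    proof (rule ccontr)
      assume "\<not> w y \<le> A / \<delta>"
      then have y: "A / \<delta> < w y" by simp
      have out: "w x \<le> A / \<delta>" if "x \<notin> cball y0 \<rho>" for x
        using vb[of x] that by (auto simp: w_def dist_commute abs_le_iff)
      obtain z where z: "z \<in> cball y0 \<rho>" "\<forall>x\<in>cball y0 \<rho>. w x \<le> w z"
        using continuous_attains_sup[of "cball y0 \<rho>" w] r continuous_on_subset[OF wcont] by auto
      have yz: "w y \<le> w z" using out[of y] y z by force
      have "w x \<le> w z" for x using out[of x] y yz z by force
      then have "0 \<in> superdiff UNIV w z"
        by (intro superdiffI[OF C1_const[of 0]]) auto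
      from wsub[OF this] have "\<delta> * w z \<le> A" using A[of z] by linarith
      then have "w z \<le> A / \<delta>" using \<delta> by (simp add: field_simps)
      then show False using y yz by linarith
    qed
    have "\<bar>w y\<bar> \<le> A / \<delta>" for y
      using wle[of y] wge[of y] vb[of y] by linarith
    then have "w \<in> C" using CI wcont wsub by blast
    then have "w y0 \<le> v y0" by (rule vub)
    then show False using r \<kappa> by (simp add: w_def \<psi>_def)
  qed
  show thesis by (rule that[OF vlip vper vb vsub vsup])
qed

text \<open>Vanishing discount. Periodicity and the uniform Lipschitz bound make
  \<open>v n - v n 0\<close> bounded and equicontinuous, while \<open>\<delta> n * v n 0\<close>
  stays bounded by \<open>A\<close>. Hence \<open>\<delta> n * v n\<close> tends along a subsequence
  to one constant \<open>l\<close> at whatever points it is evaluated, and the corrector belongs to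
  the constant \<open>- l\<close>.\<close>

lemma corrector_exists:
  obtains c v where "\<exists>L. L-lipschitz_on UNIV v" "Z_periodic v" "cell_sub F c v" "cell_sup F c v"
proof -
  obtain A L where A: "0 \<le> A" and L0: "0 \<le> L" and Ab: "\<And>y. \<bar>F y 0\<bar> \<le> A"
    and L: "\<And>y q. F y q \<le> A \<Longrightarrow> norm q \<le> L" using constants by blast
  define \<delta> where "\<delta> n = 1 / real (Suc n)" for n
  have \<delta>: "\<delta> n > 0" for n by (simp add: \<delta>_def)
  have \<delta>0: "\<delta> \<longlonglongrightarrow> 0"
    unfolding \<delta>_def using LIMSEQ_inverse_real_of_nat by (simp add: inverse_eq_divide)
  have "\<exists>v. L-lipschitz_on UNIV v \<and> Z_periodic v \<and> (\<forall>y. \<bar>v y\<bar> \<le> A / \<delta> n) \<and>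
    (\<forall>y q. q \<in> superdiff UNIV v y \<longrightarrow> \<delta> n * v y + F y q \<le> 0) \<and>
    (\<forall>y q. q \<in> superdiff UNIV (\<lambda>y. - v y) y \<longrightarrow> 0 \<le> \<delta> n * v y + F y (- q))" for n
    by (rule discounted_solution[OF \<delta>[of n] L0 Ab L]) blast+
  then obtain v where v: "\<And>n. L-lipschitz_on UNIV (v n)" "\<And>n. Z_periodic (v n)"
    "\<And>n y. \<bar>v n y\<bar> \<le> A / \<delta> n"
    "\<And>n y q. q \<in> superdiff UNIV (v n) y \<Longrightarrow> \<delta> n * v n y + F y q \<le> 0"
    "\<And>n y q. q \<in> superdiff UNIV (\<lambda>y. - v n y) y \<Longrightarrow> 0 \<le> \<delta> n * v n y + F y (- q)"
    by metis
  define w where "w n y = v n y + - v n 0" for n y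
  have wlip: "L-lipschitz_on UNIV (w n)" for n
    using lipschitz_realD[OF v(1)] by (intro lipschitz_realI L0) (simp add: w_def)
  have wper: "Z_periodic (w n)" for n using v(2) by (simp add: Z_periodic_def w_def)
  obtain D where D: "\<And>y. y \<in> cbox 0 (\<chi> i. 1) \<Longrightarrow> norm (y :: real^'n) \<le> D"
    using bounded_cbox unfolding bounded_iff by blast
  have wb: "norm (w n y) \<le> L * D" for n y
  proof -
    obtain k where k: "\<forall>i. k $ i \<in> \<int>" "y + k \<in> cbox 0 (\<chi> i. 1)" by (rule Z_periodic_rep)
    have "norm (w n (y + k)) \<le> L * norm (y + k)"
      using lipschitz_onD[OF wlip[of n], of "y + k" 0] by (simp add: w_def dist_norm)
    also have "\<dots> \<le> L * D" using D[OF k(2)] L0 by (rule mult_left_mono)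
    finally show ?thesis using wper[of n] k(1) unfolding Z_periodic_def by metis
  qed
  obtain g r where r: "strict_mono r"
    and g: "\<And>K. compact K \<Longrightarrow> K \<subseteq> UNIV \<Longrightarrow> uniform_limit K (\<lambda>n. w (r n)) g sequentially"
  proof (rule equicontinuous_subsequence[of UNIV w "L * D"])
    fix e :: real assume e: "e > 0"
    show "\<exists>d>0. \<forall>n. \<forall>x\<in>UNIV. \<forall>y\<in>UNIV. dist x y < d \<longrightarrow> dist (w n x) (w n y) < e"
    proof (intro exI[of _ "e / (L + 1)"] conjI allI ballI impI)
      fix n :: nat and x y :: "real^'n" assume "dist x y < e / (L + 1)"
      then have "(L + 1) * dist x y < e" using L0 by (simp add: field_simps)
      moreover have "dist (w n x) (w n y) \<le> L * dist x y" using lipschitz_onD[OF wlip] by blast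
      ultimately show "dist (w n x) (w n y) < e"
        using zero_le_dist[of x y] unfolding distrib_right by linarith
    qed (use e L0 in auto)
  qed (use wb in auto)
  have "\<bar>\<delta> n * v n 0\<bar> \<le> A" for n
    using v(3)[of n 0] \<delta>[of n] by (simp add: abs_mult field_simps)
  then have "bounded (range (\<lambda>n. \<delta> (r n) * v (r n) 0))"
    unfolding bounded_iff by (intro exI[of _ A]) auto
  then obtain l r' where r': "strict_mono r'" "((\<lambda>n. \<delta> (r n) * v (r n) 0) \<circ> r') \<longlonglongrightarrow> l"
    using bounded_imp_convergent_subsequence by blast
  define s where "s n = r (r' n)" for n
  have s: "strict_mono s" using r r'(1) by (simp add: s_def strict_mono_def)
  have gs: "uniform_limit K (\<lambda>n. w (s n)) g sequentially" if "compact K" for K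
    using filterlim_compose[OF g[OF that] filterlim_subseq[OF r'(1)]] by (simp add: s_def)
  have ls: "(\<lambda>n. \<delta> (s n) * v (s n) 0) \<longlonglongrightarrow> l" using r'(2) by (simp add: s_def o_def)
  have \<delta>s: "(\<lambda>n. \<delta> (s n)) \<longlonglongrightarrow> 0" using LIMSEQ_subseq_LIMSEQ[OF \<delta>0 s] by (simp add: o_def)
  have gp: "(\<lambda>n. w (s n) y) \<longlonglongrightarrow> g y" for y
    using tendsto_uniform_limitI[OF gs[of "{y}"]] by simp
  have glip: "L-lipschitz_on UNIV g"
  proof (rule lipschitz_realI[OF _ L0])
    show "g y \<le> g x + L * norm (y - x)" for x y
      by (rule LIMSEQ_le[OF gp tendsto_add[OF gp tendsto_const]])
        (use lipschitz_realD[OF wlip] in blast)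
  qed
  have gcont: "continuous_on UNIV g" by (rule lipschitz_on_continuous_on[OF glip])
  have wcont: "continuous_on UNIV (w n)" for n by (rule lipschitz_on_continuous_on[OF wlip])
  have gper: "Z_periodic g"
    unfolding Z_periodic_def
  proof (intro allI impI)
    fix y k :: "real^'n" assume "\<forall>i. k $ i \<in> \<int>"
    then have "w n (y + k) = w n y" for n using wper unfolding Z_periodic_def by blast
    then show "g (y + k) = g y" using LIMSEQ_unique[OF gp[of "y + k"]] gp[of y] by simp
  qed
  have near: "\<forall>\<^sub>F n in sequentially. \<forall>z\<in>K. \<bar>w (s n) z - g z\<bar> < e" if "compact K" "e > 0" for K e
    using uniform_limitD[OF gs[OF that(1)] that(2)] by (simp add: dist_real_def)
  have dv: "(\<lambda>n. \<delta> (s n) * v (s n) (zs n)) \<longlonglongrightarrow> l" for zs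
  proof -
    have "(\<lambda>n. \<delta> (s n) * w (s n) (zs n)) \<longlonglongrightarrow> 0"
    proof (rule tendsto_norm_zero_cancel, rule tendsto_sandwich[OF _ _ tendsto_const])
      show "(\<lambda>n. \<delta> (s n) * (L * D)) \<longlonglongrightarrow> 0" using tendsto_mult_left_zero[OF \<delta>s] .
      show "\<forall>\<^sub>F n in sequentially. norm (\<delta> (s n) * w (s n) (zs n)) \<le> \<delta> (s n) * (L * D)"
        using wb \<delta> by (auto simp: abs_mult less_imp_le intro!: always_eventually mult_left_mono)
    qed auto
    from tendsto_add[OF this ls] show ?thesis by (simp add: w_def algebra_simps)
  qed
  have sub: "cell_sub F (- l) g"
    unfolding cell_sub_def
  proof (intro allI ballI)
    fix y q assume q: "q \<in> superdiff UNIV g y"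
    obtain zs qs where z: "\<forall>\<^sub>F n in sequentially. qs n \<in> superdiff UNIV (w (s n)) (zs n)"
      "zs \<longlonglongrightarrow> y" "qs \<longlonglongrightarrow> q"
    proof (rule superdiff_stable[of UNIV g "\<lambda>n. w (s n)" y q])
      show "\<forall>\<^sub>F n in sequentially. \<forall>z\<in>K. w (s n) z \<le> g z + e" if "compact K" "e > 0" for K e
        using near[OF that] by eventually_elim force
    qed (use gcont wcont gp q in auto)
    have eq: "superdiff UNIV (w n) z = superdiff UNIV (v n) z" for n z
      using superdiff_shift[of UNIV "v n" "- v n 0" z] by (simp add: w_def[abs_def])
    have "\<forall>\<^sub>F n in sequentially. \<delta> (s n) * v (s n) (zs n) + F (zs n) (qs n) \<le> 0"
      using z(1) by eventually_elim (unfold eq, rule v(4))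
    with tendsto_add[OF dv[of zs] tendsto_curried[OF cont z(2,3)]]
    have "l + F y q \<le> 0" by (rule tendsto_upperbound) simp
    then show "F y q \<le> - l" by simp
  qed
  have sup: "cell_sup F (- l) g"
    unfolding cell_sup_def
  proof (intro allI ballI)
    fix y q assume q: "q \<in> superdiff UNIV (\<lambda>y. - g y) y"
    obtain zs qs where z: "\<forall>\<^sub>F n in sequentially. qs n \<in> superdiff UNIV (\<lambda>y. - w (s n) y) (zs n)"
      "zs \<longlonglongrightarrow> y" "qs \<longlonglongrightarrow> q"
    proof (rule superdiff_stable[of UNIV "\<lambda>y. - g y" "\<lambda>n y. - w (s n) y" y q])
      show "\<forall>\<^sub>F n in sequentially. \<forall>z\<in>K. - w (s n) z \<le> - g z + e" if "compact K" "e > 0" for K e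
        using near[OF that] by eventually_elim force
      show "(\<lambda>n. - w (s n) y) \<longlonglongrightarrow> - g y" by (rule tendsto_minus[OF gp])
      show "continuous_on UNIV (\<lambda>y. - g y)" by (rule continuous_on_minus[OF gcont])
      show "continuous_on UNIV (\<lambda>y. - w (s n) y)" for n by (rule continuous_on_minus[OF wcont])
    qed (use q in auto)
    have eq: "superdiff UNIV (\<lambda>y. - w n y) z = superdiff UNIV (\<lambda>y. - v n y) z" for n z
      using superdiff_shift[of UNIV "\<lambda>y. - v n y" "v n 0" z] by (simp add: w_def)
    have "\<forall>\<^sub>F n in sequentially. 0 \<le> \<delta> (s n) * v (s n) (zs n) + F (zs n) (- qs n)"
      using z(1) by eventually_elim (unfold eq, rule v(5))
    with tendsto_add[OF dv[of zs] tendsto_curried[OF cont z(2) tendsto_minus[OF z(3)]]]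
    have "0 \<le> l + F y (- q)" by (rule tendsto_lowerbound) simp
    then show "- l \<le> F y (- q)" by simp
  qed
  show thesis by (rule that[of g "- l"]) (use glip gper sub sup in auto)
qed

end

text \<open>Doubling of variables in which the Lipschitz constant of \<open>v2\<close> bounds the
  common gradient \<open>q\<close>. As the penalization grows, points and gradients stay in a
  compact set, and a limit point satisfies both inequalities at once. Restricting \<open>F12\<close>
  to the sublevel set of \<open>F1\<close> is essential for its use: on it coercivity bounds the
  gradients. The case \<open>F1 = F2\<close>, \<open>d = 0\<close> is uniqueness of the
  constant.\<close>

lemma cell_comparison:
  fixes v1 v2 :: "real^'n \<Rightarrow> real"
  assumes F1: "continuous_on UNIV (\<lambda>(y, q). F1 y q)" and F2: "continuous_on UNIV (\<lambda>(y, q). F2 y q)"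
    and v1: "continuous_on UNIV v1" "Z_periodic v1" "cell_sub F1 c1 v1"
    and v2: "L-lipschitz_on UNIV v2" "Z_periodic v2" "cell_sup F2 c2 v2"
    and F12: "\<And>y q. F1 y q \<le> c1 \<Longrightarrow> F2 y q \<le> F1 y q + d"
  shows "c2 \<le> c1 + d"
proof -
  let ?Q = "cbox (0::real^'n) (\<chi> i. 1)"
  have L0: "0 \<le> L" using v2(1) lipschitz_on_nonneg by blast
  have v2c: "continuous_on UNIV v2" by (rule lipschitz_on_continuous_on[OF v2(1)])
  obtain B1 where B1: "\<And>y. \<bar>v1 y\<bar> \<le> B1" using Z_periodic_bounded[OF v1(2,1)] by blast
  obtain B2 where B2: "\<And>y. \<bar>v2 y\<bar> \<le> B2" using Z_periodic_bounded[OF v2(2) v2c] by blast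
  obtain D where D: "\<And>y. y \<in> ?Q \<Longrightarrow> norm y \<le> D"
    using bounded_cbox unfolding bounded_iff by blast
  have "\<exists>x\<in>?Q. \<exists>q. norm q \<le> 2 * L \<and> F1 x q \<le> c1 \<and> c2 \<le> F2 (x - (1 / (2 * real (Suc n))) *\<^sub>R q) q" for n
  proof -
    define a where "a = real (Suc n)"
    have a: "a \<ge> 1" by (simp add: a_def)
    \<comment> \<open>Written with the displacement \<open>z = y - x\<close>: by periodicity
      \<open>x\<close> can be moved into the unit cube, which leaves coercivity to be checked in
      \<open>z\<close> alone.\<close>
    define \<Phi> where "\<Phi> x z = v1 x - v2 (x + z) - a * (norm z)\<^sup>2" for x z
    obtain p where p: "p \<in> ?Q \<times> UNIV" "\<And>p'. p' \<in> ?Q \<times> UNIV \<Longrightarrow> \<Phi> (fst p') (snd p') \<le> \<Phi> (fst p) (snd p)"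
    proof (rule attains_max_coercive[of "?Q \<times> UNIV" "\<lambda>p. \<Phi> (fst p) (snd p)" "(0, 0)" "D + (2 * B1 + 2 * B2 + 1)"])
      show "closed (?Q \<times> (UNIV :: (real^'n) set))" by (intro closed_Times) auto
      show "continuous_on (?Q \<times> UNIV) (\<lambda>p. \<Phi> (fst p) (snd p))"
        unfolding \<Phi>_def
        by (intro continuous_intros continuous_on_compose2[OF v1(1)] continuous_on_compose2[OF v2c]) auto
      show "((0::real^'n), (0::real^'n)) \<in> ?Q \<times> UNIV" by (simp add: mem_box_cart)
      fix p assume p: "p \<in> ?Q \<times> (UNIV :: (real^'n) set)" "norm p > D + (2 * B1 + 2 * B2 + 1)"
      obtain x z where xz: "p = (x, z)" by (cases p)
      have "norm z > 2 * B1 + 2 * B2 + 1"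
        using p norm_Pair_le[of x z] D[of x] by (auto simp: xz)
      moreover have "B1 \<ge> 0" "B2 \<ge> 0" using B1[of 0] B2[of 0] by linarith+
      ultimately have "norm z > 1" by linarith
      then have "norm z \<le> (norm z)\<^sup>2" by (simp add: self_le_power)
      also have "\<dots> \<le> a * (norm z)\<^sup>2" using a by (simp add: mult_le_cancel_right1)
      finally have "2 * B1 + 2 * B2 \<le> a * (norm z)\<^sup>2" using \<open>norm z > 2 * B1 + 2 * B2 + 1\<close> by linarith
      then show "\<Phi> (fst p) (snd p) \<le> \<Phi> (fst (0, 0)) (snd (0, 0))"
        using B1[of x] B1[of 0] B2[of "x + z"] B2[of 0] by (simp add: xz \<Phi>_def)
    qed blast
    obtain x z where xz: "p = (x, z)" by (cases p)
    have xQ: "x \<in> ?Q" using p(1) xz by simp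
    have max: "\<Phi> x' z' \<le> \<Phi> x z" for x' z'
    proof -
      obtain k where k: "\<forall>i. k $ i \<in> \<int>" "x' + k \<in> ?Q" by (rule Z_periodic_rep)
      have "v1 (x' + k) = v1 x'" "v2 (x' + z' + k) = v2 (x' + z')"
        using v1(2) v2(2) k(1) unfolding Z_periodic_def by blast+
      moreover have "x' + k + z' = x' + z' + k" by simp
      ultimately have "\<Phi> x' z' = \<Phi> (x' + k) z'" by (simp only: \<Phi>_def)
      also have "\<dots> \<le> \<Phi> x z" using p(2)[of "(x' + k, z')"] k(2) xz by simp
      finally show ?thesis .
    qed
    define y where "y = x + z"
    have max': "v1 x' - v2 y' - a * (norm (y' - x'))\<^sup>2 \<le> v1 x - v2 y - a * (norm (y - x))\<^sup>2" for x' y'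
      using max[of x' "y' - x'"] by (simp add: \<Phi>_def y_def)
    define q where "q = (2 * a) *\<^sub>R (x - y)"
    have "(a * 1) *\<^sub>R (2 *\<^sub>R (x - y)) \<in> superdiff UNIV v1 x"
      by (rule superdiffI[OF C1_scale[OF C1_norm_squared[of y], of a]])
        (use max'[of _ y] in \<open>auto simp: norm_minus_commute\<close>)
    then have 1: "F1 x q \<le> c1" using v1(3) unfolding cell_sub_def by (simp add: q_def mult.commute)
    have "(a * 1) *\<^sub>R (2 *\<^sub>R (y - x)) \<in> superdiff UNIV (\<lambda>y. - v2 y) y"
      by (rule superdiffI[OF C1_scale[OF C1_norm_squared[of x], of a]])
        (use max'[of x] in \<open>auto simp: algebra_simps\<close>)
    moreover have "- ((a * 1) *\<^sub>R (2 *\<^sub>R (y - x))) = q"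
      by (simp add: q_def scaleR_right_diff_distrib mult.commute)
    ultimately have 2: "c2 \<le> F2 y q" using v2(3) unfolding cell_sup_def by metis
    \<comment> \<open>Comparison with the diagonal pair \<open>(x, x)\<close>: the Lipschitz bound
      of \<open>v2\<close> absorbs the penalty, whence \<open>norm q \<le> 2 * L\<close> for every
      \<open>a\<close>.\<close>
    have "a * (norm (y - x))\<^sup>2 \<le> L * norm (y - x)"
      using max'[of x x] lipschitz_realD[OF v2(1), of x y] by (simp add: norm_minus_commute)
    then have "a * norm (y - x) \<le> L"
      using L0 by (cases "norm (y - x) = 0") (auto simp: power2_eq_square)
    then have "norm q \<le> 2 * L" using a by (simp add: q_def norm_minus_commute)
    moreover have "y = x - (1 / (2 * a)) *\<^sub>R q" using a by (simp add: q_def)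
    ultimately show ?thesis using 1 2 xQ unfolding a_def by metis
  qed
  then obtain x q where x: "\<And>n. x n \<in> ?Q" and q: "\<And>n. norm (q n) \<le> 2 * L"
    and 1: "\<And>n. F1 (x n) (q n) \<le> c1"
    and 2: "\<And>n. c2 \<le> F2 (x n - (1 / (2 * real (Suc n))) *\<^sub>R q n) (q n)" by metis
  have "compact (?Q \<times> cball (0::real^'n) (2 * L))" by (intro compact_Times) auto
  then have "seq_compact (?Q \<times> cball (0::real^'n) (2 * L))" by (simp add: compact_eq_seq_compact_metric)
  moreover have "\<forall>n. (x n, q n) \<in> ?Q \<times> cball 0 (2 * L)" using x q by simp
  ultimately obtain l r where r: "strict_mono r" "((\<lambda>n. (x n, q n)) \<circ> r) \<longlonglongrightarrow> l"
    by (rule seq_compactE)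
  have xr: "(\<lambda>n. x (r n)) \<longlonglongrightarrow> fst l" and qr: "(\<lambda>n. q (r n)) \<longlonglongrightarrow> snd l"
    using tendsto_fst[OF r(2)] tendsto_snd[OF r(2)] by (simp_all add: o_def)
  have "(\<lambda>n. 1 / (2 * real (Suc n))) \<longlonglongrightarrow> 0"
    using tendsto_mult_right_zero[OF LIMSEQ_inverse_real_of_nat, of "1/2"] by (simp add: inverse_eq_divide)
  from LIMSEQ_subseq_LIMSEQ[OF this r(1)]
  have "(\<lambda>n. x (r n) - (1 / (2 * real (Suc (r n)))) *\<^sub>R q (r n)) \<longlonglongrightarrow> fst l - 0 *\<^sub>R snd l"
    by (intro tendsto_intros xr qr) (simp add: o_def)
  from tendsto_lowerbound[OF tendsto_curried[OF F2 this qr]] 2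
  have "c2 \<le> F2 (fst l) (snd l)" by simp
  moreover have 3: "F1 (fst l) (snd l) \<le> c1"
    using tendsto_upperbound[OF tendsto_curried[OF F1 xr qr], of c1] 1 by simp
  ultimately show ?thesis using F12[OF 3] by linarith
qed

text \<open>Test at a maximum point of \<open>v\<close>, where 0 is a superdifferential. Together
  with its counterpart this places the effective Hamiltonian between values of \<open>H\<close> at
  the same \<open>p\<close>, giving coercivity and local bounds.\<close>

lemma cell_sub_ge_somewhere:
  assumes "Z_periodic v" "continuous_on UNIV v" "cell_sub F c v"
  obtains y where "F y 0 \<le> c"
proof -
  obtain z where "\<And>w. v w \<le> v z" using Z_periodic_attains_max[OF assms(1,2)] by blast
  then have "0 \<in> superdiff UNIV v z"
    by (intro superdiffI[OF C1_const[of 0]]) auto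
  then show thesis using assms(3) that unfolding cell_sub_def by blast
qed

lemma cell_sup_le_somewhere:
  assumes "Z_periodic v" "continuous_on UNIV v" "cell_sup F c v"
  obtains y where "c \<le> F y 0"
proof -
  have "Z_periodic (\<lambda>y. - v y)" "continuous_on UNIV (\<lambda>y. - v y)"
    using assms by (auto simp: Z_periodic_def intro: continuous_on_minus)
  then obtain z where "\<And>w. - v w \<le> - v z" using Z_periodic_attains_max by blast
  then have "0 \<in> superdiff UNIV (\<lambda>y. - v y) z"
    by (intro superdiffI[OF C1_const[of 0]]) auto
  then show thesis using assms(3) that unfolding cell_sup_def by fastforce
qed

section \<open>Comparison for monotone systems\<close>

lemma visc_subsolutionD:
  assumes "visc_subsolution G T u0 u" "t > 0" "(p, \<tau>) \<in> superdiff (strip T) (\<lambda>z. u z $ i) (x, t)"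
  shows "\<tau> + G i x t (u (x, t)) p \<le> 0"
proof -
  obtain \<phi> g where \<phi>: "C1_with_gradient \<phi> g" "local_max_on (strip T) (\<lambda>w. u w $ i - \<phi> w) (x, t)"
    "g (x, t) = (p, \<tau>)"
    using assms(3) by (rule superdiffE)
  have "snd (g (x, t)) + G i x t (u (x, t)) (fst (g (x, t))) \<le> 0"
    using assms(1) conjI[OF \<phi>(1) conjI[OF assms(2) \<phi>(2)]] unfolding visc_subsolution_def by blast
  then show ?thesis by (simp add: \<phi>(3))
qed

lemma visc_supersolutionD:
  assumes "visc_supersolution G T u0 u" "t > 0" "(p, \<tau>) \<in> superdiff (strip T) (\<lambda>z. - u z $ i) (x, t)"
  shows "0 \<le> - \<tau> + G i x t (u (x, t)) (- p)"
proof -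
  obtain \<phi> g where \<phi>: "C1_with_gradient \<phi> g" "local_max_on (strip T) (\<lambda>w. - u w $ i - \<phi> w) (x, t)"
    "g (x, t) = (p, \<tau>)"
    using assms(3) by (rule superdiffE)
  have "local_min_on (strip T) (\<lambda>w. u w $ i - - \<phi> w) (x, t)"
    unfolding local_min_iff_max using \<phi>(2) by simp
  from conjI[OF C1_minus[OF \<phi>(1)] conjI[OF assms(2) this]]
  have "0 \<le> snd (- g (x, t)) + G i x t (u (x, t)) (fst (- g (x, t)))"
    using assms(1) unfolding visc_supersolution_def by blast
  then show ?thesis by (simp add: \<phi>(3))
qed

lemma C1_square: "C1_with_gradient (\<lambda>t::real. (t - s)\<^sup>2) (\<lambda>t. 2 * (t - s))"
  using C1_norm_squared[of s] by simp

lemma finite_type_attains_max: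
  fixes f :: "'m::finite \<Rightarrow> real"
  obtains i where "\<And>k. f k \<le> f i"
proof -
  have "Max (range f) \<in> range f" by (rule Max_in) auto
  then obtain i where "Max (range f) = f i" by blast
  then have "f k \<le> f i" for k using Max_ge[of "range f" "f k"] by auto
  then show thesis by (rule that)
qed

lemma norm_le_CARD:
  fixes r :: "real^'m"
  assumes "\<And>k. \<bar>r $ k\<bar> \<le> B"
  shows "norm r \<le> real CARD('m) * B"
proof -
  have "norm r \<le> (\<Sum>k\<in>UNIV. \<bar>r $ k\<bar>)" by (rule norm_le_l1_cart)
  also have "\<dots> \<le> (\<Sum>k\<in>(UNIV::'m set). B)" by (rule sum_mono) (use assms in auto)
  finally show ?thesis by simp
qed

lemma closed_strip: "closed (strip T)"
  unfolding strip_def by (intro closed_Times) auto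

lemma BUC_component_bounded:
  fixes w :: "'a::metric_space \<Rightarrow> real^'m"
  assumes "BUC_on S w"
  obtains B where "\<And>z i. z \<in> S \<Longrightarrow> \<bar>w z $ i\<bar> \<le> B"
proof -
  obtain B where B: "\<And>z. z \<in> S \<Longrightarrow> norm (w z) \<le> B"
    using assms unfolding BUC_on_def bounded_iff by blast
  show thesis by (rule that[OF order_trans[OF component_le_norm_cart B]])
qed

lemma BUC_component_uniform:
  fixes w :: "'a::metric_space \<Rightarrow> real^'m"
  assumes w: "BUC_on S w" and e: "e > 0"
  obtains d where "d > 0"
    "\<And>z z' i. z \<in> S \<Longrightarrow> z' \<in> S \<Longrightarrow> dist z z' < d \<Longrightarrow> \<bar>w z $ i - w z' $ i\<bar> < e"
proof -
  obtain d where d: "d > 0" "\<And>z z'. z \<in> S \<Longrightarrow> z' \<in> S \<Longrightarrow> dist z' z < d \<Longrightarrow> dist (w z') (w z) < e"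
    using w e unfolding BUC_on_def uniformly_continuous_on_def by blast
  have "\<bar>w z $ i - w z' $ i\<bar> < e" if "z \<in> S" "z' \<in> S" "dist z z' < d" for z z' i
    using d(2)[OF that(2,1,3)] component_le_norm_cart[of "w z - w z'" i] by (simp add: dist_norm)
  with d(1) show thesis by (rule that)
qed

lemma BUC_space_uniform:
  fixes w :: "(real^'n) \<times> real \<Rightarrow> real^'m"
  assumes "BUC_on (strip T) w" "e > 0"
  shows "\<exists>d>0. \<forall>i x y t. t \<in> {0..T} \<and> dist x y < d \<longrightarrow> \<bar>w (x, t) $ i - w (y, t) $ i\<bar> < e"
proof -
  obtain d where "d > 0" "\<And>z z' i. z \<in> strip T \<Longrightarrow> z' \<in> strip T \<Longrightarrow> dist z z' < d \<Longrightarrow> \<bar>w z $ i - w z' $ i\<bar> < e"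
    using BUC_component_uniform[OF assms] by blast
  then show ?thesis by (intro exI[of _ d]) (auto simp: strip_def dist_Pair_Pair)
qed

text \<open>\<open>G_unif\<close> compares values at the same \<open>r\<close>: in the doubling
  argument monotonicity first replaces \<open>v\<close> by \<open>u\<close> in that slot.
  \<open>G_mono\<close> is (Mon) with the maximum over the index spelled out as
  inequalities.\<close>

locale monotone_nonlinearity =
  fixes G :: "'m::finite \<Rightarrow> real^'n \<Rightarrow> real^'m \<Rightarrow> real^'n \<Rightarrow> real"
  assumes G_coer: "\<And>K. \<exists>R. \<forall>i x r p. R \<le> norm p \<longrightarrow> K \<le> G i x r p"
    and G_unif: "\<And>R e. e > 0 \<Longrightarrow> \<exists>d>0. \<forall>i x y r p q. norm r \<le> R \<and> norm p \<le> R \<and> norm q \<le> R \<and>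
      dist x y < d \<and> dist p q < d \<longrightarrow> \<bar>G i x r p - G i y r q\<bar> < e"
    and G_mono: "\<And>i x r s p. (\<And>k. r $ k - s $ k \<le> r $ i - s $ i) \<Longrightarrow> 0 \<le> r $ i - s $ i \<Longrightarrow>
      G i x s p \<le> G i x r p"
begin

text \<open>Doubling of variables in which the time penalization \<open>(t - s)\<^sup>2 / \<eta>\<close> is kept: the equation for
  \<open>u\<close> and coercivity then bound the gradient \<open>2 * a * (x - y)\<close> by a constant independent of \<open>a\<close>, so
  no growth condition on the modulus of \<open>G\<close> in \<open>x\<close> is needed when \<open>a\<close> tends to infinity.\<close>

lemma doubling:
  assumes \<eta>: "\<eta> > 0" and D: "0 \<le> D"
    and uc: "continuous_on (strip T) u" and vc: "continuous_on (strip T) v"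
    and ub: "\<And>z i. z \<in> strip T \<Longrightarrow> \<bar>u z $ i\<bar> \<le> B" and vb: "\<And>z i. z \<in> strip T \<Longrightarrow> \<bar>v z $ i\<bar> \<le> B"
    and vu: "\<And>e. e > 0 \<Longrightarrow> \<exists>d>0. \<forall>i x y t. t \<in> {0..T} \<and> dist x y < d \<longrightarrow> \<bar>v (x, t) $ i - v (y, t) $ i\<bar> < e"
    and sub: "\<And>i x t p \<tau>. t > 0 \<Longrightarrow> (p, \<tau>) \<in> superdiff (strip T) (\<lambda>z. u z $ i) (x, t) \<Longrightarrow>
      \<tau> + G i x (u (x, t)) p \<le> 0"
    and sup: "\<And>i x t p \<tau>. t > 0 \<Longrightarrow> (p, \<tau>) \<in> superdiff (strip T) (\<lambda>z. - v z $ i) (x, t) \<Longrightarrow>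
      0 \<le> - \<tau> + G i x (v (x, t)) (- p)"
    and b1: "\<And>i x t. t \<in> {0..T} \<Longrightarrow> u (x, t) $ i - v (x, 0) $ i \<le> D + t\<^sup>2 / \<eta>"
    and b2: "\<And>i x t. t \<in> {0..T} \<Longrightarrow> u (x, 0) $ i - v (x, t) $ i \<le> D + t\<^sup>2 / \<eta>"
    and ts: "t0 \<in> {0..T}" "s0 \<in> {0..T}"
  shows "u (x0, t0) $ i0 - v (x0, s0) $ i0 \<le> D + (t0 - s0)\<^sup>2 / \<eta>"
proof (rule ccontr)
  assume neg: "\<not> ?thesis"
  \<comment> \<open>A third of the excess: the terms \<open>\<mu> * t0\<close> and
    \<open>\<beta> * J x0\<close> cost at most \<sigma> each, which leaves
    \<open>\<Phi> \<ge> \<sigma>\<close> at the given point.\<close>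
  define \<sigma> where "\<sigma> = (u (x0, t0) $ i0 - v (x0, s0) $ i0 - D - (t0 - s0)\<^sup>2 / \<eta>) / 3"
  have \<sigma>: "\<sigma> > 0" using neg by (simp add: \<sigma>_def)
  have T: "T \<ge> 0" using ts by simp
  have B: "B \<ge> 0" using ub[of "(0, 0)" i0] T by (simp add: strip_def)
  define \<mu> where "\<mu> = \<sigma> / (T + 1)"
  have "\<mu> > 0" using \<sigma> T by (simp add: \<mu>_def)
  then have "\<mu> * t0 \<le> \<mu> * (T + 1)" using ts by (intro mult_left_mono) auto
  with \<open>\<mu> > 0\<close> have \<mu>: "\<mu> > 0" "\<mu> * t0 \<le> \<sigma>" using T by (simp_all add: \<mu>_def)
  \<comment> \<open>The time penalization has derivative at least \<open>- 2 * T / \<eta>\<close> on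
    the strip, so the equation for \<open>u\<close> keeps \<open>G\<close> below this level and the
    gradient below \<open>R0\<close>.\<close>
  obtain R0 where R0: "\<And>i x r p. R0 \<le> norm p \<Longrightarrow> 2 * T / \<eta> + 1 \<le> G i x r p" using G_coer by blast
  define R where "R = \<bar>R0\<bar> + 1 + real CARD('m) * B"
  obtain d where d: "d > 0" "\<And>i x y r p q. norm r \<le> R \<Longrightarrow> norm p \<le> R \<Longrightarrow> norm q \<le> R \<Longrightarrow>
      dist x y < d \<Longrightarrow> dist p q < d \<Longrightarrow> \<bar>G i x r p - G i y r q\<bar> < \<mu>"
    using G_unif[OF \<mu>(1), of R] by blast
  obtain dv where dv: "dv > 0"
    "\<And>i x y t. t \<in> {0..T} \<Longrightarrow> dist x y < dv \<Longrightarrow> \<bar>v (x, t) $ i - v (y, t) $ i\<bar> < \<sigma>"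
    using vu[OF \<sigma>] by blast
  define J where "J x = sqrt (1\<^sup>2 + (norm (x - 0))\<^sup>2)" for x :: "real^'n"
  have J: "norm x \<le> J x" "J x > 0" for x
    using norm_le_sqrt_sum[of x 1] by (auto simp: J_def add_pos_nonneg)
  have JC1: "C1_with_gradient J (\<lambda>x. (1 / J x) *\<^sub>R x)"
    using C1_sqrt_norm[of 1 "0 :: real^'n"] by (simp add: J_def[abs_def])
  \<comment> \<open>Three demands: the penalty at \<open>x0\<close> costs at most \<sigma>, its
    gradient \<open>e\<close> has norm at most 1 so that \<open>p\<close> stays within
    \<open>R\<close>, and \<open>e\<close> is shorter than the radius \<open>d\<close> of uniform
    continuity.\<close>
  define \<beta> where "\<beta> = min (\<sigma> / J x0) (min 1 (d / 2))"
  have "\<beta> \<le> \<sigma> / J x0" by (simp add: \<beta>_def)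
  then have \<beta>1: "\<beta> * J x0 \<le> \<sigma>" using J(2)[of x0] by (simp add: pos_le_divide_eq)
  have \<beta>: "\<beta> > 0" "\<beta> \<le> 1" "\<beta> < d"
    using \<sigma> J d(1) by (auto simp: \<beta>_def)
  define \<rho> where "\<rho> = min d dv"
  have \<rho>: "\<rho> > 0" using d dv by (simp add: \<rho>_def)
  \<comment> \<open>No limit in \<open>a\<close> has to be taken: at the maximum
    \<open>a * (norm (x - y))^2 \<le> 2 * B\<close>, so this value already forces
    \<open>norm (x - y) < \<rho>\<close>.\<close>
  define a where "a = 1 + (2 * B + 1) / \<rho>\<^sup>2"
  have a: "a \<ge> 1" "2 * B < a * \<rho>\<^sup>2"
    using B \<rho> by (auto simp: a_def field_simps add_pos_nonneg)
  define \<Phi> where "\<Phi> i x t y s = u (x, t) $ i - v (y, s) $ i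
      - (D + \<mu> * t + \<beta> * J x + a * (norm (x - y))\<^sup>2 + (t - s)\<^sup>2 / \<eta>)" for i x t y s
  have \<Phi>0: "\<sigma> \<le> \<Phi> i0 x0 t0 x0 s0"
  proof -
    have "u (x0, t0) $ i0 - v (x0, s0) $ i0 - D - (t0 - s0)\<^sup>2 / \<eta> = 3 * \<sigma>" by (simp add: \<sigma>_def)
    then show ?thesis using \<mu>(2) \<beta>1 by (simp add: \<Phi>_def)
  qed
  let ?S = "strip T \<times> strip T :: (((real^'n) \<times> real) \<times> (real^'n) \<times> real) set"
  let ?f = "\<lambda>i z. \<Phi> i (fst (fst z)) (snd (fst z)) (fst (snd z)) (snd (snd z))"
  let ?z0 = "((x0, t0), (x0, s0))"
  \<comment> \<open>Far away only \<open>\<Phi> \<le> 0\<close> is known, and for an index other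
    than \<open>i0\<close> the value at \<open>?z0\<close> may be negative; truncation at 0 makes
    the two comparable. It is harmless, as the overall maximum is at least
    \<open>\<sigma> > 0\<close>.\<close>
  have "\<exists>z\<in>?S. \<forall>w\<in>?S. max (?f i w) 0 \<le> max (?f i z) 0" for i
  proof (rule attains_max_coercive[of ?S "\<lambda>z. max (?f i z) 0" ?z0 "4 * B / \<beta> + 2 * B + 1 + 2 * T"])
    show "closed ?S" by (intro closed_Times closed_strip)
    have "continuous_on ?S (\<lambda>z. u (fst z))" "continuous_on ?S (\<lambda>z. v (snd z))"
      by (rule continuous_on_compose2[OF uc] continuous_on_compose2[OF vc],
          auto intro: continuous_on_fst continuous_on_snd continuous_on_id)+
    then show "continuous_on ?S (\<lambda>z. max (?f i z) 0)"
      unfolding \<Phi>_def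
      by (intro continuous_intros continuous_on_compose2[OF C1_continuous[OF JC1, of UNIV]])
        (use \<eta> in auto)
    show "?z0 \<in> ?S" using ts by (simp add: strip_def)
    fix z assume z: "z \<in> ?S" "norm z > 4 * B / \<beta> + 2 * B + 1 + 2 * T"
    obtain x t y s where xt: "z = ((x, t), (y, s))" by (metis surj_pair)
    have S: "(x, t) \<in> strip T" "(y, s) \<in> strip T" "0 \<le> t" "t \<le> T" "0 \<le> s" "s \<le> T"
      using z(1) xt by (auto simp: strip_def)
    have "norm z \<le> norm (x, t) + norm (y, s)" unfolding xt by (rule norm_Pair_le)
    also have "\<dots> \<le> (norm x + t) + (norm y + s)"
      using norm_Pair_le[of x t] norm_Pair_le[of y s] S by simp
    also have "norm y \<le> norm x + norm (x - y)"
      by (metis norm_minus_commute norm_triangle_sub)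
    finally have big: "2 * norm x + norm (x - y) > 4 * B / \<beta> + 2 * B + 1" using z(2) S by simp
    have "2 * B \<le> \<beta> * J x + a * (norm (x - y))\<^sup>2"
    proof (cases "norm x > 2 * B / \<beta>")
      case True
      then have "2 * B < \<beta> * norm x" using \<beta> by (simp add: field_simps)
      also have "\<dots> \<le> \<beta> * J x" using J \<beta> by simp
      finally show ?thesis using a by (smt (verit) mult_nonneg_nonneg zero_le_power2)
    next
      case False
      then have n: "norm (x - y) > 2 * B + 1" using big by simp
      then have "norm (x - y) \<le> (norm (x - y))\<^sup>2" using B by (simp add: self_le_power)
      also have "\<dots> \<le> a * (norm (x - y))\<^sup>2" using a by (simp add: mult_le_cancel_right1)
      finally show ?thesis using n J(2)[of x] \<beta>(1) by (smt (verit) mult_pos_pos)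
    qed
    moreover have "\<mu> * t \<ge> 0" "(t - s)\<^sup>2 / \<eta> \<ge> 0" using \<mu> S \<eta> by auto
    ultimately have "?f i z \<le> 0"
      using ub[OF S(1), of i] vb[OF S(2), of i] D unfolding xt by (simp add: \<Phi>_def)
    then show "max (?f i z) 0 \<le> max (?f i ?z0) 0" by simp
  qed blast
  then obtain zm where zm: "\<And>i. zm i \<in> ?S" "\<And>i w. w \<in> ?S \<Longrightarrow> max (?f i w) 0 \<le> max (?f i (zm i)) 0"
    by metis
  obtain i where i: "\<And>k. ?f k (zm k) \<le> ?f i (zm i)"
    using finite_type_attains_max[of "\<lambda>k. ?f k (zm k)"] by blast
  obtain x t y s where xt: "zm i = ((x, t), (y, s))" by (metis surj_pair)
  have S: "(x, t) \<in> strip T" "(y, s) \<in> strip T" "t \<in> {0..T}" "s \<in> {0..T}"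
    using zm(1)[of i] xt by (auto simp: strip_def)
  have "max (?f i0 ?z0) 0 \<le> max (?f i0 (zm i0)) 0" by (rule zm(2)) (use ts in \<open>simp add: strip_def\<close>)
  then have ge: "\<sigma> \<le> \<Phi> i x t y s" using \<Phi>0 \<sigma> i[of i0] by (simp add: xt)
  have mx: "\<Phi> k x' t' y' s' \<le> \<Phi> i x t y s" if "t' \<in> {0..T}" "s' \<in> {0..T}" for k x' t' y' s'
    using zm(2)[of "((x', t'), (y', s'))" k] i[of k] ge \<sigma> that by (simp add: xt strip_def)
  have nn: "\<mu> * t \<ge> 0" "(t - s)\<^sup>2 / \<eta> \<ge> 0" "\<beta> * J x > 0" "a * (norm (x - y))\<^sup>2 \<ge> 0"
    using \<mu> S \<eta> \<beta> J a by auto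
  have "a * (norm (x - y))\<^sup>2 \<le> 2 * B"
    using ge nn \<sigma> D ub[OF S(1), of i] vb[OF S(2), of i] by (simp add: \<Phi>_def)
  also have "\<dots> < a * \<rho>\<^sup>2" by (rule a(2))
  finally have "(norm (x - y))\<^sup>2 < \<rho>\<^sup>2" using a(1) by simp
  then have xy: "dist x y < \<rho>" using \<rho> by (simp add: dist_norm power2_less_imp_less)
  \<comment> \<open>At an initial time \<open>b1\<close> or \<open>b2\<close>, together with the
    space modulus of \<open>v\<close> across the distance below \<open>dv\<close>, would give
    \<open>\<Phi> < \<sigma>\<close>.\<close>
  have "t \<noteq> 0"
  proof
    assume "t = 0"
    then show False using ge nn b2[OF S(4), of x i] dv(2)[OF S(4), of x y i] xy
      by (simp add: \<Phi>_def \<rho>_def)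
  qed
  moreover have "s \<noteq> 0"
  proof
    assume "s = 0"
    then show False using ge nn b1[OF S(3), of x i] dv(2)[of 0 x y i] xy T
      by (simp add: \<Phi>_def \<rho>_def)
  qed
  ultimately have ts0: "t > 0" "s > 0" using S by auto
  define p where "p = (2 * a) *\<^sub>R (x - y)"
  define e where "e = (\<beta> / J x) *\<^sub>R x"
  have ne: "norm e \<le> \<beta>" using J[of x] \<beta> by (simp add: e_def field_simps)
  have "(0 + \<beta> *\<^sub>R ((1 / J x) *\<^sub>R x) + a *\<^sub>R (2 *\<^sub>R (x - y)), \<mu> + (1 / \<eta>) *\<^sub>R (2 * (t - s)))
      \<in> superdiff (strip T) (\<lambda>z. u z $ i) (x, t)"
  proof (rule superdiffI)
    let ?P = "\<lambda>x. D + \<beta> * J x + a * (norm (x - y))\<^sup>2"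
    let ?Q = "\<lambda>t. \<mu> * t + (1 / \<eta>) * (t - s)\<^sup>2"
    show "C1_with_gradient (\<lambda>z. ?P (fst z) + ?Q (snd z))
        (\<lambda>z. (0 + \<beta> *\<^sub>R ((1 / J (fst z)) *\<^sub>R fst z) + a *\<^sub>R (2 *\<^sub>R (fst z - y)), 0)
          + (0, \<mu> + (1 / \<eta>) *\<^sub>R (2 * (snd z - s))))"
      by (intro C1_add C1_fst[of ?P] C1_snd[of ?Q] C1_const C1_linear C1_square C1_scale JC1 C1_norm_squared)
    fix w :: "(real^'n) \<times> real" assume "w \<in> strip T"
    moreover obtain x' t' where "w = (x', t')" by (cases w)
    ultimately show "u w $ i - (?P (fst w) + ?Q (snd w)) \<le> u (x, t) $ i - (?P (fst (x, t)) + ?Q (snd (x, t)))"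
      using mx[of t' s i x' y] S by (simp add: strip_def \<Phi>_def)
  qed (use S in auto)
  from sub[OF ts0(1) this]
  have 1: "\<mu> + 2 * (t - s) / \<eta> + G i x (u (x, t)) (p + e) \<le> 0"
    by (simp add: p_def e_def mult.commute add.commute)
  have "(a *\<^sub>R (2 *\<^sub>R (y - x)), (1 / \<eta>) *\<^sub>R (2 * (s - t))) \<in> superdiff (strip T) (\<lambda>z. - v z $ i) (y, s)"
  proof (rule superdiffI)
    let ?P = "\<lambda>y. a * (norm (y - x))\<^sup>2"
    let ?Q = "\<lambda>s. (1 / \<eta>) * (s - t)\<^sup>2"
    show "C1_with_gradient (\<lambda>z. ?P (fst z) + ?Q (snd z))
        (\<lambda>z. (a *\<^sub>R (2 *\<^sub>R (fst z - x)), 0) + (0, (1 / \<eta>) *\<^sub>R (2 * (snd z - t))))"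
      by (intro C1_add C1_fst[of ?P] C1_snd[of ?Q] C1_square C1_scale C1_norm_squared)
    fix w :: "(real^'n) \<times> real" assume "w \<in> strip T"
    moreover obtain y' s' where "w = (y', s')" by (cases w)
    ultimately show "- v w $ i - (?P (fst w) + ?Q (snd w)) \<le> - v (y, s) $ i - (?P (fst (y, s)) + ?Q (snd (y, s)))"
      using mx[of t s' i x y'] S by (simp add: strip_def \<Phi>_def norm_minus_commute power2_commute)
  qed (use S in auto)
  from sup[OF ts0(2) this]
  have "0 \<le> 2 * (t - s) / \<eta> + G i y (v (y, s)) (- ((a * 2) *\<^sub>R (y - x)))"
    by (simp add: algebra_simps diff_divide_distrib)
  moreover have "- ((a * 2) *\<^sub>R (y - x)) = p" by (simp add: p_def algebra_simps)
  ultimately have 2: "0 \<le> 2 * (t - s) / \<eta> + G i y (v (y, s)) p" by simp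
  have "G i y (v (y, s)) p \<le> G i y (u (x, t)) p"
  proof (rule G_mono)
    show "u (x, t) $ k - v (y, s) $ k \<le> u (x, t) $ i - v (y, s) $ i" for k
      using mx[OF S(3,4), of k x y] by (simp add: \<Phi>_def)
    show "0 \<le> u (x, t) $ i - v (y, s) $ i" using ge nn \<sigma> D by (simp add: \<Phi>_def)
  qed
  then have 3: "\<mu> \<le> G i y (u (x, t)) p - G i x (u (x, t)) (p + e)" using 1 2 by linarith
  have "(2 * (s - t)) / \<eta> \<le> (2 * T) / \<eta>" using S \<eta> by (intro divide_right_mono) auto
  moreover have "- (2 * (t - s) / \<eta>) = (2 * (s - t)) / \<eta>" by (simp add: algebra_simps diff_divide_distrib)
  ultimately have "- (2 * (t - s) / \<eta>) \<le> 2 * T / \<eta>" by simp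
  then have "G i x (u (x, t)) (p + e) < 2 * T / \<eta> + 1" using 1 \<mu>(1) by linarith
  then have "norm (p + e) < R0" using R0[of "p + e"] by (meson not_le)
  moreover have "norm p \<le> norm (p + e) + norm e" using norm_triangle_sub[of p "- e"] by (simp add: norm_triangle_ineq2 add.commute norm_diff_triangle_le)
  moreover have "real CARD('m) * B \<ge> 0" using B by simp
  ultimately have "norm p \<le> R" "norm (p + e) \<le> R" using ne \<beta>(2) unfolding R_def by linarith+
  moreover have "norm (u (x, t)) \<le> R"
    using norm_le_CARD[of "u (x, t)" B] ub[OF S(1)] by (simp add: R_def)
  moreover have "dist y x < d" using xy by (simp add: \<rho>_def dist_commute)
  moreover have "dist p (p + e) < d" using ne \<beta>(3) by (simp add: dist_norm)
  ultimately have "\<bar>G i y (u (x, t)) p - G i x (u (x, t)) (p + e)\<bar> < \<mu>" by (intro d(2))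
  then show False using 3 by linarith
qed

text \<open>The bounds \<open>b1\<close> and \<open>b2\<close> of \<open>doubling\<close> hold with
  \<open>D = e\<close>: for \<open>t < d\<close> by uniform continuity and the ordered initial data,
  for \<open>t \<ge> d\<close> because \<eta> is so small that \<open>t^2 / \<eta>\<close> exceeds
  \<open>2 * B\<close>.\<close>

lemma comparison:
  assumes u: "BUC_on (strip T) u" and v: "BUC_on (strip T) v"
    and sub: "visc_subsolution (\<lambda>i x t. G i x) T u0 u"
    and sup: "visc_supersolution (\<lambda>i x t. G i x) T u0 v"
    and z: "z \<in> strip T"
  shows "u z $ i \<le> v z $ i"
proof (rule field_le_epsilon)
  fix e :: real assume e: "e > 0"
  obtain B1 where B1: "\<And>z i. z \<in> strip T \<Longrightarrow> \<bar>u z $ i\<bar> \<le> B1"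
    using BUC_component_bounded[OF u] by blast
  obtain B2 where B2: "\<And>z i. z \<in> strip T \<Longrightarrow> \<bar>v z $ i\<bar> \<le> B2"
    using BUC_component_bounded[OF v] by blast
  define B where "B = max B1 B2"
  have B: "\<And>z i. z \<in> strip T \<Longrightarrow> \<bar>u z $ i\<bar> \<le> B" "\<And>z i. z \<in> strip T \<Longrightarrow> \<bar>v z $ i\<bar> \<le> B"
    using B1 B2 by (simp_all add: B_def max.coboundedI1 max.coboundedI2)
  have T: "0 \<le> T" using z by (auto simp: strip_def)
  have "B \<ge> 0" using B(1)[OF z, of i] by linarith
  obtain d1 where d1: "d1 > 0"
    "\<And>z z' i. z \<in> strip T \<Longrightarrow> z' \<in> strip T \<Longrightarrow> dist z z' < d1 \<Longrightarrow> \<bar>u z $ i - u z' $ i\<bar> < e"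
    using BUC_component_uniform[OF u e] by blast
  obtain d2 where d2: "d2 > 0"
    "\<And>z z' i. z \<in> strip T \<Longrightarrow> z' \<in> strip T \<Longrightarrow> dist z z' < d2 \<Longrightarrow> \<bar>v z $ i - v z' $ i\<bar> < e"
    using BUC_component_uniform[OF v e] by blast
  define d where "d = min d1 d2"
  have d: "d > 0" using d1 d2 by (simp add: d_def)
  define \<eta> where "\<eta> = d\<^sup>2 / (2 * B + 1)"
  have \<eta>: "\<eta> > 0" using d \<open>B \<ge> 0\<close> by (simp add: \<eta>_def)
  have large: "2 * B \<le> t\<^sup>2 / \<eta>" if "d \<le> t" for t
  proof -
    have "2 * B \<le> d\<^sup>2 / \<eta>" using d \<open>B \<ge> 0\<close> by (simp add: \<eta>_def)
    also have "\<dots> \<le> t\<^sup>2 / \<eta>" using that d \<eta> by (intro divide_right_mono power_mono) auto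
    finally show ?thesis .
  qed
  have init: "u (x, 0) $ k \<le> v (x, 0) $ k" for x k
    using sub sup unfolding visc_subsolution_def visc_supersolution_def by (meson order_trans)
  obtain x t where zt: "z = (x, t)" "t \<in> {0..T}" using z by (auto simp: strip_def)
  have "u (x, t) $ i - v (x, t) $ i \<le> e + (t - t)\<^sup>2 / \<eta>"
  proof (rule doubling[OF \<eta> _ _ _ B])
    show "continuous_on (strip T) u" "continuous_on (strip T) v"
      using u v by (auto simp: BUC_on_def intro: uniformly_continuous_imp_continuous)
    show "\<exists>d>0. \<forall>i x y t. t \<in> {0..T} \<and> dist x y < d \<longrightarrow> \<bar>v (x, t) $ i - v (y, t) $ i\<bar> < e'" if "e' > 0" for e'
      by (rule BUC_space_uniform[OF v that])
  next
    fix k and y :: "real^'n" and s assume s: "s \<in> {0..T}"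
    then have S: "(y, s) \<in> strip T" "(y, 0) \<in> strip T" by (auto simp: strip_def)
    show "u (y, s) $ k - v (y, 0) $ k \<le> e + s\<^sup>2 / \<eta>"
    proof (cases "s < d")
      case True
      then have "u (y, s) $ k - u (y, 0) $ k < e"
        using d1(2)[OF S, of k] s by (auto simp: dist_Pair_Pair d_def)
      moreover have "s\<^sup>2 / \<eta> \<ge> 0" using \<eta> by simp
      ultimately show ?thesis using init[of y k] by linarith
    next
      case False
      then show ?thesis using large[of s] B(1)[OF S(1), of k] B(2)[OF S(2), of k] e by linarith
    qed
    show "u (y, 0) $ k - v (y, s) $ k \<le> e + s\<^sup>2 / \<eta>"
    proof (cases "s < d")
      case True
      then have "v (y, 0) $ k - v (y, s) $ k < e"
        using d2(2)[OF S, of k] s by (auto simp: dist_Pair_Pair d_def)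
      moreover have "s\<^sup>2 / \<eta> \<ge> 0" using \<eta> by simp
      ultimately show ?thesis using init[of y k] by linarith
    next
      case False
      then show ?thesis using large[of s] B(1)[OF S(2), of k] B(2)[OF S(1), of k] e by linarith
    qed
  qed (use e zt visc_subsolutionD[OF sub] visc_supersolutionD[OF sup] in auto)
  then show "u z $ i \<le> v z $ i + e" by (simp add: zt)
qed

end

section \<open>Estimates independent of the nonlinearity's oscillations\<close>

lemma sqrt_one_norm:
  fixes x :: "'a::real_normed_vector"
  shows "norm x \<le> sqrt (1\<^sup>2 + (norm x)\<^sup>2)" "0 < sqrt (1\<^sup>2 + (norm x)\<^sup>2)" "1 \<le> sqrt (1\<^sup>2 + (norm x)\<^sup>2)"
    "sqrt (1\<^sup>2 + (norm x)\<^sup>2) \<le> 1 + norm x" "norm ((1 / sqrt (1\<^sup>2 + (norm x)\<^sup>2)) *\<^sub>R x) \<le> 1"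
proof -
  show 1: "norm x \<le> sqrt (1\<^sup>2 + (norm x)\<^sup>2)" by (rule norm_le_sqrt_sum)
  show 2: "1 \<le> sqrt (1\<^sup>2 + (norm x)\<^sup>2)" by simp
  then show 3: "0 < sqrt (1\<^sup>2 + (norm x)\<^sup>2)" by linarith
  show "sqrt (1\<^sup>2 + (norm x)\<^sup>2) \<le> 1 + norm x"
    using sqrt_sum_squares_le_sum[of 1 "norm x"] by simp
  show "norm ((1 / sqrt (1\<^sup>2 + (norm x)\<^sup>2)) *\<^sub>R x) \<le> 1"
    using 1 3 by (simp add: divide_le_eq)
qed

text \<open>\<open>C + (A + 1) * t\<close> is a strict barrier. At a maximum over points and indices
  the component \<open>i\<close> dominates and is nonnegative, so monotonicity compares
  \<open>u\<close> with 0 and only \<open>G\<close> at \<open>r = 0\<close> enters. The bound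
  \<open>B\<close> secures the existence of a maximum and does not reach the conclusion.\<close>

lemma subsolution_upper_bound:
  fixes G :: "'m::finite \<Rightarrow> real^'n \<Rightarrow> real^'m \<Rightarrow> real^'n \<Rightarrow> real"
  assumes mono: "\<And>i x r s p. (\<And>k. r $ k - s $ k \<le> r $ i - s $ i) \<Longrightarrow> 0 \<le> r $ i - s $ i \<Longrightarrow>
      G i x s p \<le> G i x r p"
    and A: "\<And>i x p. norm p \<le> 1 \<Longrightarrow> - A \<le> G i x 0 p" and A0: "0 \<le> A" and C0: "0 \<le> C"
    and uc: "continuous_on (strip T) u" and ub: "\<And>z i. z \<in> strip T \<Longrightarrow> \<bar>u z $ i\<bar> \<le> B"
    and sub: "\<And>i x t p \<tau>. t > 0 \<Longrightarrow> (p, \<tau>) \<in> superdiff (strip T) (\<lambda>z. u z $ i) (x, t) \<Longrightarrow>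
      \<tau> + G i x (u (x, t)) p \<le> 0"
    and init: "\<And>i x. u (x, 0) $ i \<le> C"
    and t0: "t0 \<in> {0..T}"
  shows "u (x0, t0) $ i0 \<le> C + (A + 1) * t0"
proof (rule ccontr)
  assume neg: "\<not> ?thesis"
  define \<sigma> where "\<sigma> = (u (x0, t0) $ i0 - C - (A + 1) * t0) / 2"
  have \<sigma>: "\<sigma> > 0" using neg by (simp add: \<sigma>_def)
  have T: "T \<ge> 0" using t0 by simp
  have B: "B \<ge> 0" using ub[of "(0, 0)" i0] T by (simp add: strip_def)
  define J where "J x = sqrt (1\<^sup>2 + (norm (x - 0))\<^sup>2)" for x :: "real^'n"
  have J: "norm x \<le> J x" "J x > 0" "norm ((1 / J x) *\<^sub>R x) \<le> 1" for x
    using sqrt_one_norm[of x] by (simp_all add: J_def)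
  have JC1: "C1_with_gradient J (\<lambda>x. (1 / J x) *\<^sub>R x)"
    using C1_sqrt_norm[of 1 "0 :: real^'n"] by (simp add: J_def[abs_def])
  define \<beta> where "\<beta> = min (\<sigma> / J x0) 1"
  have "\<beta> \<le> \<sigma> / J x0" by (simp add: \<beta>_def)
  then have \<beta>1: "\<beta> * J x0 \<le> \<sigma>" using J(2)[of x0] by (simp add: pos_le_divide_eq)
  have \<beta>: "\<beta> > 0" "\<beta> \<le> 1" using \<sigma> J by (auto simp: \<beta>_def)
  define \<Phi> where "\<Phi> i z = u z $ i - (C + \<beta> * J (fst z) + (A + 1) * snd z)" for i z
  have \<Phi>0: "\<sigma> \<le> \<Phi> i0 (x0, t0)"
  proof -
    have "u (x0, t0) $ i0 - C - (A + 1) * t0 = 2 * \<sigma>" by (simp add: \<sigma>_def)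
    then show ?thesis using \<beta>1 by (simp add: \<Phi>_def)
  qed
  have z0: "(x0, t0) \<in> strip T" using t0 by (simp add: strip_def)
  have "\<exists>z\<in>strip T. \<forall>w\<in>strip T. max (\<Phi> i w) 0 \<le> max (\<Phi> i z) 0" for i
  proof (rule attains_max_coercive[of "strip T" "\<lambda>z. max (\<Phi> i z) 0" "(x0, t0)" "B / \<beta> + T"])
    show "continuous_on (strip T) (\<lambda>z. max (\<Phi> i z) 0)"
      unfolding \<Phi>_def
      by (intro continuous_intros uc continuous_on_compose2[OF C1_continuous[OF JC1, of UNIV]]) auto
    fix z :: "(real^'n) \<times> real" assume z: "z \<in> strip T" "norm z > B / \<beta> + T"
    obtain x t where xt: "z = (x, t)" by (cases z)
    have t: "0 \<le> t" "t \<le> T" using z(1) by (auto simp: strip_def xt)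
    have "norm x > B / \<beta>" using norm_Pair_le[of x t] z(2) t by (simp add: xt)
    then have "B < \<beta> * norm x" using \<beta> by (simp add: field_simps)
    also have "\<dots> \<le> \<beta> * J x" using J \<beta> by simp
    finally have "B < \<beta> * J x" .
    moreover have "(A + 1) * t \<ge> 0" using A0 t by simp
    ultimately have "\<Phi> i z \<le> 0"
      using ub[OF z(1), of i] C0 by (simp add: \<Phi>_def xt)
    then show "max (\<Phi> i z) 0 \<le> max (\<Phi> i (x0, t0)) 0" by simp
  qed (blast intro: z0 closed_strip)+
  then obtain zm where zm: "\<And>i. zm i \<in> strip T" "\<And>i w. w \<in> strip T \<Longrightarrow> max (\<Phi> i w) 0 \<le> max (\<Phi> i (zm i)) 0"
    by metis
  obtain i where i: "\<And>k. \<Phi> k (zm k) \<le> \<Phi> i (zm i)"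
    using finite_type_attains_max[of "\<lambda>k. \<Phi> k (zm k)"] by blast
  obtain x t where xt: "zm i = (x, t)" by (cases "zm i")
  have S: "(x, t) \<in> strip T" "0 \<le> t" using zm(1)[of i] by (auto simp: xt strip_def)
  have ge: "\<sigma> \<le> \<Phi> i (x, t)" using zm(2)[OF z0, of i0] \<Phi>0 \<sigma> i[of i0] by (simp add: xt)
  have mx: "\<Phi> k w \<le> \<Phi> i (x, t)" if "w \<in> strip T" for k w
    using zm(2)[OF that, of k] i[of k] ge \<sigma> by (simp add: xt)
  have pos: "\<beta> * J x > 0" "(A + 1) * t \<ge> 0" using \<beta> J A0 S by auto
  have "t \<noteq> 0" using ge pos init[of x i] \<sigma> by (auto simp: \<Phi>_def)
  then have "t > 0" using S by simp
  have "(0 + \<beta> *\<^sub>R ((1 / J x) *\<^sub>R x), A + 1) \<in> superdiff (strip T) (\<lambda>z. u z $ i) (x, t)"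
  proof (rule superdiffI)
    let ?P = "\<lambda>x. C + \<beta> * J x"
    show "C1_with_gradient (\<lambda>z. ?P (fst z) + (A + 1) * snd z)
        (\<lambda>z. (0 + \<beta> *\<^sub>R ((1 / J (fst z)) *\<^sub>R fst z), 0) + (0, A + 1))"
      by (intro C1_add C1_fst[of ?P] C1_snd[OF C1_linear] C1_const C1_scale JC1)
    fix w :: "(real^'n) \<times> real" assume "w \<in> strip T"
    from mx[OF this, of i] show "u w $ i - (?P (fst w) + (A + 1) * snd w)
        \<le> u (x, t) $ i - (?P (fst (x, t)) + (A + 1) * snd (x, t))"
      by (simp add: \<Phi>_def)
  qed (use S in auto)
  from sub[OF \<open>t > 0\<close> this]
  have "A + 1 + G i x (u (x, t)) (\<beta> *\<^sub>R ((1 / J x) *\<^sub>R x)) \<le> 0" by simp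
  moreover have "norm (\<beta> *\<^sub>R w) \<le> 1" if "norm w \<le> 1" for w :: "real^'n"
    using that \<beta> by (simp add: mult_le_one)
  then have "norm (\<beta> *\<^sub>R ((1 / J x) *\<^sub>R x)) \<le> 1" using J(3) by blast
  moreover have "G i x 0 q \<le> G i x (u (x, t)) q" for q
  proof (rule mono)
    show "u (x, t) $ k - 0 $ k \<le> u (x, t) $ i - 0 $ i" for k
      using mx[OF S(1), of k] by (simp add: \<Phi>_def)
    show "0 \<le> u (x, t) $ i - 0 $ i" using ge pos \<sigma> C0 by (simp add: \<Phi>_def)
  qed
  ultimately show False using A[of "\<beta> *\<^sub>R ((1 / J x) *\<^sub>R x)" i x] by (smt (verit))
qed

text \<open>The barrier \<open>a + K * (J x - 1) + (A + 1) * t\<close> has space gradient of norm at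
  most \<open>K\<close>, where \<open>G\<close> is at least \<open>- A\<close>. The maximum of the
  difference therefore sits at the initial time, where \<open>init\<close> applies; at the vertex
  \<open>x0\<close> the spatial term vanishes.\<close>

lemma subsolution_initial_layer:
  fixes G :: "'m::finite \<Rightarrow> real^'n \<Rightarrow> real^'m \<Rightarrow> real^'n \<Rightarrow> real"
  assumes K: "K > 0"
    and A: "\<And>i x r p. norm r \<le> real CARD('m) * B \<Longrightarrow> norm p \<le> K \<Longrightarrow> - A \<le> G i x r p" and A0: "0 \<le> A"
    and uc: "continuous_on (strip T) u" and ub: "\<And>z i. z \<in> strip T \<Longrightarrow> \<bar>u z $ i\<bar> \<le> B"
    and sub: "\<And>i x t p \<tau>. t > 0 \<Longrightarrow> (p, \<tau>) \<in> superdiff (strip T) (\<lambda>z. u z $ i) (x, t) \<Longrightarrow>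
      \<tau> + G i x (u (x, t)) p \<le> 0"
    and init: "\<And>x. u (x, 0) $ i \<le> a + K * (sqrt (1\<^sup>2 + (norm (x - x0))\<^sup>2) - 1)"
    and t0: "t0 \<in> {0..T}"
  shows "u (x0, t0) $ i \<le> a + (A + 1) * t0"
proof -
  define J where "J x = sqrt (1\<^sup>2 + (norm (x - x0))\<^sup>2)" for x :: "real^'n"
  have J: "norm (x - x0) \<le> J x" "J x > 0" "norm ((1 / J x) *\<^sub>R (x - x0)) \<le> 1" for x
    using sqrt_one_norm[of "x - x0"] by (simp_all add: J_def)
  have JC1: "C1_with_gradient J (\<lambda>x. (1 / J x) *\<^sub>R (x - x0))"
    using C1_sqrt_norm[of 1 x0] by (simp add: J_def[abs_def])
  define \<Phi> where "\<Phi> z = u z $ i - (K * J (fst z) + (A + 1) * snd z)" for z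
  have T: "T \<ge> 0" using t0 by simp
  have z0: "(x0, t0) \<in> strip T" using t0 by (simp add: strip_def)
  obtain z where z: "z \<in> strip T" "\<And>w. w \<in> strip T \<Longrightarrow> \<Phi> w \<le> \<Phi> z"
  proof (rule attains_max_coercive[of "strip T" \<Phi> "(x0, t0)" "norm x0 + (2 * B + K + (A + 1) * T) / K + T"])
    show "continuous_on (strip T) \<Phi>"
      unfolding \<Phi>_def
      by (intro continuous_intros uc continuous_on_compose2[OF C1_continuous[OF JC1, of UNIV]]) auto
    fix z :: "(real^'n) \<times> real"
    assume z: "z \<in> strip T" "norm z > norm x0 + (2 * B + K + (A + 1) * T) / K + T"
    obtain x t where xt: "z = (x, t)" by (cases z)
    have t: "0 \<le> t" "t \<le> T" using z(1) by (auto simp: strip_def xt)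
    have "norm x > norm x0 + (2 * B + K + (A + 1) * T) / K"
      using norm_Pair_le[of x t] z(2) t by (simp add: xt)
    then have "(2 * B + K + (A + 1) * T) / K < norm (x - x0)" using norm_triangle_sub[of x x0] by linarith
    also have "\<dots> \<le> J x" by (rule J)
    finally have "2 * B + K + (A + 1) * T < K * J x" using K by (simp add: field_simps)
    moreover have "(A + 1) * t \<ge> 0" using A0 t by simp
    moreover have "(A + 1) * t0 \<le> (A + 1) * T" using A0 t0 by (intro mult_left_mono) auto
    moreover have "J x0 = 1" by (simp add: J_def)
    ultimately show "\<Phi> z \<le> \<Phi> (x0, t0)"
      using ub[OF z(1), of i] ub[OF z0, of i] by (simp add: \<Phi>_def xt)
  qed (blast intro: z0 closed_strip)+
  obtain x t where xt: "z = (x, t)" by (cases z)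
  have S: "(x, t) \<in> strip T" "0 \<le> t" using z(1) by (auto simp: xt strip_def)
  have "t = 0"
  proof (rule ccontr)
    assume "t \<noteq> 0"
    then have "t > 0" using S by simp
    have "(K *\<^sub>R ((1 / J x) *\<^sub>R (x - x0)), A + 1) \<in> superdiff (strip T) (\<lambda>z. u z $ i) (x, t)"
    proof (rule superdiffI)
      show "C1_with_gradient (\<lambda>z. K * J (fst z) + (A + 1) * snd z)
          (\<lambda>z. (K *\<^sub>R ((1 / J (fst z)) *\<^sub>R (fst z - x0)), 0) + (0, A + 1))"
        by (intro C1_add C1_fst[of "\<lambda>x. K * J x"] C1_snd[OF C1_linear] C1_scale JC1)
      fix w :: "(real^'n) \<times> real" assume "w \<in> strip T"
      from z(2)[OF this] show "u w $ i - (K * J (fst w) + (A + 1) * snd w)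
          \<le> u (x, t) $ i - (K * J (fst (x, t)) + (A + 1) * snd (x, t))"
        by (simp add: \<Phi>_def xt)
    qed (use S in auto)
    from sub[OF \<open>t > 0\<close> this]
    have "A + 1 + G i x (u (x, t)) (K *\<^sub>R ((1 / J x) *\<^sub>R (x - x0))) \<le> 0" .
    moreover have "- A \<le> G i x (u (x, t)) (K *\<^sub>R ((1 / J x) *\<^sub>R (x - x0)))"
    proof (rule A)
      show "norm (u (x, t)) \<le> real CARD('m) * B" using norm_le_CARD ub[OF S(1)] by blast
      show "norm (K *\<^sub>R ((1 / J x) *\<^sub>R (x - x0))) \<le> K"
        using mult_left_mono[OF J(3)[of x], of K] K unfolding norm_scaleR[of K] by simp
    qed
    ultimately show False by linarith
  qed
  have "\<Phi> (x0, t0) \<le> \<Phi> z" by (rule z(2)[OF z0])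
  then show ?thesis using init[of x] \<open>t = 0\<close> by (simp add: \<Phi>_def xt J_def algebra_simps)
qed

text \<open>For fixed \<open>t0\<close> the penalization \<open>(s - t0)\<^sup>2 / \<eta>\<close> bounds the time derivative, so coercivity bounds
  the space gradient by \<open>R\<close>; a cone of slope \<open>L > R\<close> can then only touch near its vertex.\<close>

lemma subsolution_space_modulus:
  fixes G :: "'m::finite \<Rightarrow> real^'n \<Rightarrow> real^'m \<Rightarrow> real^'n \<Rightarrow> real"
  assumes \<eta>: "\<eta> > 0" and e: "e > 0" and R: "0 \<le> R" "R < L"
    and coer: "\<And>i x r p. R \<le> norm p \<Longrightarrow> 2 * T / \<eta> + 1 \<le> G i x r p"
    and uc: "continuous_on (strip T) u" and ub: "\<And>z i. z \<in> strip T \<Longrightarrow> \<bar>u z $ i\<bar> \<le> B"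
    and uu: "\<exists>d>0. \<forall>i x y t. t \<in> {0..T} \<and> dist x y < d \<longrightarrow> \<bar>u (x, t) $ i - u (y, t) $ i\<bar> < e"
    and sub: "\<And>i x t p \<tau>. t > 0 \<Longrightarrow> (p, \<tau>) \<in> superdiff (strip T) (\<lambda>z. u z $ i) (x, t) \<Longrightarrow>
      \<tau> + G i x (u (x, t)) p \<le> 0"
    and time: "\<And>x t s. t \<in> {0..T} \<Longrightarrow> s \<in> {0..T} \<Longrightarrow> u (x, t) $ i - u (x, s) $ i \<le> e + (t - s)\<^sup>2 / \<eta>"
    and init: "\<And>x y. u (x, 0) $ i \<le> u (y, 0) $ i + e + L * norm (x - y)"
    and t0: "t0 \<in> {0..T}"
  shows "u (x0, t0) $ i - u (y, t0) $ i \<le> 3 * e + L * norm (x0 - y)"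
proof -
  obtain d where d: "d > 0"
    "\<And>i x y t. t \<in> {0..T} \<Longrightarrow> dist x y < d \<Longrightarrow> \<bar>u (x, t) $ i - u (y, t) $ i\<bar> < e" using uu by blast
  have L: "L > 0" using R by linarith
  define C where "C = R / sqrt (L\<^sup>2 - R\<^sup>2)"
  have "L\<^sup>2 - R\<^sup>2 > 0" using R by (simp add: power_strict_mono)
  then have C: "C \<ge> 0" using R by (simp add: C_def)
  \<comment> \<open>The radius \<open>d\<close> depends on the particular \<open>u\<close> and must
    not reach the conclusion. It is absorbed here: \<kappa> is so small that the touching point lies
    within \<open>d\<close> of \<open>y\<close>, while smoothing the cone costs at most
    \<open>L * \<kappa> \<le> e\<close>.\<close>
  define \<kappa> where "\<kappa> = min (d / (C + 1)) (e / L)"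
  have \<kappa>: "\<kappa> > 0" using d e L C by (simp add: \<kappa>_def)
  have "\<kappa> \<le> d / (C + 1)" "\<kappa> \<le> e / L" by (simp_all add: \<kappa>_def)
  then have "(C + 1) * \<kappa> \<le> d" "L * \<kappa> \<le> e" using C L by (simp_all add: field_simps)
  then have \<kappa>': "C * \<kappa> < d" "L * \<kappa> \<le> e" using \<kappa> by (simp_all add: distrib_right)
  define J where "J x = sqrt (\<kappa>\<^sup>2 + (norm (x - y))\<^sup>2)" for x :: "real^'n"
  have J: "norm (x - y) \<le> J x" "J x \<le> \<kappa> + norm (x - y)" "J x \<ge> 0" for x
    using norm_le_sqrt_sum[of "x - y" \<kappa>] sqrt_sum_squares_le_sum[of \<kappa> "norm (x - y)"] \<kappa>
    by (auto simp: J_def)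
  have JC1: "C1_with_gradient J (\<lambda>x. (1 / J x) *\<^sub>R (x - y))"
    using C1_sqrt_norm[OF \<kappa>, of y] by (simp add: J_def[abs_def])
  define \<Phi> where "\<Phi> z = u z $ i - (L * J (fst z) + (1 / \<eta>) * (snd z - t0)\<^sup>2)" for z
  have T: "T \<ge> 0" using t0 by simp
  have z0: "(x0, t0) \<in> strip T" using t0 by (simp add: strip_def)
  obtain z where z: "z \<in> strip T" "\<And>w. w \<in> strip T \<Longrightarrow> \<Phi> w \<le> \<Phi> z"
  proof (rule attains_max_coercive[of "strip T" \<Phi> "(x0, t0)" "norm y + (2 * B + L * J x0) / L + T"])
    show "continuous_on (strip T) \<Phi>"
      unfolding \<Phi>_def
      by (intro continuous_intros uc continuous_on_compose2[OF C1_continuous[OF JC1, of UNIV]])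
        (use \<eta> in auto)
    fix z :: "(real^'n) \<times> real"
    assume z: "z \<in> strip T" "norm z > norm y + (2 * B + L * J x0) / L + T"
    obtain x t where xt: "z = (x, t)" by (cases z)
    have t: "0 \<le> t" "t \<le> T" using z(1) by (auto simp: strip_def xt)
    have "norm x > norm y + (2 * B + L * J x0) / L"
      using norm_Pair_le[of x t] z(2) t by (simp add: xt)
    then have "(2 * B + L * J x0) / L < norm (x - y)" using norm_triangle_sub[of x y] by linarith
    also have "\<dots> \<le> J x" by (rule J)
    finally have "2 * B + L * J x0 < L * J x" using L by (simp add: field_simps)
    moreover have "(1 / \<eta>) * (t - t0)\<^sup>2 \<ge> 0" using \<eta> by simp
    ultimately show "\<Phi> z \<le> \<Phi> (x0, t0)"
      using ub[OF z(1), of i] ub[OF z0, of i] by (simp add: \<Phi>_def xt)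
  qed (blast intro: z0 closed_strip)+
  obtain x s where xs: "z = (x, s)" by (cases z)
  have S: "(x, s) \<in> strip T" "s \<in> {0..T}" using z(1) by (auto simp: xs strip_def)
  \<comment> \<open>Two of the three \<open>e\<close>: one from \<open>time\<close>, the other from
    \<open>init\<close> at the initial time and from \<open>uu\<close> otherwise. The third is the
    cost of smoothing.\<close>
  have "u (x, s) $ i - L * J x \<le> u (y, t0) $ i + 2 * e + (s - t0)\<^sup>2 / \<eta>"
  proof (cases "s = 0")
    case True
    have "L * norm (x - y) \<le> L * J x" using J L by simp
    then show ?thesis using init[of x y] time[of 0 t0 y] T t0 True by (simp)
  next
    case False
    then have "s > 0" using S by simp
    have "(L *\<^sub>R ((1 / J x) *\<^sub>R (x - y)), (1 / \<eta>) *\<^sub>R (2 * (s - t0))) \<in> superdiff (strip T) (\<lambda>z. u z $ i) (x, s)"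
    proof (rule superdiffI)
      show "C1_with_gradient (\<lambda>z. L * J (fst z) + (1 / \<eta>) * (snd z - t0)\<^sup>2)
          (\<lambda>z. (L *\<^sub>R ((1 / J (fst z)) *\<^sub>R (fst z - y)), 0) + (0, (1 / \<eta>) *\<^sub>R (2 * (snd z - t0))))"
        by (intro C1_add C1_fst[of "\<lambda>x. L * J x"] C1_snd[of "\<lambda>s. (1 / \<eta>) * (s - t0)\<^sup>2"]
            C1_square C1_scale JC1)
      fix w :: "(real^'n) \<times> real" assume "w \<in> strip T"
      from z(2)[OF this] show "u w $ i - (L * J (fst w) + (1 / \<eta>) * (snd w - t0)\<^sup>2)
          \<le> u (x, s) $ i - (L * J (fst (x, s)) + (1 / \<eta>) * (snd (x, s) - t0)\<^sup>2)"
        by (simp add: \<Phi>_def xs)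
    qed (use S in auto)
    from sub[OF \<open>s > 0\<close> this]
    have "(2 * (s - t0)) / \<eta> + G i x (u (x, s)) (L *\<^sub>R ((1 / J x) *\<^sub>R (x - y))) \<le> 0" by simp
    moreover have "(2 * (t0 - s)) / \<eta> \<le> (2 * T) / \<eta>" using S t0 \<eta> by (intro divide_right_mono) auto
    moreover have "- ((2 * (s - t0)) / \<eta>) = (2 * (t0 - s)) / \<eta>" by (simp add: algebra_simps diff_divide_distrib)
    ultimately have "G i x (u (x, s)) (L *\<^sub>R ((1 / J x) *\<^sub>R (x - y))) < 2 * T / \<eta> + 1" by linarith
    then have "norm (L *\<^sub>R ((1 / J x) *\<^sub>R (x - y))) < R"
      using coer[of "L *\<^sub>R ((1 / J x) *\<^sub>R (x - y))" i x "u (x, s)"] by linarith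
    then have "norm ((L / J x) *\<^sub>R (x - y)) \<le> R" by simp
    from norm_scaled_gradient_le[OF \<kappa> R this[unfolded J_def]]
    have "dist x y < d" using \<kappa>'(1) by (simp add: C_def dist_norm)
    from d(2)[OF S(2) this, of i] have "u (x, s) $ i \<le> u (y, s) $ i + e" by linarith
    moreover have "L * J x \<ge> 0" using L J by simp
    ultimately show ?thesis using time[OF S(2) t0, of y] by linarith
  qed
  moreover have "\<Phi> (x0, t0) \<le> \<Phi> z" by (rule z(2)[OF z0])
  moreover have "L * J x0 \<le> L * \<kappa> + L * norm (x0 - y)"
    using J(2)[of x0] L by (metis distrib_left mult_left_mono less_imp_le)
  ultimately show ?thesis using \<kappa>'(2) by (simp add: \<Phi>_def xs)
qed

text \<open>Within the distance \<open>d\<close> of uniform continuity \<open>e\<close> pays for the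
  difference. Beyond it the smoothed cone has height at least \<open>m\<close>, and
  \<open>K * m = 2 * \<bar>C\<bar> + 1\<close> exceeds the oscillation of \<open>f\<close>. The cone
  has the shape required by \<open>subsolution_initial_layer\<close>.\<close>

lemma BUC_cone_modulus:
  fixes f :: "'a::real_normed_vector \<Rightarrow> real^'m"
  assumes f: "BUC_on UNIV f" and e: "e > 0"
  obtains K where "K > 0" "\<And>x y i. f y $ i \<le> f x $ i + e + K * (sqrt (1\<^sup>2 + (norm (y - x))\<^sup>2) - 1)"
proof -
  obtain C where C: "\<And>x. norm (f x) \<le> C" using f unfolding BUC_on_def bounded_iff by auto
  have C': "\<bar>f x $ i\<bar> \<le> C" for x i using component_le_norm_cart[of "f x" i] C[of x] by linarith
  obtain d where d: "d > 0" "\<And>x y. dist y x < d \<Longrightarrow> dist (f y) (f x) < e"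
    using f e unfolding BUC_on_def uniformly_continuous_on_def by blast
  define m where "m = sqrt (1\<^sup>2 + d\<^sup>2) - 1"
  have m: "m > 0" using d by (simp add: m_def)
  define K where "K = (2 * \<bar>C\<bar> + 1) / m"
  have K: "K > 0" "K * m = 2 * \<bar>C\<bar> + 1" using m by (auto simp: K_def add_nonneg_pos)
  show thesis
  proof (rule that[OF K(1)])
    fix x y :: 'a and i
    let ?s = "sqrt (1\<^sup>2 + (norm (y - x))\<^sup>2) - 1"
    show "f y $ i \<le> f x $ i + e + K * ?s"
    proof (cases "dist y x < d")
      case True
      have "\<bar>(f y - f x) $ i\<bar> < e"
        using d(2)[OF True] component_le_norm_cart[of "f y - f x" i] by (simp add: dist_norm)
      moreover have "K * ?s \<ge> 0" using K sqrt_one_norm(3)[of "y - x"] by (intro mult_nonneg_nonneg) auto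
      ultimately show ?thesis by simp
    next
      case False
      then have "d\<^sup>2 \<le> (norm (y - x))\<^sup>2" using d by (intro power_mono) (auto simp: dist_norm)
      then have "m \<le> ?s" by (simp add: m_def)
      then have "K * m \<le> K * ?s" using K by (intro mult_left_mono) auto
      then show ?thesis using K(2) C'[of x i] C'[of y i] e by linarith
    qed
  qed
qed

section \<open>The oscillating and the effective Hamiltonian\<close>

lemma finite_type_uniform_bound:
  assumes "\<And>j::'m::finite. \<exists>R. P j R" "\<And>j R R'. P j R \<Longrightarrow> R \<le> R' \<Longrightarrow> P j (R' :: real)"
  shows "\<exists>R. \<forall>j. P j R"
proof -
  obtain f where f: "\<And>j. P j (f j)" using assms(1) by metis
  have "f j \<le> Max (range f)" for j by (rule Max_ge) auto
  then show ?thesis using f assms(2) by blast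
qed

lemma finite_type_uniform_radius:
  assumes "\<And>j::'m::finite. \<exists>d>0. P j d" "\<And>j d d'. P j d \<Longrightarrow> d' \<le> d \<Longrightarrow> P j (d' :: real)"
  shows "\<exists>d>0. \<forall>j. P j d"
proof -
  obtain f where f: "\<And>j. f j > 0" "\<And>j. P j (f j)" using assms(1) by metis
  have "Min (range f) \<le> f j" for j by (rule Min_le) auto
  moreover have "Min (range f) > 0" using f(1) by (subst Min_gr_iff) auto
  ultimately show ?thesis using f(2) assms(2) by blast
qed

lemma dist_Pair_le: "dist (a, b) (c, d) \<le> dist a c + dist b d"
  by (simp add: dist_Pair_Pair sqrt_sum_squares_le_sum)

locale hamiltonian_system =
  fixes H :: "'m::finite \<Rightarrow> real^'n \<Rightarrow> real^'n \<Rightarrow> real^'m \<Rightarrow> real^'n \<Rightarrow> real"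
  assumes H_cont: "\<forall>j. continuous_on UNIV (\<lambda>(x, y, r, p). H j x y r p)"
    and H_S: "structural_S H"
    and H_Mon: "Mon H"
begin

section \<open>The assumptions on \<open>H\<close> in forms uniform over the index\<close>

lemma H_per: "Z_periodic (\<lambda>y. H j x y r p)"
  using H_S by (simp add: structural_S_def)

lemma H_coer: "\<exists>R. \<forall>j x y r p. R \<le> norm p \<longrightarrow> K \<le> H j x y r p"
proof -
  show ?thesis
    by (rule finite_type_uniform_bound[of "\<lambda>j R. \<forall>x y r p. R \<le> norm p \<longrightarrow> K \<le> H j x y r p"])
      (use H_S in \<open>auto simp: structural_S_def\<close>)
qed

lemma H_mono:
  assumes "\<And>k. r $ k - s $ k \<le> r $ i - s $ i" "0 \<le> r $ i - s $ i"
  shows "H i x y s p \<le> H i x y r p"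
proof -
  have "r $ i - s $ i = Max (range (\<lambda>k. r $ k - s $ k))"
    by (rule Max_eqI[symmetric]) (use assms(1) in auto)
  with assms(2) H_Mon have "\<forall>x y p. H i x y r p - H i x y s p \<ge> 0" unfolding Mon_def by blast
  then show ?thesis by simp
qed

lemma H_BUC:
  assumes "R > 0"
  shows "BUC_on (UNIV \<times> UNIV \<times> {r. \<forall>k. r $ k \<in> {-R..R}} \<times> ball 0 R) (\<lambda>(x, y, r, p). H j x y r p)"
  using H_S assms by (simp add: structural_S_def)

text \<open>The domain of the continuity assumption is a cube in \<open>r\<close> times an open ball
  in \<open>p\<close>. Size \<open>\<bar>R\<bar> + 1\<close> contains the closed norm balls of
  radius \<open>R\<close> and is positive for every real \<open>R\<close>.\<close>

lemma mem_box_ball: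
  assumes "norm (r :: real^'m) \<le> R" "norm (p :: real^'n) \<le> R"
  shows "(x, y, r, p) \<in> UNIV \<times> UNIV \<times> {r. \<forall>k. r $ k \<in> {-(\<bar>R\<bar> + 1)..\<bar>R\<bar> + 1}} \<times> ball 0 (\<bar>R\<bar> + 1)"
proof -
  have "\<bar>r $ k\<bar> \<le> \<bar>R\<bar>" for k using component_le_norm_cart[of r k] assms(1) by linarith
  then have "r $ k \<in> {-(\<bar>R\<bar> + 1)..\<bar>R\<bar> + 1}" for k by (simp add: abs_le_iff) (smt (verit))
  moreover have "norm p < \<bar>R\<bar> + 1" using assms(2) by linarith
  ultimately show ?thesis by simp
qed

lemma H_unif:
  assumes "e > 0"
  shows "\<exists>d>0. \<forall>j x y r p x' y' r' p'. norm r \<le> R \<and> norm p \<le> R \<and> norm r' \<le> R \<and> norm p' \<le> R \<and>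
    dist x x' < d \<and> dist y y' < d \<and> dist r r' < d \<and> dist p p' < d \<longrightarrow>
    \<bar>H j x y r p - H j x' y' r' p'\<bar> < e"
proof -
  let ?P = "\<lambda>j d. \<forall>x y r p x' y' r' p'. norm r \<le> R \<and> norm p \<le> R \<and> norm r' \<le> R \<and> norm p' \<le> R \<and>
    dist x x' < d \<and> dist y y' < d \<and> dist r r' < d \<and> dist p p' < d \<longrightarrow>
    \<bar>H j x y r p - H j x' y' r' p'\<bar> < e"
  have "\<exists>d>0. ?P j d" for j
  proof -
    let ?S = "UNIV \<times> UNIV \<times> {r. \<forall>k. r $ k \<in> {-(\<bar>R\<bar> + 1)..\<bar>R\<bar> + 1}} \<times> ball 0 (\<bar>R\<bar> + 1)
      :: ((real^'n) \<times> (real^'n) \<times> (real^'m) \<times> (real^'n)) set"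
    have "uniformly_continuous_on ?S (\<lambda>(x, y, r, p). H j x y r p)"
      using H_BUC[of "\<bar>R\<bar> + 1" j] by (simp add: BUC_on_def)
    from uniformly_continuous_onE[OF this assms]
    obtain d where d: "d > 0" "\<And>z z'. z \<in> ?S \<Longrightarrow> z' \<in> ?S \<Longrightarrow> dist z' z < d \<Longrightarrow>
      dist ((\<lambda>(x, y, r, p). H j x y r p) z') ((\<lambda>(x, y, r, p). H j x y r p) z) < e"
      by blast
    have "?P j (d / 4)"
    proof (intro allI impI)
      fix x y p x' y' p' :: "real^'n" and r r' :: "real^'m"
      assume *: "norm r \<le> R \<and> norm p \<le> R \<and> norm r' \<le> R \<and> norm p' \<le> R \<and>
        dist x x' < d / 4 \<and> dist y y' < d / 4 \<and> dist r r' < d / 4 \<and> dist p p' < d / 4"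
      have "dist (x, y, r, p) (x', y', r', p') < d"
        using * dist_Pair_le[of x "(y, r, p)" x' "(y', r', p')"] dist_Pair_le[of y "(r, p)" y' "(r', p')"]
          dist_Pair_le[of r p r' p'] by linarith
      from d(2)[OF mem_box_ball mem_box_ball this] *
      show "\<bar>H j x y r p - H j x' y' r' p'\<bar> < e" by (simp add: dist_real_def)
    qed
    with d(1) show ?thesis by (intro exI[of _ "d / 4"]) simp
  qed
  moreover have "?P j d'" if P: "?P j d" and le: "d' \<le> d" for j d d'
  proof (intro allI impI)
    fix x y p x' y' p' :: "real^'n" and r r' :: "real^'m"
    assume "norm r \<le> R \<and> norm p \<le> R \<and> norm r' \<le> R \<and> norm p' \<le> R \<and>
      dist x x' < d' \<and> dist y y' < d' \<and> dist r r' < d' \<and> dist p p' < d'"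
    then show "\<bar>H j x y r p - H j x' y' r' p'\<bar> < e"
      by (intro P[rule_format]) (use le in linarith)
  qed
  ultimately show ?thesis by (rule finite_type_uniform_radius[of ?P])
qed

lemma H_bdd: "\<exists>B\<ge>0. \<forall>j x y r p. norm r \<le> R \<and> norm p \<le> R \<longrightarrow> \<bar>H j x y r p\<bar> \<le> B"
proof -
  let ?P = "\<lambda>j B. \<forall>x y r p. norm r \<le> R \<and> norm p \<le> R \<longrightarrow> \<bar>H j x y r p\<bar> \<le> B"
  have "\<exists>B. ?P j B" for j
  proof -
    let ?S = "UNIV \<times> UNIV \<times> {r. \<forall>k. r $ k \<in> {-(\<bar>R\<bar> + 1)..\<bar>R\<bar> + 1}} \<times> ball 0 (\<bar>R\<bar> + 1)
      :: ((real^'n) \<times> (real^'n) \<times> (real^'m) \<times> (real^'n)) set"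
    have "bounded ((\<lambda>(x, y, r, p). H j x y r p) ` ?S)"
      using H_BUC[of "\<bar>R\<bar> + 1" j] by (simp add: BUC_on_def)
    then obtain B where B: "\<And>z. z \<in> ?S \<Longrightarrow> norm ((\<lambda>(x, y, r, p). H j x y r p) z) \<le> B"
      unfolding bounded_iff by blast
    have "?P j B"
    proof (intro allI impI)
      fix x y p :: "real^'n" and r :: "real^'m" assume "norm r \<le> R \<and> norm p \<le> R"
      then show "\<bar>H j x y r p\<bar> \<le> B" using B[OF mem_box_ball, of r p x y] by simp
    qed
    then show ?thesis by blast
  qed
  moreover have "?P j B'" if P: "?P j B" and le: "B \<le> B'" for j B B'
    using order_trans[OF P[rule_format] le] by blast
  ultimately have "\<exists>B. \<forall>j. ?P j B" by (rule finite_type_uniform_bound[of ?P])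
  then obtain B where "\<forall>j. ?P j B" ..
  then show ?thesis by (intro exI[of _ "\<bar>B\<bar>"]) (auto intro: order_trans[OF _ abs_ge_self])
qed

section \<open>Comparison between effective Hamiltonians\<close>

lemma cell_problem_H: "cell_problem (\<lambda>y q. H i x y r (p + q))"
proof
  have "continuous_on UNIV (\<lambda>z. (x, fst z, r, p + snd z))" by (intro continuous_intros)
  from continuous_on_compose2[OF H_cont[rule_format, of i] this]
  show "continuous_on UNIV (\<lambda>(y, q). H i x y r (p + q))" by (simp add: case_prod_unfold)
  show "Z_periodic (\<lambda>y. H i x y r (p + q))" for q by (rule H_per)
  show "\<exists>R. \<forall>y q. R \<le> norm q \<longrightarrow> K \<le> H i x y r (p + q)" for K
  proof -
    obtain R where R: "\<And>q y. R \<le> norm q \<Longrightarrow> K \<le> H i x y r q" using H_coer by blast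
    have "K \<le> H i x y r (p + q)" if "R + norm p \<le> norm q" for y q
      using R[of "p + q" y] norm_triangle_ineq2[of q "- p"] that by (simp add: add.commute)
    then show ?thesis by blast
  qed
qed

text \<open>Makes the definite description usable: existence comes from the vanishing discount,
  uniqueness from \<open>cell_comparison\<close> with \<open>d = 0\<close> in both orders.\<close>

lemma effective_corrector:
  obtains v L where "L-lipschitz_on UNIV v" "Z_periodic v"
    "cell_sub (\<lambda>y q. H i x y r (p + q)) (effective_hamiltonian H i x r p) v"
    "cell_sup (\<lambda>y q. H i x y r (p + q)) (effective_hamiltonian H i x r p) v"
proof -
  interpret cell_problem "\<lambda>y q. H i x y r (p + q)" by (rule cell_problem_H)
  let ?F = "\<lambda>y q. H i x y r (p + q)"
  let ?P = "\<lambda>c. \<exists>v. (\<exists>L. L-lipschitz_on UNIV v) \<and> Z_periodic v \<and> stationary_visc_solution ?F c v"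
  obtain c v where v: "\<exists>L. L-lipschitz_on UNIV v" "Z_periodic v" "cell_sub ?F c v" "cell_sup ?F c v"
    by (rule corrector_exists)
  have Pc: "?P c"
    using v lipschitz_on_continuous_on unfolding stationary_visc_solution_iff by blast
  have le: "c2 \<le> c1" if 1: "?P c1" and 2: "?P c2" for c1 c2
  proof -
    obtain v1 where v1: "continuous_on UNIV v1" "Z_periodic v1" "cell_sub ?F c1 v1"
      using 1 unfolding stationary_visc_solution_iff by blast
    obtain v2 L where v2: "L-lipschitz_on UNIV v2" "Z_periodic v2" "cell_sup ?F c2 v2"
      using 2 unfolding stationary_visc_solution_iff by blast
    show ?thesis using cell_comparison[OF cont cont v1 v2, of 0] by simp
  qed
  have "?P (THE c. ?P c)"
  proof (rule theI[of ?P, OF Pc])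
    fix c' assume "?P c'"
    then show "c' = c" using le[OF Pc] le[OF _ Pc] by (intro antisym) blast+
  qed
  then have "?P (effective_hamiltonian H i x r p)" unfolding effective_hamiltonian_def .
  then show thesis using that unfolding stationary_visc_solution_iff by blast
qed

text \<open>Correctors for two sets of parameters are compared. Monotonicity and continuity of the
  effective Hamiltonians both follow from here; the premise concerns only a sublevel set, where
  coercivity bounds \<open>p + q\<close>.\<close>

lemma effective_le:
  assumes "\<And>y q. H i x y r (p + q) \<le> effective_hamiltonian H i x r p \<Longrightarrow>
    H i x' y s (p' + q) \<le> H i x y r (p + q) + d"
  shows "effective_hamiltonian H i x' s p' \<le> effective_hamiltonian H i x r p + d"
proof -
  obtain v1 L1 where v1: "L1-lipschitz_on UNIV v1" "Z_periodic v1"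
    "cell_sub (\<lambda>y q. H i x y r (p + q)) (effective_hamiltonian H i x r p) v1"
    by (rule effective_corrector)
  obtain v2 L2 where v2: "L2-lipschitz_on UNIV v2" "Z_periodic v2"
    "cell_sup (\<lambda>y q. H i x' y s (p' + q)) (effective_hamiltonian H i x' s p') v2"
    by (rule effective_corrector)
  show ?thesis
    by (rule cell_comparison[OF cell_problem.cont[OF cell_problem_H] cell_problem.cont[OF cell_problem_H]
          lipschitz_on_continuous_on[OF v1(1)] v1(2,3) v2]) (use assms in blast)
qed

lemma effective_lower: "\<exists>y. H i x y r p \<le> effective_hamiltonian H i x r p"
proof -
  obtain v L where v: "L-lipschitz_on UNIV v" "Z_periodic v"
    "cell_sub (\<lambda>y q. H i x y r (p + q)) (effective_hamiltonian H i x r p) v"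
    by (rule effective_corrector)
  from cell_sub_ge_somewhere[OF v(2) lipschitz_on_continuous_on[OF v(1)] v(3)]
  obtain y where "H i x y r (p + 0) \<le> effective_hamiltonian H i x r p" by blast
  then show ?thesis by auto
qed

lemma effective_upper: "\<exists>y. effective_hamiltonian H i x r p \<le> H i x y r p"
proof -
  obtain v L where v: "L-lipschitz_on UNIV v" "Z_periodic v"
    "cell_sup (\<lambda>y q. H i x y r (p + q)) (effective_hamiltonian H i x r p) v"
    by (rule effective_corrector)
  from cell_sup_le_somewhere[OF v(2) lipschitz_on_continuous_on[OF v(1)] v(3)]
  obtain y where "effective_hamiltonian H i x r p \<le> H i x y r (p + 0)" by blast
  then show ?thesis by auto
qed

lemma effective_unif:
  assumes e: "e > 0"
  shows "\<exists>d>0. \<forall>i x y r p q. norm r \<le> R \<and> norm p \<le> R \<and> norm q \<le> R \<and> dist x y < d \<and> dist p q < d \<longrightarrow>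
    \<bar>effective_hamiltonian H i x r p - effective_hamiltonian H i y r q\<bar> < e"
proof -
  obtain B where B: "\<And>j x y r p. norm r \<le> R \<Longrightarrow> norm p \<le> R \<Longrightarrow> \<bar>H j x y r p\<bar> \<le> B" using H_bdd by blast
  obtain R1 where R1: "\<And>j x y r p. R1 \<le> norm p \<Longrightarrow> B + 1 \<le> H j x y r p" using H_coer by blast
  \<comment> \<open>\<open>B\<close> bounds the effective Hamiltonian through
    \<open>effective_upper\<close>, so the gradients \<open>p + k\<close> in question are shorter
    than \<open>R1\<close>; the extra 1 accommodates the shift to \<open>q + k\<close>.\<close>
  define R2 where "R2 = max R (R1 + 1)"
  have "e / 2 > 0" using e by simp
  from H_unif[OF this, of R2] obtain d where d: "d > 0"
    "\<And>j x y r p x' y' r' p'. norm r \<le> R2 \<Longrightarrow> norm p \<le> R2 \<Longrightarrow> norm r' \<le> R2 \<Longrightarrow> norm p' \<le> R2 \<Longrightarrow>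
      dist x x' < d \<Longrightarrow> dist y y' < d \<Longrightarrow> dist r r' < d \<Longrightarrow> dist p p' < d \<Longrightarrow>
      \<bar>H j x y r p - H j x' y' r' p'\<bar> < e / 2" by blast
  have le: "effective_hamiltonian H i y r q \<le> effective_hamiltonian H i x r p + e / 2"
    if *: "norm r \<le> R" "norm p \<le> R" "dist x y < d" "dist p q < min d 1" for i x y r p q
  proof (rule effective_le)
    fix z k assume "H i x z r (p + k) \<le> effective_hamiltonian H i x r p"
    moreover obtain y' where "effective_hamiltonian H i x r p \<le> H i x y' r p" using effective_upper by blast
    ultimately have "H i x z r (p + k) \<le> B" using B[OF *(1,2), of i x y'] by linarith
    then have pk: "norm (p + k) < R1" using R1[of "p + k" i x z r] by linarith
    have "dist (p + k) (q + k) < min d 1" using *(4) by (simp add: dist_norm)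
    moreover have "norm (q + k) \<le> norm (p + k) + dist (p + k) (q + k)"
      by (metis dist_norm dist_commute norm_triangle_sub)
    ultimately have "\<bar>H i x z r (p + k) - H i y z r (q + k)\<bar> < e / 2"
      using pk *(1,3) d(1) by (intro d(2)) (auto simp: R2_def)
    then show "H i y z r (q + k) \<le> H i x z r (p + k) + e / 2" by linarith
  qed
  show ?thesis
  proof (intro exI[of _ "min d 1"] conjI allI impI)
    fix i and x y :: "real^'n" and r :: "real^'m" and p q :: "real^'n"
    assume *: "norm r \<le> R \<and> norm p \<le> R \<and> norm q \<le> R \<and> dist x y < min d 1 \<and> dist p q < min d 1"
    then have "dist x y < d" "dist y x < d" "dist q p < min d 1" by (auto simp: dist_commute)
    with * le[of r p x y q i] le[of r q y x p i] e
    show "\<bar>effective_hamiltonian H i x r p - effective_hamiltonian H i y r q\<bar> < e" by linarith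
  qed (use d in auto)
qed

lemma monotone_nonlinearity_effective: "monotone_nonlinearity (effective_hamiltonian H)"
proof
  show "\<exists>R. \<forall>i x r p. R \<le> norm p \<longrightarrow> K \<le> effective_hamiltonian H i x r p" for K
    using H_coer[of K] effective_lower by (meson order_trans)
  show "\<exists>d>0. \<forall>i x y r p q. norm r \<le> R \<and> norm p \<le> R \<and> norm q \<le> R \<and> dist x y < d \<and> dist p q < d \<longrightarrow>
    \<bar>effective_hamiltonian H i x r p - effective_hamiltonian H i y r q\<bar> < e" if "e > 0" for R e
    using effective_unif[OF that] .
  show "effective_hamiltonian H i x s p \<le> effective_hamiltonian H i x r p"
    if "\<And>k. r $ k - s $ k \<le> r $ i - s $ i" "0 \<le> r $ i - s $ i" for i x r s p
    using effective_le[of i x r p x s p 0] H_mono[OF that] by simp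
qed

text \<open>The radius in \<open>G_unif\<close> shrinks at least like \<open>d * \<epsilon>\<close>.
  This does no harm, because the conclusion of \<open>doubling\<close> does not involve that
  radius.\<close>

lemma monotone_nonlinearity_oscillating:
  assumes "\<epsilon> > 0"
  shows "monotone_nonlinearity (\<lambda>i x. H i x (x /\<^sub>R \<epsilon>))"
proof
  show "\<exists>R. \<forall>i x r p. R \<le> norm p \<longrightarrow> K \<le> H i x (x /\<^sub>R \<epsilon>) r p" for K
    using H_coer[of K] by blast
  show "\<exists>d>0. \<forall>i x y r p q. norm r \<le> R \<and> norm p \<le> R \<and> norm q \<le> R \<and> dist x y < d \<and> dist p q < d \<longrightarrow>
    \<bar>H i x (x /\<^sub>R \<epsilon>) r p - H i y (y /\<^sub>R \<epsilon>) r q\<bar> < e" if e: "e > 0" for R e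
  proof -
    obtain d where d: "d > 0"
      "\<And>j x y r p x' y' r' p'. norm r \<le> R \<Longrightarrow> norm p \<le> R \<Longrightarrow> norm r' \<le> R \<Longrightarrow> norm p' \<le> R \<Longrightarrow>
        dist x x' < d \<Longrightarrow> dist y y' < d \<Longrightarrow> dist r r' < d \<Longrightarrow> dist p p' < d \<Longrightarrow>
        \<bar>H j x y r p - H j x' y' r' p'\<bar> < e" using H_unif[OF e, of R] by blast
    show ?thesis
    proof (intro exI[of _ "min d (d * \<epsilon>)"] conjI allI impI)
      fix i and x y :: "real^'n" and r :: "real^'m" and p q :: "real^'n"
      assume *: "norm r \<le> R \<and> norm p \<le> R \<and> norm q \<le> R \<and> dist x y < min d (d * \<epsilon>) \<and>
        dist p q < min d (d * \<epsilon>)"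
      have "dist (x /\<^sub>R \<epsilon>) (y /\<^sub>R \<epsilon>) = dist x y / \<epsilon>"
        using assms by (simp add: dist_norm scaleR_right_diff_distrib[symmetric] divide_inverse mult.commute)
      also have "\<dots> < d" using * assms by (simp add: divide_less_eq)
      finally show "\<bar>H i x (x /\<^sub>R \<epsilon>) r p - H i y (y /\<^sub>R \<epsilon>) r q\<bar> < e"
        using * d(1) by (intro d(2)) auto
    qed (use d assms in auto)
  qed
  show "H i x (x /\<^sub>R \<epsilon>) s p \<le> H i x (x /\<^sub>R \<epsilon>) r p"
    if "\<And>k. r $ k - s $ k \<le> r $ i - s $ i" "0 \<le> r $ i - s $ i" for i x r s p
    by (rule H_mono[OF that])
qed

end

section \<open>Equicontinuity of the oscillating solutions\<close>

locale hamiltonian_problem = hamiltonian_system H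
  for H :: "'m::finite \<Rightarrow> real^'n \<Rightarrow> real^'n \<Rightarrow> real^'m \<Rightarrow> real^'n \<Rightarrow> real" +
  fixes T :: real and u0 :: "real^'n \<Rightarrow> real^'m"
  assumes T: "T > 0" and u0: "BUC_on UNIV u0"
begin

text \<open>Bundling \<epsilon> with the solution lets uniformity in \<epsilon> be expressed by
  constants chosen before a quantification over all such pairs.\<close>

definition oscillating_solution :: "real \<Rightarrow> ((real^'n) \<times> real \<Rightarrow> real^'m) \<Rightarrow> bool" where
  "oscillating_solution \<epsilon> u \<longleftrightarrow> \<epsilon> > 0 \<and> BUC_on (strip T) u \<and> visc_solution (oscillating_G H \<epsilon>) T u0 u"

lemma oscillating_sub:
  assumes "oscillating_solution \<epsilon> u" "t > 0" "(p, \<tau>) \<in> superdiff (strip T) (\<lambda>z. u z $ i) (x, t)"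
  shows "\<tau> + H i x (x /\<^sub>R \<epsilon>) (u (x, t)) p \<le> 0"
  using visc_subsolutionD[OF _ assms(2,3), of "oscillating_G H \<epsilon>" u0] assms(1)
  by (simp add: oscillating_solution_def visc_solution_def oscillating_G_def)

lemma oscillating_sup:
  assumes "oscillating_solution \<epsilon> u" "t > 0" "(p, \<tau>) \<in> superdiff (strip T) (\<lambda>z. - u z $ i) (x, t)"
  shows "0 \<le> - \<tau> + H i x (x /\<^sub>R \<epsilon>) (u (x, t)) (- p)"
  using visc_supersolutionD[OF _ assms(2,3), of "oscillating_G H \<epsilon>" u0] assms(1)
  by (simp add: oscillating_solution_def visc_solution_def oscillating_G_def)

text \<open>Reflection: \<open>-u\<close> is a subsolution for the Hamiltonian \<open>- H i x y (- r) (- p)\<close>, which is again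
  monotone and locally bounded, though not coercive.\<close>

lemma reflected_sub:
  assumes "oscillating_solution \<epsilon> u" "t > 0" "(p, \<tau>) \<in> superdiff (strip T) (\<lambda>z. (- u z) $ i) (x, t)"
  shows "\<tau> + - H i x (x /\<^sub>R \<epsilon>) (- (- u (x, t))) (- p) \<le> 0"
  using oscillating_sup[OF assms(1,2), of p \<tau> i x] assms(3) by simp

lemma oscillating_cont: "oscillating_solution \<epsilon> u \<Longrightarrow> continuous_on (strip T) u"
  by (simp add: oscillating_solution_def visc_solution_def)

lemma oscillating_init: "oscillating_solution \<epsilon> u \<Longrightarrow> u (x, 0) $ i = u0 x $ i"
  by (intro antisym) (simp_all add: oscillating_solution_def visc_solution_def visc_subsolution_def
      visc_supersolution_def)

text \<open>One constant \<open>A\<close> bounds \<open>H\<close> at \<open>r = 0\<close> and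
  \<open>norm p \<le> 1\<close> over all fast variables, so the barriers for \<open>u\<close> and
  for its reflection are the same for every \<epsilon>.\<close>

lemma oscillating_bounded:
  obtains B where "0 \<le> B" "\<And>\<epsilon> u z i. oscillating_solution \<epsilon> u \<Longrightarrow> z \<in> strip T \<Longrightarrow> \<bar>u z $ i\<bar> \<le> B"
proof -
  obtain C where C: "\<And>x i. \<bar>u0 x $ i\<bar> \<le> C"
    by (rule BUC_component_bounded[OF u0], rule that, simp)
  have C0: "0 \<le> C" using C[of 0 undefined] by linarith
  obtain A where A0: "0 \<le> A" and A: "\<And>j x y r p. norm r \<le> 1 \<Longrightarrow> norm p \<le> 1 \<Longrightarrow> \<bar>H j x y r p\<bar> \<le> A"
    using H_bdd[of 1] by blast
  have "\<bar>u z $ i\<bar> \<le> C + (A + 1) * T" if u: "oscillating_solution \<epsilon> u" and z: "z \<in> strip T" for \<epsilon> u z i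
  proof -
    obtain x t where zt: "z = (x, t)" and t: "t \<in> {0..T}" using z by (auto simp: strip_def)
    obtain B where B: "\<And>z i. z \<in> strip T \<Longrightarrow> \<bar>u z $ i\<bar> \<le> B"
      using BUC_component_bounded u unfolding oscillating_solution_def by blast
    have "u (x, t) $ i \<le> C + (A + 1) * t"
    proof (rule subsolution_upper_bound[where G = "\<lambda>i x. H i x (x /\<^sub>R \<epsilon>)", OF _ _ A0 C0 oscillating_cont[OF u] B])
      show "- A \<le> H i x (x /\<^sub>R \<epsilon>) 0 p" if "norm p \<le> 1" for i x p
        using A[of 0 p i x "x /\<^sub>R \<epsilon>"] that by simp
      show "u (x, 0) $ i \<le> C" for i x using C[of x i] oscillating_init[OF u, of x i] by linarith
      show "H i x (x /\<^sub>R \<epsilon>) s p \<le> H i x (x /\<^sub>R \<epsilon>) r p"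
        if "\<And>k. r $ k - s $ k \<le> r $ i - s $ i" "0 \<le> r $ i - s $ i" for i x r s p
        by (rule H_mono[OF that])
      show "\<tau> + H i x (x /\<^sub>R \<epsilon>) (u (x, t)) p \<le> 0"
        if "t > 0" "(p, \<tau>) \<in> superdiff (strip T) (\<lambda>z. u z $ i) (x, t)" for i x t p \<tau>
        by (rule oscillating_sub[OF u that])
    qed (use t in auto)
    moreover have "(- u (x, t)) $ i \<le> C + (A + 1) * t"
    proof (rule subsolution_upper_bound[where G = "\<lambda>i x r p. - H i x (x /\<^sub>R \<epsilon>) (- r) (- p)" and
          u = "\<lambda>z. - u z", OF _ _ A0 C0 continuous_on_minus[OF oscillating_cont[OF u]]])
      show "- A \<le> - H i x (x /\<^sub>R \<epsilon>) (- 0) (- p)" if "norm p \<le> 1" for i x p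
        using A[of 0 "- p" i x "x /\<^sub>R \<epsilon>"] that by simp
      show "(- u (x, 0)) $ i \<le> C" for i x using C[of x i] oscillating_init[OF u, of x i] by simp
      show "- H i x (x /\<^sub>R \<epsilon>) (- s) (- p) \<le> - H i x (x /\<^sub>R \<epsilon>) (- r) (- p)"
        if "\<And>k. r $ k - s $ k \<le> r $ i - s $ i" "0 \<le> r $ i - s $ i" for i x r s p
        using H_mono[of "- s" "- r" i x "x /\<^sub>R \<epsilon>" "- p"] that by simp
      show "\<bar>(- u z) $ i\<bar> \<le> B" if "z \<in> strip T" for z i using B[OF that] by simp
      show "\<tau> + - H i x (x /\<^sub>R \<epsilon>) (- (- u (x, t))) (- p) \<le> 0"
        if "t > 0" "(p, \<tau>) \<in> superdiff (strip T) (\<lambda>z. (- u z) $ i) (x, t)" for i x t p \<tau>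
        by (rule reflected_sub[OF u that])
    qed (use t in auto)
    moreover have "(A + 1) * t \<le> (A + 1) * T" using A0 t by (intro mult_left_mono) auto
    ultimately show ?thesis unfolding zt by (simp add: abs_le_iff)
  qed
  moreover have "0 \<le> C + (A + 1) * T" using C0 A0 T by simp
  ultimately show thesis using that by blast
qed

text \<open>\<open>doubling\<close> is applied to \<open>u\<close> against itself, with different
  times. Its conditions at the initial time come from barriers that grow linearly in
  \<open>t\<close>; the linear growth is traded for a quadratic one.\<close>

lemma oscillating_time_modulus:
  assumes e: "e > 0"
  obtains \<eta> where "\<eta> > 0" "\<And>\<epsilon> u x t s i. oscillating_solution \<epsilon> u \<Longrightarrow> t \<in> {0..T} \<Longrightarrow> s \<in> {0..T} \<Longrightarrow>
    u (x, t) $ i - u (x, s) $ i \<le> 2 * e + (t - s)\<^sup>2 / \<eta>"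
proof -
  obtain B where B: "0 \<le> B" "\<And>\<epsilon> u z i. oscillating_solution \<epsilon> u \<Longrightarrow> z \<in> strip T \<Longrightarrow> \<bar>u z $ i\<bar> \<le> B"
    using oscillating_bounded by blast
  obtain K where K: "K > 0" "\<And>x y i. u0 y $ i \<le> u0 x $ i + e + K * (sqrt (1\<^sup>2 + (norm (y - x))\<^sup>2) - 1)"
    using BUC_cone_modulus[OF u0 e] by blast
  define R where "R = max K (real CARD('m) * B)"
  have R: "K \<le> R" "real CARD('m) * B \<le> R" by (simp_all add: R_def)
  obtain A where A0: "0 \<le> A" and A: "\<And>j x y r p. norm r \<le> R \<Longrightarrow> norm p \<le> R \<Longrightarrow> \<bar>H j x y r p\<bar> \<le> A"
    using H_bdd[of R] by blast
  \<comment> \<open>Young's inequality: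
    \<open>(A + 1) * t \<le> e + (A + 1)^2 * t^2 / (4 * e)\<close>, and the last term is
    \<open>t^2 / \<eta>\<close>.\<close>
  define \<eta> where "\<eta> = 4 * e / (A + 1)\<^sup>2"
  have \<eta>: "\<eta> > 0" using e A0 by (simp add: \<eta>_def)
  have young: "(A + 1) * t \<le> e + t\<^sup>2 / \<eta>" for t
  proof -
    have "0 \<le> ((A + 1) * t - 2 * e)\<^sup>2" by simp
    then have "4 * e * ((A + 1) * t) \<le> 4 * e * e + ((A + 1) * t)\<^sup>2"
      by (simp add: power2_diff power2_eq_square algebra_simps)
    then have "(A + 1) * t \<le> (4 * e * e + ((A + 1) * t)\<^sup>2) / (4 * e)" using e by (simp add: field_simps)
    also have "\<dots> = e + ((A + 1) * t)\<^sup>2 / (4 * e)" using e by (simp add: add_divide_distrib)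
    also have "((A + 1) * t)\<^sup>2 / (4 * e) = t\<^sup>2 / \<eta>" by (simp add: \<eta>_def power_mult_distrib)
    finally show ?thesis .
  qed
  have "u (x, t) $ i - u (x, s) $ i \<le> 2 * e + (t - s)\<^sup>2 / \<eta>"
    if u: "oscillating_solution \<epsilon> u" and ts: "t \<in> {0..T}" "s \<in> {0..T}" for \<epsilon> u x t s i
  proof -
    interpret monotone_nonlinearity "\<lambda>i x. H i x (x /\<^sub>R \<epsilon>)"
      using u by (intro monotone_nonlinearity_oscillating) (simp add: oscillating_solution_def)
    note Bu = B(2)[OF u]
    have up: "u (x, t) $ i \<le> u0 x $ i + e + (A + 1) * t" if t: "t \<in> {0..T}" for x t i
    proof (rule subsolution_initial_layer[where G = "\<lambda>i x. H i x (x /\<^sub>R \<epsilon>)", OF K(1) _ A0 oscillating_cont[OF u] Bu])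
      show "- A \<le> H i x (x /\<^sub>R \<epsilon>) r p" if "norm r \<le> real CARD('m) * B" "norm p \<le> K" for i x r p
        using A[OF order_trans[OF that(1) R(2)] order_trans[OF that(2) R(1)], of i x "x /\<^sub>R \<epsilon>"] by (simp add: abs_le_iff)
      show "u (y, 0) $ i \<le> u0 x $ i + e + K * (sqrt (1\<^sup>2 + (norm (y - x))\<^sup>2) - 1)" for y
        using K(2)[of y i x] oscillating_init[OF u] by simp
      show "\<tau> + H i x (x /\<^sub>R \<epsilon>) (u (x, t)) p \<le> 0"
        if "t > 0" "(p, \<tau>) \<in> superdiff (strip T) (\<lambda>z. u z $ i) (x, t)" for i x t p \<tau>
        by (rule oscillating_sub[OF u that])
    qed (use t in auto)
    have low: "(- u (x, t)) $ i \<le> (- u0 x $ i + e) + (A + 1) * t" if t: "t \<in> {0..T}" for x t i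
    proof (rule subsolution_initial_layer[where G = "\<lambda>i x r p. - H i x (x /\<^sub>R \<epsilon>) (- r) (- p)" and
          u = "\<lambda>z. - u z", OF K(1) _ A0 continuous_on_minus[OF oscillating_cont[OF u]]])
      show "- A \<le> - H i x (x /\<^sub>R \<epsilon>) (- r) (- p)" if "norm r \<le> real CARD('m) * B" "norm p \<le> K" for i x r p
        using A[of "- r" "- p" i x "x /\<^sub>R \<epsilon>"] order_trans[OF that(1) R(2)] order_trans[OF that(2) R(1)]
        by (simp add: abs_le_iff)
      show "(- u (y, 0)) $ i \<le> (- u0 x $ i + e) + K * (sqrt (1\<^sup>2 + (norm (y - x))\<^sup>2) - 1)" for y
        using K(2)[of x i y] oscillating_init[OF u, of y i] by (simp add: norm_minus_commute)
      show "\<bar>(- u z) $ i\<bar> \<le> B" if "z \<in> strip T" for z i using Bu[OF that] by simp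
      show "\<tau> + - H i x (x /\<^sub>R \<epsilon>) (- (- u (x, t))) (- p) \<le> 0"
        if "t > 0" "(p, \<tau>) \<in> superdiff (strip T) (\<lambda>z. (- u z) $ i) (x, t)" for i x t p \<tau>
        by (rule reflected_sub[OF u that])
    qed (use t in auto)
    show ?thesis
    proof (rule doubling[OF \<eta> _ oscillating_cont[OF u] oscillating_cont[OF u] Bu Bu])
      show "0 \<le> 2 * e" using e by simp
      show "\<exists>d>0. \<forall>i x y t. t \<in> {0..T} \<and> dist x y < d \<longrightarrow> \<bar>u (x, t) $ i - u (y, t) $ i\<bar> < e'"
        if "e' > 0" for e'
        using BUC_space_uniform[OF _ that] u unfolding oscillating_solution_def by blast
      show "u (x, t) $ i - u (x, 0) $ i \<le> 2 * e + t\<^sup>2 / \<eta>" if "t \<in> {0..T}" for i x t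
        using up[OF that, of x i] young[of t] oscillating_init[OF u, of x i] by linarith
      show "u (x, 0) $ i - u (x, t) $ i \<le> 2 * e + t\<^sup>2 / \<eta>" if "t \<in> {0..T}" for i x t
        using low[OF that, of x i] young[of t] oscillating_init[OF u, of x i] by simp
      show "\<tau> + H i x (x /\<^sub>R \<epsilon>) (u (x, t)) p \<le> 0"
        if "t > 0" "(p, \<tau>) \<in> superdiff (strip T) (\<lambda>z. u z $ i) (x, t)" for i x t p \<tau>
        by (rule oscillating_sub[OF u that])
      show "0 \<le> - \<tau> + H i x (x /\<^sub>R \<epsilon>) (u (x, t)) (- p)"
        if "t > 0" "(p, \<tau>) \<in> superdiff (strip T) (\<lambda>z. - u z $ i) (x, t)" for i x t p \<tau>
        by (rule oscillating_sup[OF u that])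
    qed (use ts in auto)
  qed
  with \<eta> show thesis using that by blast
qed

lemma oscillating_equicontinuous:
  assumes e: "e > 0"
  obtains d where "d > 0" "\<And>\<epsilon> u z z'. oscillating_solution \<epsilon> u \<Longrightarrow> z \<in> strip T \<Longrightarrow> z' \<in> strip T \<Longrightarrow>
    dist z z' < d \<Longrightarrow> dist (u z) (u z') < e"
proof -
  \<comment> \<open>Each component will vary by at most \<open>10 * c\<close>: \<open>6 * c\<close>
    and \<open>2 * c\<close> from the two moduli and \<open>c\<close> from each distance term.
    Summing over components gives \<open>10 / 16 * e\<close>.\<close>
  define c where "c = e / (16 * real CARD('m))"
  have c: "c > 0" using e by (simp add: c_def)
  obtain B where B: "0 \<le> B" "\<And>\<epsilon> u z i. oscillating_solution \<epsilon> u \<Longrightarrow> z \<in> strip T \<Longrightarrow> \<bar>u z $ i\<bar> \<le> B"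
    using oscillating_bounded by blast
  obtain \<eta> where \<eta>: "\<eta> > 0" "\<And>\<epsilon> u x t s i. oscillating_solution \<epsilon> u \<Longrightarrow> t \<in> {0..T} \<Longrightarrow> s \<in> {0..T} \<Longrightarrow>
    u (x, t) $ i - u (x, s) $ i \<le> 2 * c + (t - s)\<^sup>2 / \<eta>"
    using oscillating_time_modulus[OF c] by blast
  obtain K where K: "K > 0" "\<And>x y i. u0 y $ i \<le> u0 x $ i + c + K * (sqrt (1\<^sup>2 + (norm (y - x))\<^sup>2) - 1)"
    using BUC_cone_modulus[OF u0 c] by blast
  obtain R0 where R0: "\<And>j x y r p. R0 \<le> norm p \<Longrightarrow> 2 * T / \<eta> + 1 \<le> H j x y r p" using H_coer by blast
  define R where "R = \<bar>R0\<bar>"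
  \<comment> \<open>The slope must strictly exceed the gradient bound \<open>R\<close> and dominate
    the cone slope \<open>K\<close> of the initial data.\<close>
  define L where "L = max K (R + 1)"
  have L: "0 \<le> R" "R < L" "K \<le> L" by (auto simp: R_def L_def)
  have space: "u (x, t) $ i - u (y, t) $ i \<le> 6 * c + L * norm (x - y)"
    if u: "oscillating_solution \<epsilon> u" and t: "t \<in> {0..T}" for \<epsilon> u x y t i
  proof -
    have "u (x, t) $ i - u (y, t) $ i \<le> 3 * (2 * c) + L * norm (x - y)"
    proof (rule subsolution_space_modulus[where G = "\<lambda>i x. H i x (x /\<^sub>R \<epsilon>)",
          OF \<eta>(1) _ L(1,2) _ oscillating_cont[OF u] B(2)[OF u]])
      show "2 * T / \<eta> + 1 \<le> H i x (x /\<^sub>R \<epsilon>) r p" if "R \<le> norm p" for i x r p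
        using R0[of p i x "x /\<^sub>R \<epsilon>" r] that by (simp add: R_def)
      show "\<exists>d>0. \<forall>i x y t. t \<in> {0..T} \<and> dist x y < d \<longrightarrow> \<bar>u (x, t) $ i - u (y, t) $ i\<bar> < 2 * c"
        using BUC_space_uniform[of T u "2 * c"] u c unfolding oscillating_solution_def by simp
      show "u (x, 0) $ i \<le> u (y, 0) $ i + 2 * c + L * norm (x - y)" for x y
      proof -
        have "K * (sqrt (1\<^sup>2 + (norm (x - y))\<^sup>2) - 1) \<le> K * norm (x - y)"
          using sqrt_one_norm(4)[of "x - y"] K(1) by (intro mult_left_mono) auto
        also have "\<dots> \<le> L * norm (x - y)" using L(3) by (intro mult_right_mono) auto
        finally show ?thesis using K(2)[of x i y] c oscillating_init[OF u] by simp
      qed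
      show "\<tau> + H i x (x /\<^sub>R \<epsilon>) (u (x, t)) p \<le> 0"
        if "t > 0" "(p, \<tau>) \<in> superdiff (strip T) (\<lambda>z. u z $ i) (x, t)" for i x t p \<tau>
        by (rule oscillating_sub[OF u that])
      show "u (x, t) $ i - u (x, s) $ i \<le> 2 * c + (t - s)\<^sup>2 / \<eta>" if "t \<in> {0..T}" "s \<in> {0..T}" for x t s
        by (rule \<eta>(2)[OF u that])
    qed (use c t in auto)
    then show ?thesis by simp
  qed
  define d where "d = min (c / L) (min 1 (c * \<eta>))"
  have "L > 0" using L by linarith
  then have d: "d > 0" using c \<eta> by (simp add: d_def)
  have comp: "u z $ i - u z' $ i \<le> 10 * c"
    if u: "oscillating_solution \<epsilon> u" and z: "z \<in> strip T" "z' \<in> strip T" "dist z z' < d" for \<epsilon> u z z' i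
  proof -
    obtain x t y s where zz: "z = (x, t)" "z' = (y, s)" by (cases z, cases z')
    have ts: "t \<in> {0..T}" "s \<in> {0..T}" using z(1,2) by (auto simp: zz strip_def)
    have "norm (x - y) \<le> dist z z'" "\<bar>t - s\<bar> \<le> dist z z'"
      using dist_fst_le[of z z'] dist_snd_le[of z z'] by (auto simp: zz dist_norm)
    then have n: "norm (x - y) < d" "\<bar>t - s\<bar> < d" using z(3) by linarith+
    have "L * norm (x - y) \<le> L * (c / L)"
      using n(1) \<open>L > 0\<close> by (intro mult_left_mono) (auto simp: d_def)
    then have 1: "L * norm (x - y) \<le> c" using \<open>L > 0\<close> by simp
    have "(t - s)\<^sup>2 = \<bar>t - s\<bar> * \<bar>t - s\<bar>" by (simp add: power2_eq_square)
    also have "\<dots> \<le> 1 * (c * \<eta>)" using n(2) by (intro mult_mono) (auto simp: d_def)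
    finally have 2: "(t - s)\<^sup>2 / \<eta> \<le> c" using \<eta>(1) by (simp add: divide_le_eq)
    show ?thesis
      using space[OF u ts(1), of x i y] \<eta>(2)[OF u ts, of y i] 1 2 c unfolding zz by linarith
  qed
  have "dist (u z) (u z') < e"
    if u: "oscillating_solution \<epsilon> u" and z: "z \<in> strip T" "z' \<in> strip T" "dist z z' < d" for \<epsilon> u z z'
  proof -
    have "\<bar>(u z - u z') $ i\<bar> \<le> 10 * c" for i
      using comp[OF u z, of i] comp[OF u z(2,1), of i] z(3) by (simp add: dist_commute abs_le_iff)
    then have "norm (u z - u z') \<le> real CARD('m) * (10 * c)" by (rule norm_le_CARD)
    also have "\<dots> = 10 / 16 * e" by (simp add: c_def)
    also have "\<dots> < e" using e by simp
    finally show ?thesis by (simp add: dist_norm)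
  qed
  with d show thesis using that by blast
qed

end

section \<open>Homogenization\<close>

lemma uniform_limit_tendsto_along:
  assumes S: "closed S" and g: "continuous_on S g" and z0: "z0 \<in> S"
    and lim: "\<And>K. compact K \<Longrightarrow> K \<subseteq> S \<Longrightarrow> uniform_limit K f g sequentially"
    and zs: "\<And>n. zs n \<in> S" "zs \<longlonglongrightarrow> (z0 :: 'a::heine_borel)"
  shows "(\<lambda>n. f n (zs n)) \<longlonglongrightarrow> g z0"
proof (rule tendstoI)
  fix e :: real assume "e > 0"
  then have e: "e / 2 > 0" by simp
  let ?K = "S \<inter> cball z0 1"
  have K: "compact ?K" "?K \<subseteq> S" using S by (auto simp: closed_Int_compact)
  have "(\<lambda>n. g (zs n)) \<longlonglongrightarrow> g z0"
    by (rule continuous_on_tendsto_compose[OF g zs(2) z0]) (simp add: zs(1))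
  from tendstoD[OF this e] tendstoD[OF zs(2) zero_less_one] uniform_limitD[OF lim[OF K] e]
  show "\<forall>\<^sub>F n in sequentially. dist (f n (zs n)) (g z0) < e"
  proof eventually_elim
    case (elim n)
    then have "zs n \<in> ?K" using zs(1) by (simp add: dist_commute)
    with elim(3) have "dist (f n (zs n)) (g (zs n)) < e / 2" by blast
    with elim(1) show ?case using dist_triangle_half_r by (metis dist_commute)
  qed
qed

text \<open>Perturbed test function method with a corrector \<open>v\<close> that is merely Lipschitz. The
  perturbation \<open>\<epsilon> v (x / \<epsilon>)\<close> is replaced by its sup-convolution at scale \<open>\<epsilon>\<^sup>2\<close>, which displaces the
  point by at most \<open>L \<epsilon>\<^sup>2\<close>, hence the fast variable by at most \<open>L \<epsilon>\<close>.\<close>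

lemma perturbed_test_function:
  fixes G :: "real^'n \<Rightarrow> real^'n \<Rightarrow> real^'m \<Rightarrow> real^'n \<Rightarrow> real"
  assumes G: "\<And>R e. e > 0 \<Longrightarrow> \<exists>d>0. \<forall>x y r p x' y' r' p'.
      norm r \<le> R \<and> norm p \<le> R \<and> norm r' \<le> R \<and> norm p' \<le> R \<and>
      dist x x' < d \<and> dist y y' < d \<and> dist r r' < d \<and> dist p p' < d \<longrightarrow>
      \<bar>G x y r p - G x' y' r' p'\<bar> < e"
    and \<epsilon>: "\<And>n. \<epsilon> n > 0" "\<epsilon> \<longlonglongrightarrow> 0"
    and un: "\<And>n. continuous_on (strip T) (un n)" and u: "continuous_on (strip T) u"
    and lim: "\<And>K. compact K \<Longrightarrow> K \<subseteq> strip T \<Longrightarrow> uniform_limit K un u sequentially"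
    and sub: "\<And>n x t p \<tau>. t > 0 \<Longrightarrow> (p, \<tau>) \<in> superdiff (strip T) (\<lambda>z. un n z $ i) (x, t) \<Longrightarrow>
      \<tau> + G x (x /\<^sub>R \<epsilon> n) (un n (x, t)) p \<le> 0"
    and v: "L-lipschitz_on UNIV v" "\<And>y. \<bar>v y\<bar> \<le> B"
    and corr: "\<And>y q. q \<in> superdiff UNIV (\<lambda>y. - v y) y \<Longrightarrow> c \<le> G x0 y (u (x0, t0)) (p0 - q)"
    and t0: "t0 > 0" and q0: "(p0, \<tau>0) \<in> superdiff (strip T) (\<lambda>z. u z $ i) (x0, t0)"
  shows "\<tau>0 + c \<le> 0"
proof -
  have L0: "0 \<le> L" using v(1) by (rule lipschitz_on_nonneg)
  have vc: "continuous_on UNIV v" by (rule lipschitz_on_continuous_on[OF v(1)])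
  have z0: "(x0, t0) \<in> strip T" using q0 by (auto simp: superdiff_def local_max_on_def)
  \<comment> \<open>The quantity maximized over the displacement \<open>z\<close> in the
    sup-convolution of \<open>- \<epsilon> n * v (x /\<^sub>R \<epsilon> n)\<close>; its maximum is
    \<open>g n x\<close>, attained at \<open>Z n x\<close>.\<close>
  define k where "k n x z = - \<epsilon> n * v ((x + z) /\<^sub>R \<epsilon> n) - (1 / (\<epsilon> n)\<^sup>2) * (norm z)\<^sup>2" for n x z
  have "\<exists>z. \<forall>z'. k n x z' \<le> k n x z" for n x
  proof -
    \<comment> \<open>Beyond this radius the penalty is at least
      \<open>2 * B * \<epsilon> n\<close>, the largest gain possible from the corrector; the summand
      1 makes \<open>norm z \<le> (norm z)^2\<close> available.\<close>
    let ?M = "1 + 2 * B * (\<epsilon> n) ^ 3"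
    have "B \<ge> 0" using v(2)[of 0] by linarith
    obtain z where "z \<in> UNIV" "\<And>z'. z' \<in> UNIV \<Longrightarrow> k n x z' \<le> k n x z"
    proof (rule attains_max_coercive[of UNIV "k n x" 0 ?M])
      show "continuous_on UNIV (k n x)"
        unfolding k_def by (intro continuous_intros continuous_on_compose2[OF vc]) (use \<epsilon>(1)[of n] in auto)
      fix z :: "real^'n" assume z: "norm z > ?M"
      have "2 * B * (\<epsilon> n) ^ 3 \<ge> 0" using \<open>B \<ge> 0\<close> \<epsilon>(1)[of n] by simp
      then have "norm z \<le> (norm z)\<^sup>2" using z by (intro self_le_power) auto
      then have "2 * B * (\<epsilon> n) ^ 3 \<le> (norm z)\<^sup>2" using z by linarith
      then have "2 * B * \<epsilon> n \<le> (1 / (\<epsilon> n)\<^sup>2) * (norm z)\<^sup>2"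
        using \<epsilon>(1)[of n] by (simp add: field_simps power3_eq_cube power2_eq_square)
      moreover have "\<bar>\<epsilon> n * v y\<bar> \<le> \<epsilon> n * B" for y
        using v(2)[of y] \<epsilon>(1)[of n] by (simp add: abs_mult)
      from this[of "(x + z) /\<^sub>R \<epsilon> n"] this[of "(x + 0) /\<^sub>R \<epsilon> n"]
      have "- \<epsilon> n * v ((x + z) /\<^sub>R \<epsilon> n) \<le> \<epsilon> n * B" "- \<epsilon> n * v ((x + 0) /\<^sub>R \<epsilon> n) \<ge> - (\<epsilon> n * B)"
        by (auto simp: abs_le_iff)
      ultimately show "k n x z \<le> k n x 0" unfolding k_def by (simp add: mult_ac)
    qed auto
    then show ?thesis by blast
  qed
  then obtain Z where Z: "\<And>n x z. k n x z \<le> k n x (Z n x)" by metis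
  define g where "g n x = k n x (Z n x)" for n x
  have veps: "\<bar>\<epsilon> n * v (a /\<^sub>R \<epsilon> n) - \<epsilon> n * v (b /\<^sub>R \<epsilon> n)\<bar> \<le> L * norm (a - b)" for n a b
  proof -
    have "\<bar>\<epsilon> n * v (a /\<^sub>R \<epsilon> n) - \<epsilon> n * v (b /\<^sub>R \<epsilon> n)\<bar> = \<epsilon> n * dist (v (a /\<^sub>R \<epsilon> n)) (v (b /\<^sub>R \<epsilon> n))"
      using \<epsilon>(1)[of n] by (simp add: dist_real_def abs_mult flip: right_diff_distrib)
    also have "\<dots> \<le> \<epsilon> n * (L * dist (a /\<^sub>R \<epsilon> n) (b /\<^sub>R \<epsilon> n))"
      using \<epsilon>(1)[of n] lipschitz_onD[OF v(1)] by (intro mult_left_mono) auto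
    also have "dist (a /\<^sub>R \<epsilon> n) (b /\<^sub>R \<epsilon> n) = norm (a - b) / \<epsilon> n"
      using \<epsilon>(1)[of n] by (simp add: dist_norm divide_inverse mult.commute flip: scaleR_right_diff_distrib)
    finally show ?thesis using \<epsilon>(1)[of n] by simp
  qed
  \<comment> \<open>Compare with \<open>z = 0\<close>: rescaling leaves the Lipschitz constant
    \<open>L\<close> unchanged, so the penalty is at most \<open>L * norm (Z n x)\<close>.\<close>
  have Zb: "norm (Z n x) \<le> L * (\<epsilon> n)\<^sup>2" for n x
  proof -
    have "(1 / (\<epsilon> n)\<^sup>2) * (norm (Z n x))\<^sup>2 \<le> L * norm (Z n x)"
      using Z[of n x 0] veps[of n "x + Z n x" x] by (simp add: k_def abs_le_iff)
    then have "norm (Z n x) * norm (Z n x) \<le> (L * (\<epsilon> n)\<^sup>2) * norm (Z n x)"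
      using \<epsilon>(1)[of n] by (simp add: field_simps power2_eq_square)
    then show ?thesis using L0 by (cases "Z n x = 0") auto
  qed
  have gb: "\<bar>g n x\<bar> \<le> \<epsilon> n * B" for n x
  proof -
    have *: "\<bar>\<epsilon> n * v y\<bar> \<le> \<epsilon> n * B" for y
      using v(2)[of y] \<epsilon>(1)[of n] by (simp add: abs_mult)
    have "(1 / (\<epsilon> n)\<^sup>2) * (norm (Z n x))\<^sup>2 \<ge> 0" by simp
    then have "g n x \<le> \<epsilon> n * B"
      using *[of "(x + Z n x) /\<^sub>R \<epsilon> n"] unfolding g_def k_def by (simp only: abs_le_iff) linarith
    moreover have "k n x 0 \<le> g n x" unfolding g_def by (rule Z)
    then have "- (\<epsilon> n * B) \<le> g n x" using *[of "x /\<^sub>R \<epsilon> n"] by (simp add: k_def abs_le_iff)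
    ultimately show ?thesis by (simp add: abs_le_iff)
  qed
  have gc: "continuous_on UNIV (g n)" for n
  proof (rule lipschitz_on_continuous_on[OF lipschitz_realI[OF _ L0]])
    fix x y
    have "k n y (Z n y) \<le> k n x (Z n y) + L * norm (y - x)"
      using veps[of n "x + Z n y" "y + Z n y"] by (simp add: k_def abs_le_iff norm_minus_commute)
    also have "k n x (Z n y) \<le> g n x" unfolding g_def by (rule Z)
    finally show "g n y \<le> g n x + L * norm (y - x)" by (simp add: g_def)
  qed
  have \<epsilon>B: "(\<lambda>n. \<epsilon> n * B) \<longlonglongrightarrow> 0" using tendsto_mult_left_zero[OF \<epsilon>(2)] .
  have g0: "(\<lambda>n. g n x) \<longlonglongrightarrow> 0" for x
  proof (rule tendsto_norm_zero_cancel, rule tendsto_sandwich[OF _ _ tendsto_const \<epsilon>B])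
    show "\<forall>\<^sub>F n in sequentially. norm (g n x) \<le> \<epsilon> n * B" using gb by simp
  qed simp
  \<comment> \<open>The perturbation is added to the solution instead of the test function. As
    \<open>g n\<close> vanishes uniformly, \<open>superdiff_stable\<close> carries
    \<open>(p0, \<tau>0)\<close> over to \<open>fn n\<close>.\<close>
  define fn where "fn n z = un n z $ i + g n (fst z)" for n z
  have ui: "continuous_on (strip T) (\<lambda>z. u z $ i)" by (rule continuous_on_component[OF u])
  obtain zs qs where zs: "\<forall>\<^sub>F n in sequentially. qs n \<in> superdiff (strip T) (fn n) (zs n)"
    "\<And>n. zs n \<in> strip T" "zs \<longlonglongrightarrow> (x0, t0)" "qs \<longlonglongrightarrow> (p0, \<tau>0)"
  proof (rule superdiff_stable[of "strip T" "\<lambda>z. u z $ i" fn "(x0, t0)" "(p0, \<tau>0)"])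
    show "continuous_on (strip T) (fn n)" for n
      unfolding fn_def
      by (intro continuous_on_add continuous_on_component un continuous_on_compose2[OF gc])
        (auto intro: continuous_on_fst continuous_on_id)
    have "(\<lambda>n. un n (x0, t0)) \<longlonglongrightarrow> u (x0, t0)"
      using uniform_limit_tendsto_along[OF closed_strip u z0 lim z0] by simp
    then have "(\<lambda>n. un n (x0, t0) $ i + g n x0) \<longlonglongrightarrow> u (x0, t0) $ i + 0"
      by (intro tendsto_add g0 tendsto_vec_nth)
    then show "(\<lambda>n. fn n (x0, t0)) \<longlonglongrightarrow> u (x0, t0) $ i" by (simp add: fn_def)
    show "\<forall>\<^sub>F n in sequentially. \<forall>z\<in>K. fn n z \<le> u z $ i + e"
      if K: "compact K" "K \<subseteq> strip T" and e: "e > 0" for K e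
    proof -
      have e2: "e / 2 > 0" using e by simp
      from uniform_limitD[OF lim[OF K] e2] tendstoD[OF \<epsilon>B e2]
      show ?thesis
      proof eventually_elim
        case (elim n)
        show ?case
        proof
          fix z assume "z \<in> K"
          then have "dist (un n z) (u z) < e / 2" using elim(1) by blast
          then have "\<bar>un n z $ i - u z $ i\<bar> < e / 2"
            using component_le_norm_cart[of "un n z - u z" i] by (simp add: dist_norm)
          moreover have "g n (fst z) < e / 2"
            using gb[of n "fst z"] elim(2) by (simp add: dist_real_def)
          ultimately show "fn n z \<le> u z $ i + e" unfolding fn_def by linarith
        qed
      qed
    qed
  qed (use closed_strip ui z0 q0 in auto)
  define x t p \<tau> where xt: "x n = fst (zs n)" "t n = snd (zs n)" "p n = fst (qs n)" "\<tau> n = snd (qs n)" for n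
  have lims: "x \<longlonglongrightarrow> x0" "t \<longlonglongrightarrow> t0" "p \<longlonglongrightarrow> p0" "\<tau> \<longlonglongrightarrow> \<tau>0"
    using tendsto_fst[OF zs(3)] tendsto_snd[OF zs(3)] tendsto_fst[OF zs(4)] tendsto_snd[OF zs(4)]
    by (simp_all add: xt[abs_def])
  define y where "y n = x n + Z n (x n)" for n
  define a where "a n = (2 / (\<epsilon> n)\<^sup>2) *\<^sub>R (x n - y n)" for n
  have ab: "norm (a n) \<le> 2 * L" for n
    using Zb[of n "x n"] \<epsilon>(1)[of n] by (simp add: a_def y_def field_simps)
  have kxy: "- \<epsilon> n * v (y' /\<^sub>R \<epsilon> n) - (1 / (\<epsilon> n)\<^sup>2) * (norm (y' - x'))\<^sup>2 \<le> g n x'" for n x' y'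
    using Z[of n x' "y' - x'"] by (simp add: k_def g_def)
  have gxy: "g n (x n) = - \<epsilon> n * v (y n /\<^sub>R \<epsilon> n) - (1 / (\<epsilon> n)\<^sup>2) * (norm (y n - x n))\<^sup>2" for n
    by (simp add: g_def k_def y_def)
  \<comment> \<open>With \<open>x n\<close> frozen, \<open>y n\<close> is the best point in the
    sup-convolution. In the fast variable this is a parabola touching \<open>- v\<close> from above,
    with gradient \<open>- a n\<close>.\<close>
  have low: "c \<le> G x0 (y n /\<^sub>R \<epsilon> n) (u (x0, t0)) (p0 + a n)" for n
  proof -
    let ?\<eta> = "y n /\<^sub>R \<epsilon> n" and ?\<xi> = "x n /\<^sub>R \<epsilon> n"
    have e: "\<epsilon> n > 0" by (rule \<epsilon>(1))
    have sc: "(1 / (\<epsilon> n)\<^sup>2) * (norm (\<epsilon> n *\<^sub>R w - x n))\<^sup>2 = (norm (w - ?\<xi>))\<^sup>2" for w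
    proof -
      have "\<epsilon> n *\<^sub>R w - x n = \<epsilon> n *\<^sub>R (w - ?\<xi>)" using e by (simp add: scaleR_right_diff_distrib)
      then have "norm (\<epsilon> n *\<^sub>R w - x n) = \<epsilon> n * norm (w - ?\<xi>)" using e by simp
      then show ?thesis using e by (simp add: power_mult_distrib)
    qed
    have "(1 / \<epsilon> n) *\<^sub>R (2 *\<^sub>R (?\<eta> - ?\<xi>)) \<in> superdiff UNIV (\<lambda>y. - v y) ?\<eta>"
    proof (rule superdiffI[OF C1_scale[OF C1_norm_squared[of ?\<xi>], of "1 / \<epsilon> n"]])
      fix w
      have "- \<epsilon> n * v w - (norm (w - ?\<xi>))\<^sup>2 \<le> - \<epsilon> n * v ?\<eta> - (norm (?\<eta> - ?\<xi>))\<^sup>2"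
        using kxy[of n "\<epsilon> n *\<^sub>R w" "x n"] e unfolding gxy sc[symmetric] by simp
      then have "(1 / \<epsilon> n) * (- \<epsilon> n * v w - (norm (w - ?\<xi>))\<^sup>2) \<le> (1 / \<epsilon> n) * (- \<epsilon> n * v ?\<eta> - (norm (?\<eta> - ?\<xi>))\<^sup>2)"
        using e by (intro mult_left_mono) auto
      then show "- v w - 1 / \<epsilon> n * (norm (w - ?\<xi>))\<^sup>2 \<le> - v ?\<eta> - 1 / \<epsilon> n * (norm (?\<eta> - ?\<xi>))\<^sup>2"
        using e by (simp add: right_diff_distrib)
    qed auto
    moreover have "(1 / \<epsilon> n) *\<^sub>R (2 *\<^sub>R (?\<eta> - ?\<xi>)) = - a n"
      using e by (simp add: a_def scaleR_right_diff_distrib power2_eq_square divide_inverse mult_ac)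
    ultimately have "- a n \<in> superdiff UNIV (\<lambda>y. - v y) ?\<eta>" by simp
    from corr[OF this] show ?thesis by simp
  qed
  \<comment> \<open>With \<open>y n\<close> frozen instead, the parabola \<psi> lies below
    \<open>g n\<close> and meets it at \<open>x n\<close>; it is smooth and can be moved to the test
    function, which shifts the gradient by \<open>a n\<close>.\<close>
  have up: "\<forall>\<^sub>F n in sequentially. \<tau> n + G (x n) (x n /\<^sub>R \<epsilon> n) (un n (zs n)) (p n + a n) \<le> 0"
    using zs(1) order_tendstoD(1)[OF lims(2) t0]
  proof eventually_elim
    case (elim n)
    define \<psi> where "\<psi> z = - \<epsilon> n * v (y n /\<^sub>R \<epsilon> n) - (1 / (\<epsilon> n)\<^sup>2) * (norm (fst z - y n))\<^sup>2"
      for z :: "(real^'n) \<times> real"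
    have \<psi>: "C1_with_gradient \<psi> (\<lambda>z. (0 - (1 / (\<epsilon> n)\<^sup>2) *\<^sub>R (2 *\<^sub>R (fst z - y n)), 0))"
      unfolding \<psi>_def
      by (intro C1_fst[of "\<lambda>x. - \<epsilon> n * v (y n /\<^sub>R \<epsilon> n) - (1 / (\<epsilon> n)\<^sup>2) * (norm (x - y n))\<^sup>2"]
          C1_diff C1_const C1_scale C1_norm_squared)
    have "qs n \<in> superdiff (strip T) (\<lambda>z. un n z $ i + \<psi> z) (zs n)"
    proof (rule superdiff_touch[OF elim(1)])
      show "\<forall>\<^sub>F w in at (zs n) within strip T. un n w $ i + \<psi> w \<le> fn n w"
        using kxy[of n "y n"] by (intro always_eventually allI) (simp add: \<psi>_def fn_def norm_minus_commute)
      show "un n (zs n) $ i + \<psi> (zs n) = fn n (zs n)"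
        using gxy[of n] by (simp add: \<psi>_def fn_def norm_minus_commute xt)
    qed
    from superdiff_add_C1[OF this \<psi>]
    have "qs n - (0 - (1 / (\<epsilon> n)\<^sup>2) *\<^sub>R (2 *\<^sub>R (x n - y n)), 0) \<in> superdiff (strip T) (\<lambda>z. un n z $ i) (zs n)"
      by (simp add: xt)
    moreover have "qs n - (0 - (1 / (\<epsilon> n)\<^sup>2) *\<^sub>R (2 *\<^sub>R (x n - y n)), 0) = (p n + a n, \<tau> n)"
      by (cases "qs n") (simp add: xt a_def)
    moreover have zn: "zs n = (x n, t n)" by (simp add: xt)
    ultimately have "(p n + a n, \<tau> n) \<in> superdiff (strip T) (\<lambda>z. un n z $ i) (x n, t n)" by simp
    from sub[OF elim(2) this] show ?case by (simp add: zn)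
  qed
  have unz: "(\<lambda>n. un n (zs n)) \<longlonglongrightarrow> u (x0, t0)"
    by (rule uniform_limit_tendsto_along[OF closed_strip u z0 lim zs(2,3)])
  show ?thesis
  proof (rule field_le_epsilon)
    fix e :: real assume e: "e > 0"
    define R where "R = norm (u (x0, t0)) + norm p0 + 2 * L + 1"
    obtain d where d: "d > 0" "\<And>x y r p x' y' r' p'. norm r \<le> R \<Longrightarrow> norm p \<le> R \<Longrightarrow> norm r' \<le> R \<Longrightarrow> norm p' \<le> R \<Longrightarrow>
        dist x x' < d \<Longrightarrow> dist y y' < d \<Longrightarrow> dist r r' < d \<Longrightarrow> dist p p' < d \<Longrightarrow>
        \<bar>G x y r p - G x' y' r' p'\<bar> < e" using G[OF e, of R] by blast
    define d1 where "d1 = min d 1"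
    have d1: "d1 > 0" using d(1) by (simp add: d1_def)
    have "(\<lambda>n. \<epsilon> n * L) \<longlonglongrightarrow> 0" using tendsto_mult_left_zero[OF \<epsilon>(2)] .
    from up tendstoD[OF this d1] tendstoD[OF unz d1] tendstoD[OF lims(1) d1] tendstoD[OF lims(3) d1]
    have "\<forall>\<^sub>F n in sequentially. \<tau> n + c \<le> e"
    proof eventually_elim
      case (elim n)
      have "dist (x n /\<^sub>R \<epsilon> n) (y n /\<^sub>R \<epsilon> n) = norm (Z n (x n)) / \<epsilon> n"
        using \<epsilon>(1)[of n] by (simp add: dist_norm y_def divide_inverse mult.commute flip: scaleR_right_diff_distrib)
      also have "\<dots> \<le> (L * (\<epsilon> n)\<^sup>2) / \<epsilon> n" using Zb \<epsilon>(1)[of n] by (intro divide_right_mono) auto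
      also have "\<dots> = \<epsilon> n * L" using \<epsilon>(1)[of n] by (simp add: power2_eq_square)
      also have "\<dots> < d1" using elim(2) by (simp add: dist_real_def)
      finally have 1: "dist (x n /\<^sub>R \<epsilon> n) (y n /\<^sub>R \<epsilon> n) < d" by (simp add: d1_def)
      have 2: "norm (un n (zs n)) \<le> norm (u (x0, t0)) + 1" "norm (p n) \<le> norm p0 + 1"
        using norm_triangle_sub[of "un n (zs n)" "u (x0, t0)"] norm_triangle_sub[of "p n" p0] elim(3,5)
        by (auto simp: dist_norm d1_def)
      have 3: "norm (p n + a n) \<le> norm (p n) + 2 * L" "norm (p0 + a n) \<le> norm p0 + 2 * L"
        using norm_triangle_ineq[of "p n" "a n"] norm_triangle_ineq[of p0 "a n"] ab[of n] by linarith+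
      have 4: "dist (p n + a n) (p0 + a n) < d" using elim(5) by (simp add: dist_norm d1_def)
      have nn: "norm p0 \<ge> 0" "norm (u (x0, t0)) \<ge> 0" by simp_all
      have "\<bar>G (x n) (x n /\<^sub>R \<epsilon> n) (un n (zs n)) (p n + a n) - G x0 (y n /\<^sub>R \<epsilon> n) (u (x0, t0)) (p0 + a n)\<bar> < e"
      proof (rule d(2)[OF _ _ _ _ _ 1 _ 4])
        show "norm (un n (zs n)) \<le> R" "norm (p n + a n) \<le> R" "norm (u (x0, t0)) \<le> R" "norm (p0 + a n) \<le> R"
          using 2 3 nn L0 unfolding R_def by linarith+
        show "dist (x n) x0 < d" "dist (un n (zs n)) (u (x0, t0)) < d"
          using elim(3,4) by (simp_all add: d1_def)
      qed
      then show ?case using low[of n] elim(1) by linarith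
    qed
    from tendsto_upperbound[OF tendsto_add[OF lims(4) tendsto_const] this]
    show "\<tau>0 + c \<le> 0 + e" by simp
  qed
qed

section \<open>Passage to the limit in the systems\<close>

lemma usc_on_continuous: "continuous_on S f \<Longrightarrow> usc_on S f"
  unfolding usc_on_def continuous_on_def by (blast intro: order_tendstoD(2))

lemma lsc_on_continuous: "continuous_on S f \<Longrightarrow> lsc_on S f"
  unfolding lsc_on_def continuous_on_def by (blast intro: order_tendstoD(1))

context hamiltonian_problem
begin

lemma limit_solution:
  assumes sol: "\<And>n. oscillating_solution (\<epsilon> n) (un n)" and \<epsilon>: "\<epsilon> \<longlonglongrightarrow> 0"
    and u: "BUC_on (strip T) u"
    and lim: "\<And>K. compact K \<Longrightarrow> K \<subseteq> strip T \<Longrightarrow> uniform_limit K un u sequentially"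
  shows "visc_solution (limit_G H) T u0 u"
proof -
  have uc: "continuous_on (strip T) u"
    using u by (auto simp: BUC_on_def intro: uniformly_continuous_imp_continuous)
  have ui: "continuous_on (strip T) (\<lambda>z. u z $ i)" for i by (rule continuous_on_component[OF uc])
  have unc: "continuous_on (strip T) (un n)" for n by (rule oscillating_cont[OF sol])
  have e0: "\<epsilon> n > 0" for n using sol[of n] by (simp add: oscillating_solution_def)
  have init: "u (x, 0) $ i = u0 x $ i" for x i
  proof -
    have z: "(x, 0) \<in> strip T" using T by (simp add: strip_def)
    have "(\<lambda>n. un n (x, 0) $ i) \<longlonglongrightarrow> u (x, 0) $ i"
      using uniform_limit_tendsto_along[OF closed_strip uc z lim z] by (intro tendsto_vec_nth) simp
    moreover have "(\<lambda>n. un n (x, 0) $ i) = (\<lambda>n. u0 x $ i)" using oscillating_init[OF sol] by blast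
    ultimately show ?thesis by (simp add: LIMSEQ_const_iff)
  qed
  have sub: "\<tau> + effective_hamiltonian H i x (u (x, t)) p \<le> 0"
    if t: "t > 0" and q: "(p, \<tau>) \<in> superdiff (strip T) (\<lambda>z. u z $ i) (x, t)" for p \<tau> i x t
  proof -
    obtain v L where v: "L-lipschitz_on UNIV v" "Z_periodic v"
      "cell_sup (\<lambda>y q. H i x y (u (x, t)) (p + q)) (effective_hamiltonian H i x (u (x, t)) p) v"
      by (rule effective_corrector)
    obtain B where B: "\<And>y. \<bar>v y\<bar> \<le> B"
      using Z_periodic_bounded[OF v(2) lipschitz_on_continuous_on[OF v(1)]] by blast
    show ?thesis
    proof (rule perturbed_test_function[where G = "H i", OF _ e0 \<epsilon> unc uc lim _ v(1) B _ t q])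
      show "\<exists>d>0. \<forall>x y r p x' y' r' p'.
          norm r \<le> R \<and> norm p \<le> R \<and> norm r' \<le> R \<and> norm p' \<le> R \<and>
          dist x x' < d \<and> dist y y' < d \<and> dist r r' < d \<and> dist p p' < d \<longrightarrow>
          \<bar>H i x y r p - H i x' y' r' p'\<bar> < e" if "e > 0" for R e
        using H_unif[OF that, of R] by blast
      show "\<tau> + H i x (x /\<^sub>R \<epsilon> n) (un n (x, t)) p \<le> 0"
        if "t > 0" "(p, \<tau>) \<in> superdiff (strip T) (\<lambda>z. un n z $ i) (x, t)" for n x t p \<tau>
        by (rule oscillating_sub[OF sol that])
      show "effective_hamiltonian H i x (u (x, t)) p \<le> H i x y (u (x, t)) (p - q)"
        if "q \<in> superdiff UNIV (\<lambda>y. - v y) y" for y q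
        using v(3) that unfolding cell_sup_def by fastforce
    qed
  qed
  have sup: "0 \<le> - \<tau> + effective_hamiltonian H i x (u (x, t)) (- p)"
    if t: "t > 0" and q: "(p, \<tau>) \<in> superdiff (strip T) (\<lambda>z. - u z $ i) (x, t)" for p \<tau> i x t
  proof -
    obtain v L where v: "L-lipschitz_on UNIV v" "Z_periodic v"
      "cell_sub (\<lambda>y q. H i x y (u (x, t)) (- p + q)) (effective_hamiltonian H i x (u (x, t)) (- p)) v"
      by (rule effective_corrector)
    obtain B where B: "\<And>y. \<bar>v y\<bar> \<le> B"
      using Z_periodic_bounded[OF v(2) lipschitz_on_continuous_on[OF v(1)]] by blast
    have "\<tau> + - effective_hamiltonian H i x (u (x, t)) (- p) \<le> 0"
    proof (rule perturbed_test_function[where G = "\<lambda>x y r p. - H i x y (- r) (- p)" and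
          un = "\<lambda>n z. - un n z" and u = "\<lambda>z. - u z" and v = "\<lambda>y. - v y" and L = L and B = B and i = i and
          T = T and \<epsilon> = \<epsilon> and ?x0.0 = x and ?p0.0 = p and ?t0.0 = t])
      show "\<exists>d>0. \<forall>x y r p x' y' r' p'.
          norm r \<le> R \<and> norm p \<le> R \<and> norm r' \<le> R \<and> norm p' \<le> R \<and>
          dist x x' < d \<and> dist y y' < d \<and> dist r r' < d \<and> dist p p' < d \<longrightarrow>
          \<bar>- H i x y (- r) (- p) - - H i x' y' (- r') (- p')\<bar> < e" if "e > 0" for R e
      proof -
        obtain d where d: "d > 0" "\<And>x y r p x' y' r' p'. norm r \<le> R \<Longrightarrow> norm p \<le> R \<Longrightarrow> norm r' \<le> R \<Longrightarrow> norm p' \<le> R \<Longrightarrow>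
          dist x x' < d \<Longrightarrow> dist y y' < d \<Longrightarrow> dist r r' < d \<Longrightarrow> dist p p' < d \<Longrightarrow>
          \<bar>H i x y r p - H i x' y' r' p'\<bar> < e" using H_unif[OF \<open>e > 0\<close>, of R] by blast
        show ?thesis
        proof (intro exI[of _ d] conjI d(1) allI impI)
          fix x y p x' y' p' :: "real^'n" and r r' :: "real^'m"
          assume "norm r \<le> R \<and> norm p \<le> R \<and> norm r' \<le> R \<and> norm p' \<le> R \<and>
            dist x x' < d \<and> dist y y' < d \<and> dist r r' < d \<and> dist p p' < d"
          then have "\<bar>H i x y (- r) (- p) - H i x' y' (- r') (- p')\<bar> < e"
            by (intro d(2)) (auto simp: dist_minus)
          then show "\<bar>- H i x y (- r) (- p) - - H i x' y' (- r') (- p')\<bar> < e" by linarith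
        qed
      qed
      show "\<tau> + - H i x (x /\<^sub>R \<epsilon> n) (- (- un n (x, t))) (- p) \<le> 0"
        if "t > 0" "(p, \<tau>) \<in> superdiff (strip T) (\<lambda>z. (- un n z) $ i) (x, t)" for n x t p \<tau>
        by (rule reflected_sub[OF sol that])
      show "- effective_hamiltonian H i x (u (x, t)) (- p) \<le> - H i x y (- (- u (x, t))) (- (p - q))"
        if "q \<in> superdiff UNIV (\<lambda>y. - (- v y)) y" for y q
        using v(3) that unfolding cell_sub_def by fastforce
      show "uniform_limit K (\<lambda>n z. - un n z) (\<lambda>z. - u z) sequentially" if "compact K" "K \<subseteq> strip T" for K
        by (rule uniform_limit_uminus[OF lim[OF that]])
      show "L-lipschitz_on UNIV (\<lambda>y. - v y)" using v(1) by (simp add: lipschitz_on_def dist_minus)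
      show "(p, \<tau>) \<in> superdiff (strip T) (\<lambda>z. (- u z) $ i) (x, t)" using q by simp
    qed (use e0 \<epsilon> unc uc B t in \<open>auto intro: continuous_on_minus\<close>)
    then show ?thesis by simp
  qed
  show ?thesis
    unfolding visc_solution_def visc_subsolution_def visc_supersolution_def limit_G_def
  proof (intro conjI allI impI)
    fix \<phi> g i x t
    assume "C1_with_gradient \<phi> g \<and> 0 < t \<and> local_max_on (strip T) (\<lambda>z. u z $ i - \<phi> z) (x, t)"
    then show "snd (g (x, t)) + effective_hamiltonian H i x (u (x, t)) (fst (g (x, t))) \<le> 0"
      by (intro sub) (auto simp: superdiff_def)
  next
    fix \<phi> g i x t
    assume *: "C1_with_gradient \<phi> g \<and> 0 < t \<and> local_min_on (strip T) (\<lambda>z. u z $ i - \<phi> z) (x, t)"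
    then have "- g (x, t) \<in> superdiff (strip T) (\<lambda>z. - u z $ i) (x, t)"
      unfolding local_min_iff_max superdiff_def using C1_minus[of \<phi> g] by blast
    then have "(- fst (g (x, t)), - snd (g (x, t))) \<in> superdiff (strip T) (\<lambda>z. - u z $ i) (x, t)"
      by (metis fst_uminus prod.collapse snd_uminus)
    from sup[OF _ this] * show "0 \<le> snd (g (x, t)) + effective_hamiltonian H i x (u (x, t)) (fst (g (x, t)))"
      by simp
  qed (use uc ui init in \<open>auto intro: usc_on_continuous lsc_on_continuous\<close>)
qed

lemma limit_solution_unique:
  assumes "BUC_on (strip T) u" "visc_solution (limit_G H) T u0 u"
    and "BUC_on (strip T) w" "visc_solution (limit_G H) T u0 w" and z: "z \<in> strip T"
  shows "w z = u z"
proof -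
  interpret monotone_nonlinearity "effective_hamiltonian H" by (rule monotone_nonlinearity_effective)
  have "limit_G H = (\<lambda>i x t. effective_hamiltonian H i x)" by (simp add: limit_G_def fun_eq_iff)
  with assms have "w z $ i \<le> u z $ i" "u z $ i \<le> w z $ i" for i
    by (auto simp: visc_solution_def intro!: comparison[OF _ _ _ _ z])
  then show ?thesis by (simp add: vec_eq_iff antisym)
qed

text \<open>The uniform bound and the common modulus pass to pointwise limits, so \<open>u\<close>
  is bounded and uniformly continuous on the whole strip although convergence is only locally
  uniform. This places it in the uniqueness class.\<close>

lemma convergent_subsequence:
  assumes sol: "\<And>n. oscillating_solution (\<epsilon> n) (un n)" and \<epsilon>: "\<epsilon> \<longlonglongrightarrow> 0"
  obtains u r where "strict_mono (r :: nat \<Rightarrow> nat)" "BUC_on (strip T) u" "visc_solution (limit_G H) T u0 u"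
    "\<And>K. compact K \<Longrightarrow> K \<subseteq> strip T \<Longrightarrow> uniform_limit K (\<lambda>n. un (r n)) u sequentially"
proof -
  obtain B where B: "0 \<le> B" "\<And>\<epsilon> u z i. oscillating_solution \<epsilon> u \<Longrightarrow> z \<in> strip T \<Longrightarrow> \<bar>u z $ i\<bar> \<le> B"
    using oscillating_bounded by blast
  have bnd: "norm (un n z) \<le> real CARD('m) * B" if "z \<in> strip T" for n z
    using norm_le_CARD B(2)[OF sol that] by blast
  have equi: "\<exists>d>0. \<forall>n. \<forall>x\<in>strip T. \<forall>y\<in>strip T. dist x y < d \<longrightarrow> dist (un n x) (un n y) < e" if "e > 0" for e
    using oscillating_equicontinuous[OF that] sol by metis
  obtain u r where r: "strict_mono (r :: nat \<Rightarrow> nat)"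
    and lim: "\<And>K. compact K \<Longrightarrow> K \<subseteq> strip T \<Longrightarrow> uniform_limit K (\<lambda>n. un (r n)) u sequentially"
    using equicontinuous_subsequence[OF bnd equi] by blast
  have pt: "(\<lambda>n. un (r n) z) \<longlonglongrightarrow> u z" if "z \<in> strip T" for z
    using tendsto_uniform_limitI[OF lim[of "{z}"]] that by simp
  have "BUC_on (strip T) u"
    unfolding BUC_on_def
  proof
    have "norm (u z) \<le> real CARD('m) * B" if "z \<in> strip T" for z
      by (rule tendsto_upperbound[OF tendsto_norm[OF pt[OF that]]]) (use bnd[OF that] in auto)
    then show "bounded (u ` strip T)" unfolding bounded_iff by blast
    show "uniformly_continuous_on (strip T) u"
      unfolding uniformly_continuous_on_def
    proof (intro allI impI)
      fix e :: real assume "e > 0"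
      then have "e / 2 > 0" by simp
      from equi[OF this] obtain d where d: "d > 0"
        "\<And>n x y. x \<in> strip T \<Longrightarrow> y \<in> strip T \<Longrightarrow> dist x y < d \<Longrightarrow> dist (un n x) (un n y) < e / 2" by blast
      have "dist (u y) (u x) < e" if "x \<in> strip T" "y \<in> strip T" "dist y x < d" for x y
      proof -
        have "\<forall>\<^sub>F n in sequentially. dist (un (r n) y) (un (r n) x) \<le> e / 2"
          using d(2)[OF that(2,1,3)] by (intro always_eventually allI less_imp_le)
        then have "dist (u y) (u x) \<le> e / 2"
          by (rule tendsto_upperbound[OF tendsto_dist[OF pt[OF that(2)] pt[OF that(1)]]]) simp
        then show ?thesis using \<open>e > 0\<close> by linarith
      qed
      with d(1) show "\<exists>d>0. \<forall>x\<in>strip T. \<forall>x'\<in>strip T. dist x' x < d \<longrightarrow> dist (u x') (u x) < e" by blast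
    qed
  qed
  moreover have "(\<lambda>n. \<epsilon> (r n)) \<longlonglongrightarrow> 0" using LIMSEQ_subseq_LIMSEQ[OF \<epsilon> r] by (simp add: o_def)
  from limit_solution[OF sol this _ lim] calculation
  have "visc_solution (limit_G H) T u0 u" by blast
  ultimately show thesis using that[OF r] lim by blast
qed

text \<open>The limit is identified along \<open>1 / real (Suc n)\<close>. If convergence failed on
  some \<open>K\<close>, a sequence of parameters staying at distance \<open>e\<close> from
  \<open>u\<close> would have a subsequence converging to a solution, which uniqueness identifies
  with \<open>u\<close>.\<close>

lemma homogenization:
  assumes sol: "\<And>\<epsilon>. \<epsilon> > 0 \<Longrightarrow> oscillating_solution \<epsilon> (u_eps \<epsilon>)"
  obtains u where "BUC_on (strip T) u" "visc_solution (limit_G H) T u0 u"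
    "\<And>K. compact K \<Longrightarrow> K \<subseteq> strip T \<Longrightarrow> uniform_limit K u_eps u (at_right 0)"
proof -
  have inv: "(\<lambda>n. 1 / real (Suc n)) \<longlonglongrightarrow> 0"
    using LIMSEQ_inverse_real_of_nat by (simp add: inverse_eq_divide)
  have "oscillating_solution (1 / real (Suc n)) (u_eps (1 / real (Suc n)))" for n
    by (rule sol) simp
  from convergent_subsequence[of "\<lambda>n. 1 / real (Suc n)" "\<lambda>n. u_eps (1 / real (Suc n))", OF this inv]
  obtain u where u: "BUC_on (strip T) u" "visc_solution (limit_G H) T u0 u" by blast
  have "uniform_limit K u_eps u (at_right 0)" if K: "compact K" "K \<subseteq> strip T" for K
  proof (rule ccontr)
    assume "\<not> ?thesis"
    then obtain e where e: "e > 0" "\<not> (\<forall>\<^sub>F \<epsilon> in at_right 0. \<forall>z\<in>K. dist (u_eps \<epsilon> z) (u z) < e)"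
      unfolding uniform_limit_iff by blast
    have "\<exists>\<epsilon>>0. \<epsilon> < 1 / real (Suc n) \<and> (\<exists>z\<in>K. e \<le> dist (u_eps \<epsilon> z) (u z))" for n
    proof (rule ccontr)
      assume "\<not> ?thesis"
      then have "\<forall>\<epsilon>>0. \<epsilon> < 1 / real (Suc n) \<longrightarrow> (\<forall>z\<in>K. dist (u_eps \<epsilon> z) (u z) < e)"
        by (meson not_le)
      moreover have "0 < 1 / real (Suc n)" by simp
      ultimately have "\<forall>\<^sub>F \<epsilon> in at_right 0. \<forall>z\<in>K. dist (u_eps \<epsilon> z) (u z) < e"
        unfolding eventually_at_right_field by blast
      with e(2) show False by simp
    qed
    then obtain \<epsilon> where \<epsilon>: "\<And>n. \<epsilon> n > 0" "\<And>n. \<epsilon> n < 1 / real (Suc n)"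
      "\<And>n. \<exists>z\<in>K. e \<le> dist (u_eps (\<epsilon> n) z) (u z)" by metis
    have "\<epsilon> \<longlonglongrightarrow> 0"
      by (rule tendsto_sandwich[OF _ _ tendsto_const inv])
        (use \<epsilon>(1,2) in \<open>auto intro!: always_eventually less_imp_le\<close>)
    from convergent_subsequence[of \<epsilon> "\<lambda>n. u_eps (\<epsilon> n)", OF sol[OF \<epsilon>(1)] this]
    obtain w r where w: "BUC_on (strip T) w" "visc_solution (limit_G H) T u0 w"
      "\<And>K. compact K \<Longrightarrow> K \<subseteq> strip T \<Longrightarrow> uniform_limit K (\<lambda>n. u_eps (\<epsilon> (r n))) w sequentially" by blast
    have "\<forall>\<^sub>F n in sequentially. \<forall>z\<in>K. dist (u_eps (\<epsilon> (r n)) z) (w z) < e"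
      by (rule uniform_limitD[OF w(3)[OF K] e(1)])
    then obtain n where "\<forall>z\<in>K. dist (u_eps (\<epsilon> (r n)) z) (w z) < e"
      unfolding eventually_sequentially by blast
    moreover have "w z = u z" if "z \<in> K" for z
      using limit_solution_unique[OF u w(1,2)] K(2) that by blast
    ultimately show False using \<epsilon>(3)[of "r n"] by fastforce
  qed
  with u show thesis using that by blast
qed

end

theorem theorem5p2:
  fixes T :: real
    and H :: "'m::finite \<Rightarrow> real^'n \<Rightarrow> real^'n \<Rightarrow> real^'m \<Rightarrow> real^'n \<Rightarrow> real"
    and u0 :: "real^'n \<Rightarrow> real^'m"
    and u_eps :: "real \<Rightarrow> (real^'n) \<times> real \<Rightarrow> real^'m"
  assumes "T > 0"
    and "\<forall>j. continuous_on UNIV (\<lambda>(x, y, r, p). H j x y r p)"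
    and "structural_S H"
    and "Mon H"
    and "BUC_on UNIV u0"
    and "\<forall>\<epsilon>>0. BUC_on (strip T) (u_eps \<epsilon>) \<and> visc_solution (oscillating_G H \<epsilon>) T u0 (u_eps \<epsilon>)"
  shows "\<exists>u. BUC_on (strip T) u \<and> visc_solution (limit_G H) T u0 u \<and>
             (\<forall>w. BUC_on (strip T) w \<and> visc_solution (limit_G H) T u0 w \<longrightarrow> (\<forall>z\<in>strip T. w z = u z)) \<and>
             (\<forall>K. compact K \<and> K \<subseteq> strip T \<longrightarrow> uniform_limit K u_eps u (at_right 0))"
proof -
  interpret hamiltonian_problem H T u0
    by unfold_locales (use assms in auto)
  obtain u where u: "BUC_on (strip T) u" "visc_solution (limit_G H) T u0 u"
    "\<And>K. compact K \<Longrightarrow> K \<subseteq> strip T \<Longrightarrow> uniform_limit K u_eps u (at_right 0)"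
  proof (rule homogenization[of u_eps])
    show "oscillating_solution \<epsilon> (u_eps \<epsilon>)" if "\<epsilon> > 0" for \<epsilon>
      using assms(6) that by (simp add: oscillating_solution_def)
  qed blast
  then show ?thesis using limit_solution_unique by blast
qed

end
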